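(* Let $n\ge 2$, $\frac12<s<1$, let $\Omega\subset\mathbb{R}^n$ be open, and let $u:\mathbb{R}^n\to\mathbb{R}$ be Lipschitz continuous with constant $L>0$ and semiconcave in $\mathbb{R}^n$ with constant $C>0$. Suppose there is a constant $\eta_0>0$ such that $$(1-s)\,\mathcal{D}_s u(x)\ge \eta_0\qquad\forall x\in\Omega$$ in the viscosity sense. Let $\mu_0,\mu_1$ be the constants (depending only on $n,s,L,C,\eta_0$) defined in the context. Then for every $\theta$ with $$0<\theta<\left(\frac{\mu_0}{n\,\mu_1}\right)^{\frac{n-1}{2s}}$$ one has $$\mathcal{D}_s u(x)=\mathcal{D}_s^{\theta}u(x)\qquad\forall x\in\Omega$$ in the classical sense (i.e. both sides are evaluated pointwise from their definitions).
   Context: Notation: $\delta(u,x,y)=u(x+y)+u(x-y)-2u(x)$. $A>0$ means $A$ is a symmetric positive definite $n\times n$ real matrix; $\lambda_{\min}(A)$ is its smallest eigenvalue. $u$ is semiconcave in $\mathbb{R}^n$ with constant $C$ if it is continuous and $\delta(u,x,y)\le C|y|^2$ for all $x,y\in\mathbb{R}^n$. Operators: $$\mathcal{D}_s u(x)=\inf\Big\{\tfrac12\int_{\mathbb{R}^n}\frac{\delta(u,x,y)}{|A^{-1}y|^{n+2s}}\,dy\ \Big|\ A>0,\ \det A=1\Big\},$$ $$\mathcal{D}_s^{\theta} u(x)=\inf\Big\{\tfrac12\int_{\mathbb{R}^n}\frac{\delta(u,x,y)}{|A^{-1}y|^{n+2s}}\,dy\ \Big|\ A>0,\ \det A=1,\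 \lambda_{\min}(A)\ge\theta\Big\}.$$ Viscosity sense: a function $u:\mathbb{R}^n\to\mathbb{R}$, upper semicontinuous in $\overline\Omega$, satisfies $\mathcal{D}_su\ge f$ in $\Omega$ in the viscosity sense if, whenever $x\in\Omega$, $N\subset\Omega$ is an open neighborhood of $x$, $\psi$ is $C^2$ in $\overline N$, $\psi(x)=u(x)$ and $\psi(y)>u(y)$ for every $y\in N\setminus\{x\}$, the function $v$ equal to $\psi$ in $N$ and to $u$ in $\mathbb{R}^n\setminus N$ satisfies $\mathcal{D}_sv(x)\ge f(x)$. The hypothesis is this condition with $f\equiv\eta_0/(1-s)$. Constants: $\omega_k=\mathcal{H}^{k-1}(\partial B_1^k(0))=\frac{2\pi^{k/2}}{\Gamma(k/2)}$ (the measure of the unit sphere in $\mathbb{R}^k$) and $$\mu_1=\frac{1-s}{2}\int_{\mathbb{R}}\frac{\min\{2L|t|,C|t|^2\}}{|t|^{1+2s}}\,dt=\frac{L^{2-2s}}{2s-1}\Big(\frac C2\Big)^{2s-1},$$ $$C_1=\frac{\sqrt\pi\,\Gamma(\frac{n-1}{2}+s)}{\Gamma(\frac n2+s)}\cdot\frac{\mu_1\omega_{n-1}}{2},\qquad C_2=\omega_{n-1}\,\frac{\Gamma(\frac{n-1}{2})\Gamma(s+\frac12)}{2\,\Gamma(\frac n2+s)},\qquad \mu_0=C_1^{1-n}C_2^{-1}\Big(\frac{\eta_0}{2}\Big)^n.$$ *)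

theory Defs
  imports "HOL-Analysis.Analysis"
begin

definition delta :: "('a::real_vector \<Rightarrow> real) \<Rightarrow> 'a \<Rightarrow> 'a \<Rightarrow> real" where
  "delta u x y = u (x + y) + u (x - y) - 2 * u x"

definition semiconcave :: "real \<Rightarrow> ('a::real_normed_vector \<Rightarrow> real) \<Rightarrow> bool" where
  "semiconcave C u \<longleftrightarrow>
     continuous_on UNIV u \<and> (\<forall>x y. delta u x y \<le> C * (norm y)\<^sup>2)"

definition positive_definite :: "real ^ 'n ^ 'n \<Rightarrow> bool" where
  "positive_definite A \<longleftrightarrow> transpose A = A \<and> (\<forall>x. x \<noteq> 0 \<longrightarrow> x \<bullet> (A *v x) > 0)"

definition eigenvalue :: "real ^ 'n ^ 'n \<Rightarrow> real \<Rightarrow> bool" where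
  "eigenvalue A l \<longleftrightarrow> (\<exists>v. v \<noteq> 0 \<and> A *v v = l *\<^sub>R v)"

text \<open>Only used for symmetric matrices, whose set of real eigenvalues is finite and nonempty.\<close>

definition lambda_min :: "real ^ 'n ^ 'n \<Rightarrow> real" where
  "lambda_min A = Min {l. eigenvalue A l}"

text \<open>
  The Lebesgue integral with values in the extended reals, i.e. the integral of the positive part
  minus the integral of the negative part (\<^const>\<open>ennreal\<close> truncates negative reals to 0).
  The Bochner integral would not do: it gives 0 to a divergent integral, whereas here the integral
  of \<open>delta u x\<close> against the kernel may be \<open>-\<infinity>\<close> for a semiconcave Lipschitz \<open>u\<close>, and
  \<open>+\<infinity>\<close> for a function \<open>v\<close> arising in the viscosity condition. The undefined case
  \<open>\<infinity> - \<infinity>\<close> occurs for neither (with \<open>1/2 < s < 1\<close>).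
\<close>

definition ereal_integral :: "('a::euclidean_space \<Rightarrow> real) \<Rightarrow> ereal" where
  "ereal_integral f =
     enn2ereal (\<integral>\<^sup>+ y. ennreal (f y) \<partial>lborel) - enn2ereal (\<integral>\<^sup>+ y. ennreal (- f y) \<partial>lborel)"

text \<open>At \<open>y = 0\<close> the integrand is 0 by the convention \<open>a / 0 = 0\<close>; this is a null set.\<close>

definition L_op :: "real \<Rightarrow> real ^ 'n ^ 'n \<Rightarrow> (real ^ 'n \<Rightarrow> real) \<Rightarrow> real ^ 'n \<Rightarrow> ereal" where
  "L_op s A u x =
     ereal (1/2) *
       ereal_integral (\<lambda>y. delta u x y / norm (matrix_inv A *v y) powr (real CARD('n) + 2 * s))"

definition D_op :: "real \<Rightarrow> (real ^ 'n \<Rightarrow> real) \<Rightarrow> real ^ 'n \<Rightarrow> ereal" where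
  "D_op s u x = Inf {L_op s A u x | A. positive_definite A \<and> det A = 1}"

definition D_op_theta :: "real \<Rightarrow> real \<Rightarrow> (real ^ 'n \<Rightarrow> real) \<Rightarrow> real ^ 'n \<Rightarrow> ereal" where
  "D_op_theta s \<theta> u x =
     Inf {L_op s A u x | A. positive_definite A \<and> det A = 1 \<and> lambda_min A \<ge> \<theta>}"

definition usc_on :: "'a::topological_space set \<Rightarrow> ('a \<Rightarrow> real) \<Rightarrow> bool" where
  "usc_on S u \<longleftrightarrow> (\<forall>x\<in>S. \<forall>a>u x. \<forall>\<^sub>F y in at x within S. u y < a)"

text \<open>
  For open \<open>N\<close>: \<open>\<psi>\<close> is twice continuously differentiable in \<open>N\<close>, and \<open>\<psi>\<close>, its gradient
  and its Hessian extend continuously to the closure of \<open>N\<close>. Only the values of \<open>\<psi>\<close> on that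
  closure matter.
\<close>

definition C2_closure :: "(real ^ 'n) set \<Rightarrow> (real ^ 'n \<Rightarrow> real) \<Rightarrow> bool" where
  "C2_closure N \<psi> \<longleftrightarrow>
     (\<exists>(G :: real ^ 'n \<Rightarrow> real ^ 'n) (H :: real ^ 'n \<Rightarrow> real ^ 'n ^ 'n).
        (\<forall>x\<in>N. (\<psi> has_derivative (\<lambda>h. G x \<bullet> h)) (at x)) \<and>
        (\<forall>x\<in>N. (G has_derivative (\<lambda>h. H x *v h)) (at x)) \<and>
        continuous_on (closure N) \<psi> \<and>
        continuous_on (closure N) G \<and>
        continuous_on (closure N) H)"

definition viscosity_D_ge ::
  "real \<Rightarrow> (real ^ 'n \<Rightarrow> real) \<Rightarrow> (real ^ 'n \<Rightarrow> real) \<Rightarrow> (real ^ 'n) set \<Rightarrow> bool" where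
  "viscosity_D_ge s u f \<Omega> \<longleftrightarrow>
     usc_on (closure \<Omega>) u \<and>
     (\<forall>x N \<psi>. x \<in> \<Omega> \<longrightarrow> open N \<longrightarrow> x \<in> N \<longrightarrow> N \<subseteq> \<Omega> \<longrightarrow> C2_closure N \<psi> \<longrightarrow>
        \<psi> x = u x \<longrightarrow> (\<forall>y\<in>N - {x}. \<psi> y > u y) \<longrightarrow>
        D_op s (\<lambda>y. if y \<in> N then \<psi> y else u y) x \<ge> ereal (f x))"

definition omega :: "nat \<Rightarrow> real" where
  "omega k = 2 * pi powr (real k / 2) / Gamma (real k / 2)"

definition mu1 :: "real \<Rightarrow> real \<Rightarrow> real \<Rightarrow> real" where
  "mu1 s L C =
     (1 - s) / 2 *
       (\<integral>t. min (2 * L * \<bar>t\<bar>) (C * \<bar>t\<bar>\<^sup>2) / \<bar>t\<bar> powr (1 + 2 * s) \<partial>lborel)"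

definition C1 :: "nat \<Rightarrow> real \<Rightarrow> real \<Rightarrow> real \<Rightarrow> real" where
  "C1 n s L C =
     sqrt pi * Gamma ((real n - 1) / 2 + s) / Gamma (real n / 2 + s) *
       (mu1 s L C * omega (n - 1) / 2)"

definition C2 :: "nat \<Rightarrow> real \<Rightarrow> real" where
  "C2 n s =
     omega (n - 1) * (Gamma ((real n - 1) / 2) * Gamma (s + 1/2) / (2 * Gamma (real n / 2 + s)))"

definition mu0 :: "nat \<Rightarrow> real \<Rightarrow> real \<Rightarrow> real \<Rightarrow> real \<Rightarrow> real" where
  "mu0 n s L C \<eta> =
     C1 n s L C powi (1 - int n) * inverse (C2 n s) * (\<eta> / 2) ^ n"

end

theory Submission
  imports Defs
begin

text \<open>
  Fix \<open>x \<in> \<Omega>\<close> and write \<open>d = delta u x\<close>, \<open>m(r) = min (2 L r) (C r^2)\<close>; then \<open>d(y) \<le> m(|y|)\<close>.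
  After the substitution \<open>y = A z\<close> the operator is
  \<open>L_A u(x) = 1/2 \<integral> d(A z) |z|^{-n-2s} dz\<close>, and in polar coordinates it becomes an average over
  directions: up to a constant, \<open>\<integral> |A z|^{2s} I(A z / |A z|)\<close>, where
  \<open>I(e) = \<integral>_0^\<infinity> d(t e) t^{-1-2s} dt\<close> is a one-dimensional fractional Laplacian. If all the values
  \<open>(1-s) I(e)\<close> lie between two positive constants, then \<open>L_A u(x)\<close> is comparable to \<open>\<integral> |A z|^{2s}\<close>, so a
  matrix with a large eigenvalue cannot compete with the identity matrix in the infimum. As \<open>det A = 1\<close>,
  a small eigenvalue forces a large one. So a matrix with \<open>lambda_min A < \<theta>\<close> does not lower the infimum.

  The upper bound \<open>(1-s) I(e) \<le> mu1\<close> is the majorant \<open>m\<close>. The lower bound \<open>(1-s) I(e) \<ge> mu0\<close> is the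
  heart of the matter (\<open>directional_lower_bound\<close>). It uses two things.

  \<^item> The viscosity hypothesis holds pointwise for every matrix: \<open>L_A u(x) \<ge> \<eta>_0/(1-s)\<close>. Semiconcavity
    provides a paraboloid that touches \<open>u\<close> from above at \<open>x\<close>; it is used as a test function on balls
    that shrink to \<open>x\<close> (\<open>viscosity_imp_kernel_inequality\<close>).

  \<^item> For a matrix \<open>A\<close> that scales the direction \<open>e\<close> by \<open>a\<close> and the orthogonal directions
    by \<open>b\<close>, averaging \<open>d\<close> over the reflection in the axis \<open>e\<close> and applying the bound \<open>m\<close> at the points
    \<open>x \<plusminus> v\<close> of the line gives \<open>\<eta>_0 \<le> C2 a^{2s} (1-s) I(e) + C1 b^{2s}\<close>. With \<open>a b^{n-1} = 1\<close> and
    \<open>C1 b^{2s} = \<eta>_0/2\<close> this is \<open>(1-s) I(e) \<ge> mu0\<close>.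

  For the final comparison, let \<open>\<Lambda>\<close> be the largest eigenvalue and \<open>w\<close> its unit eigenvector. Then
  \<open>|A z| \<ge> \<Lambda> |z \<bullet> w|\<close>, and by symmetry \<open>|z \<bullet> w|^{2s}\<close> has at least \<open>1/n\<close> of the average of \<open>|z|^{2s}\<close>; so
  \<open>L_A u(x) \<ge> L_I u(x)\<close> as soon as \<open>mu0 \<Lambda>^{2s} \<ge> n mu1\<close> (\<open>L_op_identity_le\<close>). The bound
  \<open>1 \<le> lambda_min A * \<Lambda>^{n-1}\<close> turns this into the condition on \<open>\<theta>\<close>. Moreover \<open>mu0 \<le> mu1\<close> gives
  \<open>\<theta> \<le> 1\<close>, so the identity matrix is admissible in the restricted infimum.

  Positive and negative parts are kept apart throughout, as integrals with values in \<open>[0,\<infinity>]\<close>, because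
  the negative part of \<open>d\<close> need not be integrable a priori. An inequality between integrals is therefore
  stated in the form \<open>negative part + constant \<le> positive part\<close>.

  Polar coordinates are replaced by integration against a Gaussian (\<open>kernel_integral_eq_gaussian_ray_integral\<close>):
  by Tonelli and scaling, \<open>\<integral> exp(-|z|^2) \<integral>_0^\<infinity> f(t z) t^{-1-2s} dt dz\<close> is \<open>\<Gamma>(n/2+s)/2\<close> times
  \<open>\<integral> f(z) |z|^{-n-2s} dz\<close>. The constants \<open>C1\<close> and \<open>C2\<close> are then Gaussian moments, which split
  into one-dimensional Gamma integrals.
\<close>

section \<open>Linear changes of variables in Lebesgue integrals\<close>

text \<open>
  Fubini with one coordinate singled out. The remaining coordinates are kept as a family indexed by
  \<open>Basis - {b}\<close>, since the hyperplane orthogonal to \<open>b\<close> has no type of its own.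
\<close>

lemma nn_integral_split_coordinate:
  fixes f :: "'a::euclidean_space \<Rightarrow> ennreal"
  assumes [measurable]: "f \<in> borel_measurable borel" and b: "b \<in> Basis"
  shows "(\<integral>\<^sup>+z. f z \<partial>lborel) =
    (\<integral>\<^sup>+x. (\<integral>\<^sup>+t. f (t *\<^sub>R b + (\<Sum>i\<in>Basis - {b}. x i *\<^sub>R i)) \<partial>lborel) \<partial>Pi\<^sub>M (Basis - {b}) (\<lambda>_. lborel))"
proof -
  interpret product_sigma_finite "\<lambda>_::'a. lborel :: real measure"
    by standard
  have ins: "Basis = insert b (Basis - {b})" using b by auto
  have "(\<integral>\<^sup>+z. f z \<partial>lborel) = (\<integral>\<^sup>+x. f (\<Sum>i\<in>Basis. x i *\<^sub>R i) \<partial>Pi\<^sub>M Basis (\<lambda>_. lborel))"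
    by (subst lborel_eq, subst nn_integral_distr) auto
  also have "\<dots> = (\<integral>\<^sup>+x. f (\<Sum>i\<in>Basis. x i *\<^sub>R i) \<partial>Pi\<^sub>M (insert b (Basis - {b})) (\<lambda>_. lborel))"
    using ins by simp
  also have "\<dots> = (\<integral>\<^sup>+x. (\<integral>\<^sup>+t. f (\<Sum>i\<in>Basis. (x(b:=t)) i *\<^sub>R i) \<partial>lborel) \<partial>Pi\<^sub>M (Basis - {b}) (\<lambda>_. lborel))"
    by (subst product_nn_integral_insert) (auto simp flip: ins)
  also have "\<dots> = (\<integral>\<^sup>+x. (\<integral>\<^sup>+t. f (t *\<^sub>R b + (\<Sum>i\<in>Basis - {b}. x i *\<^sub>R i)) \<partial>lborel) \<partial>Pi\<^sub>M (Basis - {b}) (\<lambda>_. lborel))"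
    by (intro nn_integral_cong arg_cong[where f=f])
       (subst sum.remove[OF finite_Basis b], auto intro!: sum.cong)
  finally show ?thesis .
qed

lemma borel_measurable_matrix_mult [measurable]:
  fixes A :: "real^'n^'n"
  shows "(\<lambda>z. A *v z) \<in> borel_measurable borel"
  by (intro borel_measurable_continuous_onI linear_continuous_on)
    (simp add: matrix_vector_mul_bounded_linear)

text \<open>
  For fixed values of the other coordinates, the shear is a translation of the coordinate along \<open>b\<close>.
\<close>

lemma nn_integral_shear:
  fixes f :: "'a::euclidean_space \<Rightarrow> ennreal"
  assumes [measurable]: "f \<in> borel_measurable borel"
    and b: "b \<in> Basis" and c: "c \<in> Basis" "c \<noteq> b"
  shows "(\<integral>\<^sup>+z. f (z + (z \<bullet> c) *\<^sub>R b) \<partial>lborel) = (\<integral>\<^sup>+z. f z \<partial>lborel)"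
proof -
  have "(\<integral>\<^sup>+z. f (z + (z \<bullet> c) *\<^sub>R b) \<partial>lborel) =
    (\<integral>\<^sup>+x. (\<integral>\<^sup>+t. f ((x c + 1 * t) *\<^sub>R b + (\<Sum>i\<in>Basis - {b}. x i *\<^sub>R i)) \<partial>lborel)
       \<partial>Pi\<^sub>M (Basis - {b}) (\<lambda>_. lborel))"
  proof (subst nn_integral_split_coordinate[OF _ b], measurable, intro nn_integral_cong)
    fix x :: "'a \<Rightarrow> real" and t :: real
    let ?z = "t *\<^sub>R b + (\<Sum>i\<in>Basis - {b}. x i *\<^sub>R i)"
    have "?z \<bullet> c = (\<Sum>i\<in>Basis - {b}. x i * (i \<bullet> c))"
      using b c by (simp add: inner_add_left inner_sum_left inner_Basis)
    also have "\<dots> = (\<Sum>i\<in>Basis - {b}. if i = c then x i else 0)"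
      using c by (intro sum.cong) (auto simp: inner_Basis)
    also have "\<dots> = x c" using c by simp
    finally show "f (?z + (?z \<bullet> c) *\<^sub>R b) = f ((x c + 1 * t) *\<^sub>R b + (\<Sum>i\<in>Basis - {b}. x i *\<^sub>R i))"
      by (simp add: algebra_simps)
  qed
  also have "\<dots> = (\<integral>\<^sup>+x. (\<integral>\<^sup>+t. f (t *\<^sub>R b + (\<Sum>i\<in>Basis - {b}. x i *\<^sub>R i)) \<partial>lborel)
       \<partial>Pi\<^sub>M (Basis - {b}) (\<lambda>_. lborel))"
  proof (rule nn_integral_cong)
    fix x :: "'a \<Rightarrow> real"
    show "(\<integral>\<^sup>+t. f ((x c + 1 * t) *\<^sub>R b + (\<Sum>i\<in>Basis - {b}. x i *\<^sub>R i)) \<partial>lborel) =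
          (\<integral>\<^sup>+t. f (t *\<^sub>R b + (\<Sum>i\<in>Basis - {b}. x i *\<^sub>R i)) \<partial>lborel)"
      by (subst (2) nn_integral_real_affine[where c=1 and t="x c"]) auto
  qed
  also have "\<dots> = (\<integral>\<^sup>+z. f z \<partial>lborel)"
    by (rule nn_integral_split_coordinate[OF _ b, symmetric]) simp
  finally show ?thesis .
qed

text \<open>
  A swap permutes the side lengths of each box, and boxes determine Lebesgue measure.
\<close>

lemma nn_integral_coordinate_swap:
  fixes f :: "real^'n \<Rightarrow> ennreal"
  assumes [measurable]: "f \<in> borel_measurable borel"
  shows "(\<integral>\<^sup>+z. f (\<chi> i. z $ Transposition.transpose m n i) \<partial>lborel) = (\<integral>\<^sup>+z. f z \<partial>lborel)"
proof -
  let ?h = "\<lambda>z::real^'n. (\<chi> i. z $ Transposition.transpose m n i)"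
  have lin: "linear ?h"
    by (rule linearI) (simp_all add: plus_vec_def scaleR_vec_def)
  have [measurable]: "?h \<in> borel_measurable borel"
    by (intro borel_measurable_continuous_onI linear_continuous_on) (use lin in \<open>simp add: linear_conv_bounded_linear\<close>)
  have "lborel = distr lborel borel ?h"
  proof (rule lborel_eqI)
    fix l u :: "real^'n" assume le: "\<And>b. b \<in> Basis \<Longrightarrow> l \<bullet> b \<le> u \<bullet> b"
    have le': "l $ i \<le> u $ i" for i
      using le[of "axis i 1"] by (simp add: inner_axis axis_in_Basis_iff)
    have vim: "?h -` box l u = box (?h l) (?h u)"
      by (auto simp: mem_box_cart) (metis transpose_involutory)+
    have prod: "(\<Prod>b\<in>Basis. (u - l) \<bullet> b) = (\<Prod>i\<in>UNIV. (u - l) $ i)" for u l :: "real^'n"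
      by (simp add: Basis_vec_def axis_eq_axis inner_axis' prod.UNION_disjoint cart_eq_inner_axis)
    have "emeasure (distr lborel borel ?h) (box l u) = emeasure lborel (box (?h l) (?h u))"
      by (subst emeasure_distr) (auto simp: vim)
    also have "\<dots> = (\<Prod>b\<in>Basis. (?h u - ?h l) \<bullet> b)"
    proof (rule emeasure_lborel_box)
      fix b :: "real^'n" assume "b \<in> Basis"
      then obtain i where "b = axis i 1" by (auto simp: Basis_vec_def)
      then show "?h l \<bullet> b \<le> ?h u \<bullet> b" by (simp add: inner_axis le')
    qed
    also have "(\<Prod>b\<in>Basis. (?h u - ?h l) \<bullet> b) = (\<Prod>i\<in>UNIV. (u - l) $ Transposition.transpose m n i)"
      by (subst prod) simp
    also have "\<dots> = (\<Prod>i\<in>UNIV. (u - l) $ i)"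
      by (rule prod.permute[where p="Transposition.transpose m n", unfolded o_def, symmetric])
         (simp add: permutes_swap_id)
    also have "\<dots> = (\<Prod>b\<in>Basis. (u - l) \<bullet> b)" by (rule prod[symmetric])
    finally show "emeasure (distr lborel borel ?h) (box l u) = ennreal (\<Prod>b\<in>Basis. (u - l) \<bullet> b)" .
  qed simp
  then have "(\<integral>\<^sup>+z. f z \<partial>lborel) = (\<integral>\<^sup>+z. f z \<partial>distr lborel borel ?h)" by simp
  also have "\<dots> = (\<integral>\<^sup>+z. f (?h z) \<partial>lborel)" by (rule nn_integral_distr) auto
  finally show ?thesis ..
qed

lemma nn_integral_coordinate_scaling:
  fixes f :: "real^'n \<Rightarrow> ennreal"
  assumes [measurable]: "f \<in> borel_measurable borel" and c: "\<And>i. c i \<noteq> 0"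
  shows "ennreal \<bar>\<Prod>i\<in>UNIV. c i\<bar> * (\<integral>\<^sup>+z. f (\<chi> i. c i * z $ i) \<partial>lborel) = (\<integral>\<^sup>+z. f z \<partial>lborel)"
proof -
  \<comment> \<open>the diagonal entries, reindexed by the standard basis vectors\<close>
  define c' :: "real^'n \<Rightarrow> real" where "c' j = c (SOME i. j = axis i 1)" for j
  have c'ax: "c' (axis i 1) = c i" for i
    by (simp add: c'_def axis_eq_axis)
  have T: "(\<Sum>j\<in>Basis. (c' j * (x \<bullet> j)) *\<^sub>R j) = (\<chi> i. c i * x $ i)" for x
  proof -
    have "(\<Sum>j\<in>Basis. (c' j * (x \<bullet> j)) *\<^sub>R j) = (\<Sum>i\<in>UNIV. (c i * x $ i) *\<^sub>R axis i 1)"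
      by (simp add: Basis_vec_def sum.UNION_disjoint axis_eq_axis c'ax inner_axis)
    also have "\<dots> = (\<chi> i. c i * x $ i)"
      by (simp add: vec_eq_iff axis_def if_distrib cong: if_cong)
    finally show ?thesis .
  qed
  have P: "(\<Prod>j\<in>Basis. \<bar>c' j\<bar>) = \<bar>\<Prod>i\<in>UNIV. c i\<bar>"
    by (simp add: Basis_vec_def prod.UNION_disjoint axis_eq_axis c'ax abs_prod)
  have c'0: "c' j \<noteq> 0" if "j \<in> Basis" for j using c by (simp add: c'_def)
  have "lborel = density (distr lborel borel (\<lambda>x. \<chi> i. c i * x $ i)) (\<lambda>_. ennreal \<bar>\<Prod>i\<in>UNIV. c i\<bar>)"
    using lborel_affine_euclidean[of c' 0] c'0 by (simp add: T P)
  then have "(\<integral>\<^sup>+z. f z \<partial>lborel) = (\<integral>\<^sup>+z. f z \<partial>density (distr lborel borel (\<lambda>x. \<chi> i. c i * x $ i)) (\<lambda>_. ennreal \<bar>\<Prod>i\<in>UNIV. c i\<bar>))"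
    by simp
  also have "\<dots> = ennreal \<bar>\<Prod>i\<in>UNIV. c i\<bar> * (\<integral>\<^sup>+z. f (\<chi> i. c i * z $ i) \<partial>lborel)"
  proof -
    have "linear (\<lambda>x::real^'n. \<chi> i. c i * x $ i)"
      by (rule linearI) (simp_all add: vec_eq_iff algebra_simps)
    then have [measurable]: "(\<lambda>x::real^'n. \<chi> i. c i * x $ i) \<in> borel_measurable borel"
      by (intro borel_measurable_continuous_onI linear_continuous_on) (simp add: linear_conv_bounded_linear)
    show ?thesis
      by (simp add: nn_integral_density nn_integral_distr nn_integral_cmult)
  qed
  finally show ?thesis ..
qed

text \<open>
  The formula is multiplicative in \<open>A\<close>, so it is enough to check it for elementary matrices.
\<close>

lemma nn_integral_matrix_image:
  fixes A :: "real^'n^'n" and f :: "real^'n \<Rightarrow> ennreal"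
  assumes "f \<in> borel_measurable borel" "det A \<noteq> 0"
  shows "ennreal \<bar>det A\<bar> * (\<integral>\<^sup>+z. f (A *v z) \<partial>lborel) = (\<integral>\<^sup>+z. f z \<partial>lborel)"
proof -
  define P :: "real^'n^'n \<Rightarrow> bool" where "P A \<longleftrightarrow> (det A \<noteq> 0 \<longrightarrow> (\<forall>f::real^'n\<Rightarrow>ennreal. f \<in> borel_measurable borel \<longrightarrow>
     ennreal \<bar>det A\<bar> * (\<integral>\<^sup>+z. f (A *v z) \<partial>lborel) = (\<integral>\<^sup>+z. f z \<partial>lborel)))" for A
  have "P A"
  proof (rule induct_matrix_elementary_alt)
    fix A B assume "P A" "P B"
    show "P (A ** B)"
      unfolding P_def
    proof (intro impI allI)
      fix f :: "real^'n \<Rightarrow> ennreal"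
      assume det: "det (A ** B) \<noteq> 0" and [measurable]: "f \<in> borel_measurable borel"
      have [measurable]: "(\<lambda>z. f (A *v z)) \<in> borel_measurable borel" by measurable
      have "ennreal \<bar>det (A ** B)\<bar> * (\<integral>\<^sup>+z. f ((A ** B) *v z) \<partial>lborel) =
        ennreal \<bar>det A\<bar> * (ennreal \<bar>det B\<bar> * (\<integral>\<^sup>+z. f (A *v (B *v z)) \<partial>lborel))"
        by (simp add: det_mul abs_mult ennreal_mult' mult.assoc matrix_vector_mul_assoc)
      also have "\<dots> = ennreal \<bar>det A\<bar> * (\<integral>\<^sup>+z. f (A *v z) \<partial>lborel)"
        using \<open>P B\<close>[unfolded P_def, rule_format, of "\<lambda>z. f (A *v z)"] det by (simp add: det_mul)
      also have "\<dots> = (\<integral>\<^sup>+z. f z \<partial>lborel)"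
        using \<open>P A\<close>[unfolded P_def] det by (auto simp: det_mul)
      finally show "ennreal \<bar>det (A ** B)\<bar> * (\<integral>\<^sup>+z. f ((A ** B) *v z) \<partial>lborel) = (\<integral>\<^sup>+z. f z \<partial>lborel)" .
    qed
  next
    fix A :: "real^'n^'n" and i assume "row i A = 0"
    then show "P A" using det_zero_row(2) by (auto simp: P_def)
  next
    fix A :: "real^'n^'n" assume diag: "\<And>i j. i \<noteq> j \<Longrightarrow> A $ i $ j = 0"
    have "A $ i $ i * x $ i = (\<Sum>j\<in>UNIV. A $ i $ j * x $ j)" for x and i :: 'n
      by (simp add: diag sum.remove[where x=i])
    then have Av: "A *v z = (\<chi> i. A $ i $ i * z $ i)" for z
      by (auto simp: matrix_vector_mult_def)
    have det: "det A = (\<Prod>i\<in>UNIV. A $ i $ i)"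
      using diag by (rule det_diagonal)
    show "P A"
      unfolding P_def det Av
      by (intro impI allI nn_integral_coordinate_scaling) auto
  next
    fix m n :: 'n assume "m \<noteq> n"
    let ?M = "(\<chi> i j. mat 1 $ i $ Transposition.transpose m n j) :: real^'n^'n"
    have Mv: "?M *v z = (\<chi> i. z $ Transposition.transpose m n i)" for z
    proof -
      have "(\<Sum>j\<in>UNIV. (if i = Transposition.transpose m n j then 1 else 0) * z $ j)
         = (\<Sum>j\<in>UNIV. if j = Transposition.transpose m n i then z $ j else 0)" for i
        by (intro sum.cong) auto
      then show ?thesis by (simp add: matrix_vector_mult_def mat_def vec_eq_iff)
    qed
    have "\<bar>det ?M\<bar> = 1"
      by (simp add: det_permute_columns permutes_swap_id sign_swap_id abs_mult)
    then show "P ?M" unfolding P_def Mv by (simp add: nn_integral_coordinate_swap)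
  next
    fix m n :: 'n assume mn: "m \<noteq> n"
    let ?M = "(\<chi> i j. of_bool (i = m \<and> j = n \<or> i = j)) :: real^'n^'n"
    have Mv: "?M *v z = z + (z \<bullet> axis n 1) *\<^sub>R axis m 1" for z
    proof -
      have "(\<Sum>j\<in>UNIV. of_bool (i = m \<and> j = n \<or> i = j) * z $ j) =
        (\<Sum>j\<in>UNIV. (if j = i then z $ j else 0) + (if j = n then (if i = m then z $ n else 0) else 0))" for i
        using mn by (intro sum.cong) auto
      then show ?thesis
        by (simp add: matrix_vector_mult_def vec_eq_iff sum.distrib cart_eq_inner_axis[symmetric])
          (simp add: axis_def)
    qed
    have "?M = (\<chi> k. if k = m then row m (mat 1) + 1 *s row n (mat 1) else row k (mat 1))"
      using mn by (auto simp: vec_eq_iff row_def mat_def)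
    then have "det ?M = 1"
      using det_row_operation[OF mn, of "mat 1" 1] by simp
    then show "P ?M" unfolding P_def Mv using mn
      by (auto intro!: nn_integral_shear simp: axis_eq_axis axis_in_Basis_iff)
  qed
  then show ?thesis using assms by (auto simp: P_def)
qed

lemma nn_integral_orthogonal_transformation:
  fixes T :: "real^'n \<Rightarrow> real^'n" and f :: "real^'n \<Rightarrow> ennreal"
  assumes f: "f \<in> borel_measurable borel" and T: "orthogonal_transformation T"
  shows "(\<integral>\<^sup>+z. f (T z) \<partial>lborel) = (\<integral>\<^sup>+z. f z \<partial>lborel)"
proof -
  have "\<bar>det (matrix T)\<bar> = 1" using T by (rule orthogonal_transformation_det)
  moreover have "matrix T *v z = T z" for z
    using T by (simp add: matrix_works orthogonal_transformation_linear)
  ultimately show ?thesis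
    using nn_integral_matrix_image[OF f, of "matrix T"] by simp
qed

section \<open>Gaussian integrals\<close>

text \<open>
  The substitution \<open>v = c t^q\<close> in the Gamma integral. Both signs of \<open>q\<close> are needed: \<open>q = 2\<close> gives the
  Gaussian moments, \<open>q = -2\<close> the inner integral of the identity that replaces polar coordinates.
\<close>

lemma nn_integral_powr_mult_exp:
  fixes p q c :: real
  assumes q: "q \<noteq> 0" and pq: "p / q > 0" and c: "c > 0"
  shows "(\<integral>\<^sup>+t. ennreal (t powr (p - 1) * exp (- (c * t powr q)) * indicator {0<..} t) \<partial>lborel) =
    ennreal (Gamma (p / q) / \<bar>q\<bar> * c powr (- (p / q)))"
proof -
  define f :: "real \<Rightarrow> real" where "f v = v powr (p / q - 1) * exp (- v)" for v
  define g :: "real \<Rightarrow> real" where "g t = c * t powr q" for t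
  define g' :: "real \<Rightarrow> real" where "g' t = c * (q * t powr (q - 1))" for t
  have der: "(g has_field_derivative g' t) (at t within {0<..})" if "t \<in> {0<..}" for t
  proof -
    have "((\<lambda>t. t powr q) has_field_derivative q * t powr (q - 1)) (at t)"
      using that by (intro has_real_derivative_powr) auto
    from DERIV_cmult[OF this, of c] show ?thesis
      unfolding g_def g'_def by (rule has_field_derivative_at_within)
  qed
  have inj: "inj_on g {0<..}"
  proof (rule inj_onI)
    fix x y assume "x \<in> {0<..}" "y \<in> {0<..}" "g x = g y"
    then have "(x powr q) powr (1 / q) = (y powr q) powr (1 / q)"
      using c by (simp add: g_def)
    then show "x = y" using \<open>x \<in> {0<..}\<close> \<open>y \<in> {0<..}\<close> q by (simp add: powr_powr)
  qed
  have im: "g ` {0<..} = {0<..}"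
  proof (intro set_eqI iffI)
    fix v :: real assume "v \<in> {0<..}"
    then have "g ((v / c) powr (1 / q)) = v" "(v / c) powr (1 / q) \<in> {0<..}"
      using c q by (auto simp: g_def powr_powr)
    then show "v \<in> g ` {0<..}" by (metis imageI)
  qed (use c in \<open>auto simp: g_def\<close>)
  have "((\<lambda>v. v powr (p / q - 1) / exp v) has_integral Gamma (p / q)) {0..}"
    using Gamma_integral_real[OF pq] .
  moreover have "f = (\<lambda>v. v powr (p / q - 1) / exp v)"
    by (simp add: f_def fun_eq_iff exp_minus field_simps)
  ultimately have "(f has_integral Gamma (p / q)) {0..}"
    by simp
  then have fi: "(f has_integral Gamma (p / q)) {0<..}"
  proof (subst has_integral_spike_set_eq[where T="{0..}"])
    have "{v \<in> {0..} - {0<..}. f v \<noteq> 0} \<subseteq> {0}" by auto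
    then show "negligible {v \<in> {0..} - {0<..}. f v \<noteq> 0}"
      by (rule negligible_subset[OF negligible_sing])
    have "{v \<in> {0<..} - {0..}. f v \<noteq> 0} = {}" by auto
    then show "negligible {v \<in> {0<..} - {0..}. f v \<noteq> 0}" by (simp only: negligible_empty)
  qed
  then have "f absolutely_integrable_on {0<..}"
    by (intro nonnegative_absolutely_integrable_1) (auto simp: f_def intro: has_integral_integrable)
  with fi have "(\<lambda>t. \<bar>g' t\<bar> * f (g t)) absolutely_integrable_on {0<..} \<and>
      integral {0<..} (\<lambda>t. \<bar>g' t\<bar> * f (g t)) = Gamma (p / q)"
    by (subst has_absolute_integral_change_of_variables_1'[OF _ der inj])
       (auto simp: im integral_unique)
  then have gi: "((\<lambda>t. \<bar>g' t\<bar> * f (g t)) has_integral Gamma (p / q)) {0<..}"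
    using absolutely_integrable_on_def has_integral_integrable_integral by blast
  have eq: "\<bar>g' t\<bar> * f (g t) = \<bar>q\<bar> * c powr (p / q) * (t powr (p - 1) * exp (- (c * t powr q)))"
    if "t > 0" for t
  proof -
    have "\<bar>g' t\<bar> * f (g t) = \<bar>q\<bar> * (c * c powr (p / q - 1)) * (t powr (q - 1) * t powr (q * (p / q - 1))) * exp (- (c * t powr q))"
      using c that by (simp add: g'_def f_def g_def abs_mult powr_mult powr_powr mult_ac)
    also have "c * c powr (p / q - 1) = c powr (p / q)"
      using c by (simp add: powr_diff)
    also have "t powr (q - 1) * t powr (q * (p / q - 1)) = t powr (p - 1)"
      using q that by (simp add: powr_add[symmetric] algebra_simps)
    finally show ?thesis by (simp add: mult_ac)
  qed
  have "((\<lambda>t. \<bar>q\<bar> * c powr (p / q) * (t powr (p - 1) * exp (- (c * t powr q)))) has_integral Gamma (p / q)) {0<..}"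
    using gi by (rule has_integral_eq[rotated]) (use eq in auto)
  from has_integral_mult_right[OF this, of "inverse (\<bar>q\<bar> * c powr (p / q))"]
  have "((\<lambda>t. t powr (p - 1) * exp (- (c * t powr q))) has_integral
      (Gamma (p / q) / \<bar>q\<bar> * c powr (- (p / q)))) {0<..}"
    using c q by (simp add: powr_minus field_simps)
  from nn_integral_has_integral_lebesgue[OF _ this]
  show ?thesis
    by (simp add: mult_ac ennreal_mult' ennreal_indicator)
qed

lemma nn_integral_gaussian_moment:
  assumes "p > 0"
  shows "(\<integral>\<^sup>+t. ennreal (t powr (p - 1) * exp (- t\<^sup>2) * indicator {0<..} t) \<partial>lborel) = ennreal (Gamma (p / 2) / 2)"
proof -
  have "(\<integral>\<^sup>+t. ennreal (t powr (p - 1) * exp (- t\<^sup>2) * indicator {0<..} t) \<partial>lborel) =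
     (\<integral>\<^sup>+t. ennreal (t powr (p - 1) * exp (- (1 * t powr 2)) * indicator {0<..} t) \<partial>lborel)"
    by (intro nn_integral_cong) (auto simp: indicator_def)
  then show ?thesis using nn_integral_powr_mult_exp[of 2 p 1] assms by simp
qed

lemma nn_integral_gaussian_abs_moment:
  assumes "p > 0"
  shows "(\<integral>\<^sup>+t. ennreal (\<bar>t\<bar> powr (p - 1) * exp (- t\<^sup>2)) \<partial>lborel) = ennreal (Gamma (p / 2))"
proof -
  let ?f = "\<lambda>t::real. ennreal (t powr (p - 1) * exp (- t\<^sup>2) * indicator {0<..} t)"
  have "(\<integral>\<^sup>+t. ennreal (\<bar>t\<bar> powr (p - 1) * exp (- t\<^sup>2)) \<partial>lborel) = (\<integral>\<^sup>+t. ?f t + ?f (- t) \<partial>lborel)"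
  proof (rule nn_integral_cong_AE)
    have "AE t in lborel. t \<noteq> (0::real)" by (rule AE_lborel_singleton)
    then show "AE t in lborel. ennreal (\<bar>t\<bar> powr (p - 1) * exp (- t\<^sup>2)) = ?f t + ?f (- t)"
    proof eventually_elim
      case (elim t)
      then show ?case by (cases "t > 0") (simp_all add: indicator_def)
    qed
  qed
  also have "\<dots> = (\<integral>\<^sup>+t. ?f t \<partial>lborel) + (\<integral>\<^sup>+t. ?f (- t) \<partial>lborel)"
    by (rule nn_integral_add) auto
  also have "(\<integral>\<^sup>+t. ?f (- t) \<partial>lborel) = (\<integral>\<^sup>+t. ?f t \<partial>lborel)"
    by (subst (2) nn_integral_real_affine[where c="-1" and t=0]) auto
  finally show ?thesis
    using Gamma_real_pos[of "p/2"] assms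
    by (simp add: nn_integral_gaussian_moment ennreal_plus[symmetric] del: ennreal_plus)
qed

lemma nn_integral_gaussian_real: "(\<integral>\<^sup>+t. ennreal (exp (- t\<^sup>2)) \<partial>lborel) = ennreal (sqrt pi)"
proof -
  have "(\<integral>\<^sup>+t. ennreal (exp (- t\<^sup>2)) \<partial>lborel) = (\<integral>\<^sup>+t. ennreal (\<bar>t\<bar> powr (1 - 1) * exp (- t\<^sup>2)) \<partial>lborel)"
  proof (rule nn_integral_cong_AE)
    have "AE t in lborel. t \<noteq> (0::real)" by (rule AE_lborel_singleton)
    then show "AE t in lborel. ennreal (exp (- t\<^sup>2)) = ennreal (\<bar>t\<bar> powr (1 - 1) * exp (- t\<^sup>2))"
      by eventually_elim simp
  qed
  then show ?thesis
    using nn_integral_gaussian_abs_moment[of 1] by (simp add: Gamma_one_half_real)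
qed

text \<open>
  The ball of radius \<open>r\<close> in \<open>\<real>^J\<close> has volume \<open>V r^k\<close> with \<open>k = card J\<close>, so the image of Lebesgue
  measure under the Euclidean norm has distribution function \<open>V r^k\<close> and density \<open>k V r^(k-1)\<close>, where
  \<open>k V = omega k\<close> is the area of the unit sphere. An index set in place of a type lets \<open>k\<close> be one less
  than the dimension of the ambient space.
\<close>

lemma nn_integral_radial_PiM:
  fixes f :: "real \<Rightarrow> ennreal"
  assumes J: "finite J" "J \<noteq> {}" and f[measurable]: "f \<in> borel_measurable borel"
  shows "(\<integral>\<^sup>+x. f (sqrt (\<Sum>i\<in>J. (x i)\<^sup>2)) \<partial>Pi\<^sub>M J (\<lambda>_. lborel)) =
    (\<integral>\<^sup>+r. ennreal (omega (card J) * r ^ (card J - 1) * indicator {0<..} r) * f r \<partial>lborel)"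
proof -
  define m where "m = card J"
  have m: "m \<ge> 1" using J by (simp add: m_def Suc_leI card_gt_0_iff)
  have om: "omega m = m * unit_ball_vol m"
  proof -
    have "real m / 2 \<notin> \<int>\<^sub>\<le>\<^sub>0" using m by (auto elim!: nonpos_Ints_cases)
    then have G: "Gamma (real m / 2 + 1) = real m / 2 * Gamma (real m / 2)" by (rule Gamma_plus1)
    show ?thesis unfolding omega_def unit_ball_vol_def G using m by simp
  qed
  let ?P = "Pi\<^sub>M J (\<lambda>_. lborel) :: ('a \<Rightarrow> real) measure"
  let ?\<rho> = "\<lambda>x. sqrt (\<Sum>i\<in>J. (x i)\<^sup>2)"
  let ?D = "density lborel (\<lambda>r::real. ennreal (omega m * r ^ (m - 1) * indicator {0<..} r))"
  have [measurable]: "?\<rho> \<in> ?P \<rightarrow>\<^sub>M borel" by measurable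
  have om0: "omega m \<ge> 0" using m by (simp add: om)
  have D: "emeasure ?D {..r} = ennreal (unit_ball_vol m * r ^ m)" if "r \<ge> 0" for r
  proof -
    have "((\<lambda>r. unit_ball_vol m * r ^ m) has_real_derivative omega m * r ^ (m - 1)) (at r within {0..r'})" for r r'
      unfolding om by (auto intro!: derivative_eq_intros)
    then have hi: "((\<lambda>r. omega m * r ^ (m - 1)) has_integral (unit_ball_vol m * r ^ m - unit_ball_vol m * 0 ^ m)) {0..r}"
      using that by (intro fundamental_theorem_of_calculus) (auto simp: has_real_derivative_iff_has_vector_derivative)
    have "emeasure ?D {..r} = (\<integral>\<^sup>+x. ennreal (omega m * x ^ (m - 1) * indicator {0<..} x) * indicator {..r} x \<partial>lborel)"
      by (subst emeasure_density) auto
    also have "\<dots> = (\<integral>\<^sup>+x. ennreal (indicator {0..r} x * (omega m * x ^ (m - 1))) \<partial>lborel)"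
      by (intro nn_integral_cong_AE AE_I[of _ _ "{0}"]) (auto simp: indicator_def split: if_splits)
    also have "\<dots> = ennreal (unit_ball_vol m * r ^ m)"
      using nn_integral_has_integral_lebesgue[OF _ hi] om0 m by (simp add: zero_power)
    finally show ?thesis .
  qed
  have "distr ?P borel ?\<rho> = ?D"
  proof (rule measure_eqI_generator_eq[where E="range (\<lambda>r. {..r})" and A="\<lambda>i. {.. real i}" and \<Omega>=UNIV])
    show "Int_stable (range (\<lambda>r::real. {..r}))"
      by (auto simp: Int_stable_def)
    show "emeasure (distr ?P borel ?\<rho>) X = emeasure ?D X" if Xr: "X \<in> range (\<lambda>r. {..r})" for X
    proof -
      obtain r where X: "X = {..r}" using Xr by auto
      have vim: "emeasure (distr ?P borel ?\<rho>) {..r} = emeasure ?P ({x. ?\<rho> x \<le> r} \<inter> space ?P)" for r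
        by (subst emeasure_distr) (auto intro!: arg_cong[where f="emeasure ?P"])
      consider "r > 0" | "r = 0" | "r < 0" by linarith
      then show ?thesis
      proof cases
        case 1
        then show ?thesis unfolding X vim using D[of r]
          by (subst emeasure_cball_aux[OF J(1) 1]) (simp add: m_def)
      next
        case 2
        have D0: "emeasure ?D {..0} = 0" using D[of 0] m by (simp add: zero_power)
        \<comment> \<open>The volume formula is for positive radii; the origin is null, being contained in every small ball.\<close>
        have small: "emeasure (distr ?P borel ?\<rho>) {..0} \<le> 0 + ennreal e" if "e > 0" for e
        proof -
          define r where "r = min 1 (e / unit_ball_vol m)"
          have r: "r > 0" "r \<le> 1" "unit_ball_vol m * r \<le> e"
            using that by (auto simp: r_def min_def field_simps)
          have "emeasure (distr ?P borel ?\<rho>) {..0} \<le> emeasure (distr ?P borel ?\<rho>) {..r}"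
            using r by (intro emeasure_mono) auto
          also have "\<dots> = ennreal (unit_ball_vol m * r ^ m)"
            unfolding vim by (subst emeasure_cball_aux[OF J(1) r(1)]) (simp add: m_def)
          also have "\<dots> \<le> ennreal e"
          proof (rule ennreal_leI)
            have "r ^ m \<le> r ^ 1" using r m by (intro power_decreasing) auto
            then have "unit_ball_vol m * r ^ m \<le> unit_ball_vol m * r" by (intro mult_left_mono) auto
            then show "unit_ball_vol m * r ^ m \<le> e" using r(3) by linarith
          qed
          finally show ?thesis by simp
        qed
        have "emeasure (distr ?P borel ?\<rho>) {..0} \<le> 0"
          by (rule ennreal_le_epsilon) (rule small)
        then show ?thesis using D0 by (simp add: X 2)
      next
        case 3
        have "\<not> ?\<rho> x \<le> r" for x :: "'a \<Rightarrow> real"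
        proof -
          have "?\<rho> x \<ge> 0" by (simp add: sum_nonneg)
          then show ?thesis using 3 by linarith
        qed
        then have "{x. ?\<rho> x \<le> r} \<inter> space ?P = {}" by auto
        then have e1: "emeasure (distr ?P borel ?\<rho>) {..r} = 0" unfolding vim by simp
        have "emeasure ?D {..r} \<le> emeasure ?D {..0}" using 3 by (intro emeasure_mono) auto
        also have "\<dots> = 0" using D[of 0] m by (simp add: zero_power)
        finally show ?thesis using e1 by (simp add: X)
      qed
    qed
    show "emeasure (distr ?P borel ?\<rho>) {..real i} \<noteq> \<infinity>" for i
    proof -
      have vim: "emeasure (distr ?P borel ?\<rho>) {..r} = emeasure ?P ({x. ?\<rho> x \<le> r} \<inter> space ?P)" for r
        by (subst emeasure_distr) (auto intro!: arg_cong[where f="emeasure ?P"])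
      have "emeasure (distr ?P borel ?\<rho>) {..real i} \<le> emeasure (distr ?P borel ?\<rho>) {..real (Suc i)}"
        by (intro emeasure_mono) auto
      also have "\<dots> < \<infinity>"
        unfolding vim by (subst emeasure_cball_aux[OF J(1)]) auto
      finally show ?thesis by simp
    qed
    show "(\<Union>i. {..real i}) = UNIV" using real_arch_simple by auto
    show "range (\<lambda>i. {..real i}) \<subseteq> range (\<lambda>r. {..r})" by auto
  qed (auto simp: borel_eq_atMost)
  then have "(\<integral>\<^sup>+r. f r \<partial>distr ?P borel ?\<rho>) = (\<integral>\<^sup>+r. f r \<partial>?D)" by simp
  then show ?thesis
    by (simp add: nn_integral_distr nn_integral_density m_def)
qed

lemma sum_Basis_components:
  fixes b :: "'a::euclidean_space"
  assumes b: "b \<in> Basis"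
  defines "z t x \<equiv> t *\<^sub>R b + (\<Sum>i\<in>Basis - {b}. x i *\<^sub>R i)"
  shows "z t x \<bullet> b = t" "norm (z t x - t *\<^sub>R b) = sqrt (\<Sum>i\<in>Basis - {b}. (x i)\<^sup>2)"
proof -
  have w: "(\<Sum>i\<in>Basis - {b}. x i *\<^sub>R i) \<bullet> c = (if c = b then 0 else x c)" if "c \<in> Basis" for c
  proof -
    have "(\<Sum>i\<in>Basis - {b}. x i *\<^sub>R i) \<bullet> c = (\<Sum>i\<in>Basis - {b}. if i = c then x i else 0)"
      unfolding inner_sum_left using that by (intro sum.cong) (auto simp: inner_Basis)
    then show ?thesis using that by (auto simp: sum.delta)
  qed
  show zb: "z t x \<bullet> b = t" using b w[OF b] by (simp add: z_def inner_add_left inner_Basis)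
  have nw: "(norm (\<Sum>i\<in>Basis - {b}. x i *\<^sub>R i))\<^sup>2 = (\<Sum>i\<in>Basis - {b}. (x i)\<^sup>2)"
  proof -
    let ?w = "\<Sum>i\<in>Basis - {b}. x i *\<^sub>R i"
    have "(norm ?w)\<^sup>2 = ?w \<bullet> ?w" by (simp add: power2_norm_eq_inner)
    also have "\<dots> = (\<Sum>c\<in>Basis. (?w \<bullet> c) * (?w \<bullet> c))" by (rule euclidean_inner)
    also have "\<dots> = (\<Sum>c\<in>Basis. if c = b then 0 else (x c)\<^sup>2)"
      by (intro sum.cong) (auto simp: w power2_eq_square)
    also have "\<dots> = (\<Sum>i\<in>Basis - {b}. (x i)\<^sup>2)"
      using b by (subst sum.remove[OF _ b]) (auto intro!: sum.cong)
    finally show ?thesis .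
  qed
  show "norm (z t x - t *\<^sub>R b) = sqrt (\<Sum>i\<in>Basis - {b}. (x i)\<^sup>2)"
    unfolding nw[symmetric] by (simp add: z_def)
qed

text \<open>
  Cylindrical coordinates about the axis \<open>b\<close>, for a product of a function of the height and a function
  of the distance to the axis.
\<close>

lemma nn_integral_cylindrical:
  fixes b :: "'a::euclidean_space" and f :: "real \<Rightarrow> ennreal" and g :: "real \<Rightarrow> ennreal"
  assumes [measurable]: "f \<in> borel_measurable borel" "g \<in> borel_measurable borel"
    and b: "b \<in> Basis" and dim: "DIM('a) \<ge> 2"
  shows "(\<integral>\<^sup>+z. f (z \<bullet> b) * g (norm (z - (z \<bullet> b) *\<^sub>R b)) \<partial>lborel) =
    (\<integral>\<^sup>+t. f t \<partial>lborel) *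
    (\<integral>\<^sup>+r. ennreal (omega (DIM('a) - 1) * r ^ (DIM('a) - 2) * indicator {0<..} r) * g r \<partial>lborel)"
proof -
  let ?J = "Basis - {b}"
  have J: "finite ?J" "card ?J = DIM('a) - 1" using b by auto
  have J': "?J \<noteq> {}"
  proof
    assume "?J = {}"
    then have "card ?J = 0" by (simp only: card.empty)
    then show False using J dim by simp
  qed
  have "(\<integral>\<^sup>+z. f (z \<bullet> b) * g (norm (z - (z \<bullet> b) *\<^sub>R b)) \<partial>lborel) =
    (\<integral>\<^sup>+x. (\<integral>\<^sup>+t. f t * g (sqrt (\<Sum>i\<in>?J. (x i)\<^sup>2)) \<partial>lborel) \<partial>Pi\<^sub>M ?J (\<lambda>_. lborel))"
    by (subst nn_integral_split_coordinate[OF _ b]) (simp_all only: sum_Basis_components[OF b], measurable)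
  also have "\<dots> = (\<integral>\<^sup>+x. (\<integral>\<^sup>+t. f t \<partial>lborel) * g (sqrt (\<Sum>i\<in>?J. (x i)\<^sup>2)) \<partial>Pi\<^sub>M ?J (\<lambda>_. lborel))"
    by (intro nn_integral_cong) (simp add: nn_integral_multc)
  also have "\<dots> = (\<integral>\<^sup>+t. f t \<partial>lborel) * (\<integral>\<^sup>+x. g (sqrt (\<Sum>i\<in>?J. (x i)\<^sup>2)) \<partial>Pi\<^sub>M ?J (\<lambda>_. lborel))"
    by (rule nn_integral_cmult) measurable
  also have "(\<integral>\<^sup>+x. g (sqrt (\<Sum>i\<in>?J. (x i)\<^sup>2)) \<partial>Pi\<^sub>M ?J (\<lambda>_. lborel)) =
    (\<integral>\<^sup>+r. ennreal (omega (DIM('a) - 1) * r ^ (DIM('a) - 2) * indicator {0<..} r) * g r \<partial>lborel)"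
    by (subst nn_integral_radial_PiM[OF J(1) J']) (simp_all add: J numeral_2_eq_2)
  finally show ?thesis .
qed

section \<open>The kernel as an average over rays\<close>

text \<open>
  The numerator may have any sign: \<^const>\<open>ennreal\<close> cuts off negative values, so this is the integral of
  the positive part of \<open>f\<close>, and \<open>kernel_integral s (\<lambda>z. - f z)\<close> is that of the negative part.
\<close>

definition kernel_integral :: "real \<Rightarrow> ('a::euclidean_space \<Rightarrow> real) \<Rightarrow> ennreal" where
  "kernel_integral s f = (\<integral>\<^sup>+z. ennreal (f z / norm z powr (real DIM('a) + 2 * s)) \<partial>lborel)"

text \<open>
  Likewise the integral of the positive part. The ray is traversed with speed \<open>|z|\<close>, so that the value is
  homogeneous of degree \<open>2 s\<close> in \<open>z\<close>.
\<close>

definition ray_integral :: "real \<Rightarrow> ('a::euclidean_space \<Rightarrow> real) \<Rightarrow> 'a \<Rightarrow> ennreal" where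
  "ray_integral s f z =
     (\<integral>\<^sup>+t. ennreal (f (t *\<^sub>R z) / t powr (1 + 2 * s) * indicator {0<..} t) \<partial>lborel)"

lemma borel_measurable_ray_integral [measurable]:
  fixes f :: "'a::euclidean_space \<Rightarrow> real"
  assumes [measurable]: "f \<in> borel_measurable borel"
  shows "ray_integral s f \<in> borel_measurable borel"
  unfolding ray_integral_def by measurable

lemma ray_integral_scaleR:
  fixes f :: "'a::euclidean_space \<Rightarrow> real"
  assumes [measurable]: "f \<in> borel_measurable borel" and c: "c > 0"
  shows "ray_integral s f (c *\<^sub>R z) = ennreal (c powr (2 * s)) * ray_integral s f z"
proof -
  let ?h = "\<lambda>t. ennreal (f (t *\<^sub>R z) / t powr (1 + 2 * s) * indicator {0<..} t)"
  have "ennreal (c powr (2 * s)) * ray_integral s f z = ennreal (c powr (2 * s)) * (ennreal c * (\<integral>\<^sup>+t. ?h (c * t) \<partial>lborel))"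
    unfolding ray_integral_def by (subst nn_integral_real_affine[where c=c and t=0]) (use c in auto)
  also have "\<dots> = ennreal (c powr (1 + 2 * s)) * (\<integral>\<^sup>+t. ?h (c * t) \<partial>lborel)"
    using c by (simp add: powr_add ennreal_mult' mult_ac)
  also have "\<dots> = (\<integral>\<^sup>+t. ennreal (c powr (1 + 2 * s)) * ?h (c * t) \<partial>lborel)"
    by (rule nn_integral_cmult[symmetric]) measurable
  also have "\<dots> = ray_integral s f (c *\<^sub>R z)"
    unfolding ray_integral_def
  proof (rule nn_integral_cong)
    fix t :: real
    show "ennreal (c powr (1 + 2 * s)) * ?h (c * t) =
        ennreal (f (t *\<^sub>R c *\<^sub>R z) / t powr (1 + 2 * s) * indicator {0<..} t)"
      using c by (auto simp: indicator_def powr_mult mult_ac zero_less_mult_iff simp flip: ennreal_mult')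
  qed
  finally show ?thesis ..
qed

text \<open>
  The condition \<open>f 0 = 0\<close> covers \<open>z = 0\<close>: there \<open>sgn z = 0\<close>, and both sides vanish.
\<close>

lemma ray_integral_homogeneous:
  fixes f :: "'a::euclidean_space \<Rightarrow> real"
  assumes f: "f \<in> borel_measurable borel" "f 0 = 0"
  shows "ray_integral s f z = ennreal (norm z powr (2 * s)) * ray_integral s f (sgn z)"
proof (cases "z = 0")
  case True
  then show ?thesis by (simp add: ray_integral_def f)
next
  case False
  then have "z = norm z *\<^sub>R sgn z" by (simp add: sgn_div_norm)
  then show ?thesis using ray_integral_scaleR[OF f(1), of "norm z" s "sgn z"] False by simp
qed

lemma ray_integral_mono:
  assumes "\<And>t. t > 0 \<Longrightarrow> f (t *\<^sub>R z) \<le> g (t *\<^sub>R w)"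
  shows "ray_integral s f z \<le> ray_integral s g w"
  unfolding ray_integral_def
  by (intro nn_integral_mono ennreal_leI) (auto simp: indicator_def intro!: divide_right_mono assms)

lemma nn_integral_scaleR:
  fixes f :: "'a::euclidean_space \<Rightarrow> ennreal"
  assumes [measurable]: "f \<in> borel_measurable borel" and c: "c > 0"
  shows "ennreal (c ^ DIM('a)) * (\<integral>\<^sup>+z. f (c *\<^sub>R z) \<partial>lborel) = (\<integral>\<^sup>+z. f z \<partial>lborel)"
proof -
  have "(\<integral>\<^sup>+z. f z \<partial>lborel) = (\<integral>\<^sup>+z. f z \<partial>density (distr lborel borel (\<lambda>x. 0 + c *\<^sub>R x)) (\<lambda>_. \<bar>c\<bar> ^ DIM('a)))"
    using lborel_affine[of c "0::'a"] c by simp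
  also have "\<dots> = ennreal (c ^ DIM('a)) * (\<integral>\<^sup>+z. f (c *\<^sub>R z) \<partial>lborel)"
    using c by (simp add: nn_integral_density nn_integral_distr nn_integral_cmult)
  finally show ?thesis ..
qed

text \<open>
  This takes the place of polar coordinates. Exchange the two integrals on the right and substitute
  \<open>y = t z\<close>; the weight that multiplies \<open>f(y)\<close> is then \<open>\<integral>_0^\<infinity> t^(-n-2s-1) exp(-|y|^2 / t^2) dt\<close>, which by
  homogeneity is a constant times \<open>|y|^(-n-2s)\<close>.
\<close>

lemma kernel_integral_eq_gaussian_ray_integral:
  fixes f :: "'a::euclidean_space \<Rightarrow> real"
  assumes [measurable]: "f \<in> borel_measurable borel" and s: "s > 0"
  shows "ennreal (Gamma (real DIM('a) / 2 + s) / 2) * kernel_integral s f =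
    (\<integral>\<^sup>+z. ennreal (exp (- (norm z)\<^sup>2)) * ray_integral s f z \<partial>lborel)"
proof -
  define N where "N = real DIM('a)"
  have N: "N > 0" by (simp add: N_def)
  let ?k = "\<lambda>t z. ennreal (f z) * ennreal (t powr (- (N + 2 * s) - 1) * exp (- ((norm z)\<^sup>2 * t powr (-2))) * indicator {0<..} t)"
  have "(\<integral>\<^sup>+z. ennreal (exp (- (norm z)\<^sup>2)) * ray_integral s f z \<partial>lborel) =
    (\<integral>\<^sup>+z. (\<integral>\<^sup>+t. ennreal (exp (- (norm z)\<^sup>2)) * ennreal (f (t *\<^sub>R z) / t powr (1 + 2 * s) * indicator {0<..} t) \<partial>lborel) \<partial>lborel)"
    unfolding ray_integral_def by (intro nn_integral_cong nn_integral_cmult[symmetric]) measurable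
  also have "\<dots> = (\<integral>\<^sup>+t. (\<integral>\<^sup>+z. ennreal (exp (- (norm z)\<^sup>2)) * ennreal (f (t *\<^sub>R z) / t powr (1 + 2 * s) * indicator {0<..} t) \<partial>lborel) \<partial>lborel)"
    by (rule lborel_pair.Fubini'[symmetric]) measurable
  also have "\<dots> = (\<integral>\<^sup>+t. (\<integral>\<^sup>+z. ?k t z \<partial>lborel) \<partial>lborel)"
  proof (rule nn_integral_cong)
    fix t :: real
    show "(\<integral>\<^sup>+z. ennreal (exp (- (norm z)\<^sup>2)) * ennreal (f (t *\<^sub>R z) / t powr (1 + 2 * s) * indicator {0<..} t) \<partial>lborel) =
      (\<integral>\<^sup>+z. ?k t z \<partial>lborel)"
    proof (cases "t > 0")
      case True
      have "(\<integral>\<^sup>+z. ?k t z \<partial>lborel) = ennreal (t ^ DIM('a)) * (\<integral>\<^sup>+z. ?k t (t *\<^sub>R z) \<partial>lborel)"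
        using True by (intro nn_integral_scaleR[symmetric]) measurable
      also have "\<dots> = (\<integral>\<^sup>+z. ennreal (t ^ DIM('a)) * ?k t (t *\<^sub>R z) \<partial>lborel)"
        by (rule nn_integral_cmult[symmetric]) measurable
      also have "\<dots> = (\<integral>\<^sup>+z. ennreal (exp (- (norm z)\<^sup>2)) * ennreal (f (t *\<^sub>R z) / t powr (1 + 2 * s) * indicator {0<..} t) \<partial>lborel)"
      proof (rule nn_integral_cong)
        fix z :: 'a
        \<comment> \<open>powers of \<open>t\<close> after the substitution: the Jacobian \<open>t^n\<close> against \<open>t^(-n-2s-1)\<close>\<close>
        have e1: "t ^ DIM('a) * t powr (- (N + 2 * s) - 1) = 1 / t powr (1 + 2 * s)"
          using True by (simp add: N_def powr_diff powr_minus powr_add powr_realpow field_simps)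
        have e2: "(norm (t *\<^sub>R z))\<^sup>2 * t powr (-2) = (norm z)\<^sup>2"
          using True by (simp add: power_mult_distrib powr_minus powr_numeral field_simps)
        have "ennreal (t ^ DIM('a)) * ?k t (t *\<^sub>R z) =
          ennreal (f (t *\<^sub>R z)) * ennreal (t ^ DIM('a) * t powr (- (N + 2 * s) - 1) * exp (- ((norm (t *\<^sub>R z))\<^sup>2 * t powr (-2))))"
          using True by (simp add: ennreal_mult' mult_ac)
        also have "\<dots> = ennreal (exp (- (norm z)\<^sup>2)) * ennreal (f (t *\<^sub>R z) / t powr (1 + 2 * s))"
          unfolding e1 e2 by (simp add: mult_ac flip: ennreal_mult'' ennreal_mult')
        finally show "ennreal (t ^ DIM('a)) * ?k t (t *\<^sub>R z) =
            ennreal (exp (- (norm z)\<^sup>2)) * ennreal (f (t *\<^sub>R z) / t powr (1 + 2 * s) * indicator {0<..} t)"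
          using True by simp
      qed
      finally show ?thesis ..
    qed simp
  qed
  also have "\<dots> = (\<integral>\<^sup>+z. (\<integral>\<^sup>+t. ?k t z \<partial>lborel) \<partial>lborel)"
    by (rule lborel_pair.Fubini') measurable
  also have "\<dots> = (\<integral>\<^sup>+z. ennreal (Gamma (N / 2 + s) / 2) * ennreal (f z / norm z powr (N + 2 * s)) \<partial>lborel)"
  proof (rule nn_integral_cong_AE)
    have "AE z in lborel. z \<noteq> (0::'a)" by (rule AE_lborel_singleton)
    then show "AE z in lborel. (\<integral>\<^sup>+t. ?k t z \<partial>lborel) = ennreal (Gamma (N / 2 + s) / 2) * ennreal (f z / norm z powr (N + 2 * s))"
    proof eventually_elim
      case (elim z)
      have G: "Gamma (N / 2 + s) > 0" using N s by (intro Gamma_real_pos) auto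
      have "(\<integral>\<^sup>+t. ?k t z \<partial>lborel) = ennreal (f z) *
          (\<integral>\<^sup>+t. ennreal (t powr (- (N + 2 * s) - 1) * exp (- ((norm z)\<^sup>2 * t powr (-2))) * indicator {0<..} t) \<partial>lborel)"
        by (rule nn_integral_cmult) measurable
      also have "\<dots> = ennreal (f z) * ennreal (Gamma (- (N + 2 * s) / - 2) / \<bar>- 2\<bar> * (norm z)\<^sup>2 powr (- (- (N + 2 * s) / - 2)))"
        using N s elim by (subst nn_integral_powr_mult_exp) auto
      \<comment> \<open>the Gamma integral above with \<open>p = -(n+2s)\<close>, \<open>q = -2\<close>, \<open>c = |z|^2\<close>\<close>
      also have "- (N + 2 * s) / - 2 = N / 2 + s" by (simp add: field_simps)
      also have "(norm z)\<^sup>2 powr - (N / 2 + s) = 1 / norm z powr (N + 2 * s)"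
      proof -
        have e1: "(norm z)\<^sup>2 = norm z powr 2" using elim by simp
        have e2: "2 * - (N / 2 + s) = - (N + 2 * s)" by (simp add: field_simps)
        show ?thesis unfolding e1 powr_powr e2 by (rule powr_minus_divide)
      qed
      also have "ennreal (f z) * ennreal (Gamma (N / 2 + s) / \<bar>- 2\<bar> * (1 / norm z powr (N + 2 * s))) =
        ennreal (Gamma (N / 2 + s) / 2) * ennreal (f z / norm z powr (N + 2 * s))"
        using G by (simp add: mult_ac flip: ennreal_mult'' ennreal_mult')
      finally show ?case .
    qed
  qed
  also have "\<dots> = ennreal (Gamma (N / 2 + s) / 2) * kernel_integral s f"
    unfolding kernel_integral_def N_def by (rule nn_integral_cmult) measurable
  finally show ?thesis by (simp add: N_def)
qed

text \<open>
  A linear map sends rays to rays, so it only changes the weight and the direction of each ray.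
\<close>

lemma kernel_integral_linear_image:
  fixes A :: "'a::euclidean_space \<Rightarrow> 'b::euclidean_space"
  assumes f: "f \<in> borel_measurable borel" "f 0 = 0" and s: "s > 0" and A: "linear A"
  shows "ennreal (Gamma (real DIM('a) / 2 + s) / 2) * kernel_integral s (\<lambda>z. f (A z)) =
    (\<integral>\<^sup>+z. ennreal (exp (- (norm z)\<^sup>2)) * (ennreal (norm (A z) powr (2 * s)) * ray_integral s f (sgn (A z))) \<partial>lborel)"
proof -
  have [measurable]: "A \<in> borel_measurable borel"
    using A by (intro borel_measurable_continuous_onI linear_continuous_on) (simp add: linear_conv_bounded_linear)
  have [measurable]: "f \<in> borel_measurable borel" by fact
  have "ray_integral s (\<lambda>z. f (A z)) z = ray_integral s f (A z)" for z
    by (simp add: ray_integral_def linear_scale[OF A])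
  also have "\<dots> z = ennreal (norm (A z) powr (2 * s)) * ray_integral s f (sgn (A z))" for z
    by (rule ray_integral_homogeneous[OF f])
  finally show ?thesis
    by (subst kernel_integral_eq_gaussian_ray_integral[OF _ s]) simp_all
qed

lemma norm_orthogonal_component:
  fixes b :: "'a::euclidean_space"
  assumes "norm b = 1"
  shows "(norm z)\<^sup>2 = (z \<bullet> b)\<^sup>2 + (norm (z - (z \<bullet> b) *\<^sub>R b))\<^sup>2"
proof -
  have "b \<bullet> b = 1" using assms by (simp add: norm_eq_1)
  then have "(norm (z - (z \<bullet> b) *\<^sub>R b))\<^sup>2 = (norm z)\<^sup>2 - (z \<bullet> b)\<^sup>2"
    unfolding power2_norm_eq_inner
    by (simp add: inner_diff_left inner_diff_right inner_commute power2_eq_square)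
  then show ?thesis by simp
qed

text \<open>
  The Gaussian splits into a factor along \<open>b\<close> and a factor in the distance to the axis. The second one
  is evaluated in terms of \<open>omega\<close>, which is the form in which it enters \<open>C2\<close>.
\<close>

lemma gaussian_moment_axis:
  fixes b :: "'a::euclidean_space"
  assumes b: "b \<in> Basis" and dim: "DIM('a) \<ge> 2" and s: "s > 0"
  shows "(\<integral>\<^sup>+z. ennreal (exp (- (norm z)\<^sup>2) * \<bar>z \<bullet> b\<bar> powr (2 * s)) \<partial>lborel) =
    ennreal (Gamma (s + 1/2) * (omega (DIM('a) - 1) * (Gamma ((real DIM('a) - 1) / 2) / 2)))"
proof -
  define N where "N = DIM('a)"
  have N: "N \<ge> 2" "real (N - 1) = real N - 1" "real (N - 2) = real N - 2" using dim by (auto simp: N_def)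
  have om: "omega (N - 1) > 0"
    unfolding omega_def using N by (intro divide_pos_pos Gamma_real_pos) auto
  have G: "Gamma (s + 1/2) > 0" using s by (intro Gamma_real_pos) auto
  have "(\<integral>\<^sup>+z. ennreal (exp (- (norm z)\<^sup>2) * \<bar>z \<bullet> b\<bar> powr (2 * s)) \<partial>lborel) =
    (\<integral>\<^sup>+z. ennreal (\<bar>z \<bullet> b\<bar> powr (2 * s) * exp (- (z \<bullet> b)\<^sup>2)) * ennreal (exp (- (norm (z - (z \<bullet> b) *\<^sub>R b))\<^sup>2)) \<partial>lborel)"
  proof (rule nn_integral_cong)
    fix z :: 'a
    have "exp (- (norm z)\<^sup>2) = exp (- (z \<bullet> b)\<^sup>2) * exp (- (norm (z - (z \<bullet> b) *\<^sub>R b))\<^sup>2)"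
      using norm_orthogonal_component[of b z] b by (simp flip: exp_add)
    then show "ennreal (exp (- (norm z)\<^sup>2) * \<bar>z \<bullet> b\<bar> powr (2 * s)) =
      ennreal (\<bar>z \<bullet> b\<bar> powr (2 * s) * exp (- (z \<bullet> b)\<^sup>2)) * ennreal (exp (- (norm (z - (z \<bullet> b) *\<^sub>R b))\<^sup>2))"
      by (simp add: mult_ac flip: ennreal_mult')
  qed
  also have "\<dots> = (\<integral>\<^sup>+t. ennreal (\<bar>t\<bar> powr (2 * s) * exp (- t\<^sup>2)) \<partial>lborel) *
    (\<integral>\<^sup>+r. ennreal (omega (N - 1) * r ^ (N - 2) * indicator {0<..} r) * ennreal (exp (- r\<^sup>2)) \<partial>lborel)"
    unfolding N_def by (rule nn_integral_cylindrical[OF _ _ b dim]) measurable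
  also have "(\<integral>\<^sup>+t. ennreal (\<bar>t\<bar> powr (2 * s) * exp (- t\<^sup>2)) \<partial>lborel) = ennreal (Gamma (s + 1/2))"
    using nn_integral_gaussian_abs_moment[of "2 * s + 1"] s by (simp add: add_divide_distrib)
  also have "(\<integral>\<^sup>+r. ennreal (omega (N - 1) * r ^ (N - 2) * indicator {0<..} r) * ennreal (exp (- r\<^sup>2)) \<partial>lborel) =
    (\<integral>\<^sup>+r. ennreal (omega (N - 1)) * ennreal (r powr (real N - 1 - 1) * exp (- r\<^sup>2) * indicator {0<..} r) \<partial>lborel)"
  proof (rule nn_integral_cong)
    fix r :: real
    have "r ^ (N - 2) = r powr (real N - 1 - 1)" if "r > 0"
      using that powr_realpow[of r "N - 2"] N by simp
    then show "ennreal (omega (N - 1) * r ^ (N - 2) * indicator {0<..} r) * ennreal (exp (- r\<^sup>2)) =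
      ennreal (omega (N - 1)) * ennreal (r powr (real N - 1 - 1) * exp (- r\<^sup>2) * indicator {0<..} r)"
      using om by (auto simp: indicator_def mult_ac simp flip: ennreal_mult' ennreal_mult'')
  qed
  also have "\<dots> = ennreal (omega (N - 1)) * ennreal (Gamma ((real N - 1) / 2) / 2)"
    using N nn_integral_gaussian_moment[of "real N - 1"] by (subst nn_integral_cmult) simp_all
  also have "ennreal (Gamma (s + 1/2)) * (ennreal (omega (N - 1)) * ennreal (Gamma ((real N - 1) / 2) / 2)) =
      ennreal (Gamma (s + 1/2) * (omega (N - 1) * (Gamma ((real N - 1) / 2) / 2)))"
    by (simp only: ennreal_mult'[OF less_imp_le[OF om]] ennreal_mult'[OF less_imp_le[OF G]])
  finally show ?thesis
    by (simp only: N_def)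
qed

text \<open>
  The counterpart of \<open>gaussian_moment_axis\<close> for the distance to the axis; it enters \<open>C1\<close>.
\<close>

lemma gaussian_moment_orthogonal:
  fixes b :: "'a::euclidean_space"
  assumes b: "b \<in> Basis" and dim: "DIM('a) \<ge> 2" and s: "s > 0"
  shows "(\<integral>\<^sup>+z. ennreal (exp (- (norm z)\<^sup>2) * norm (z - (z \<bullet> b) *\<^sub>R b) powr (2 * s)) \<partial>lborel) =
    ennreal (sqrt pi * (omega (DIM('a) - 1) * (Gamma ((real DIM('a) - 1) / 2 + s) / 2)))"
proof -
  define N where "N = DIM('a)"
  have N: "N \<ge> 2" "real (N - 1) = real N - 1" "real (N - 2) = real N - 2" using dim by (auto simp: N_def)
  have om: "omega (N - 1) > 0"
    unfolding omega_def using N by (intro divide_pos_pos Gamma_real_pos) auto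
  have "(\<integral>\<^sup>+z. ennreal (exp (- (norm z)\<^sup>2) * norm (z - (z \<bullet> b) *\<^sub>R b) powr (2 * s)) \<partial>lborel) =
    (\<integral>\<^sup>+z. ennreal (exp (- (z \<bullet> b)\<^sup>2)) * ennreal (norm (z - (z \<bullet> b) *\<^sub>R b) powr (2 * s) * exp (- (norm (z - (z \<bullet> b) *\<^sub>R b))\<^sup>2)) \<partial>lborel)"
  proof (rule nn_integral_cong)
    fix z :: 'a
    have "exp (- (norm z)\<^sup>2) = exp (- (z \<bullet> b)\<^sup>2) * exp (- (norm (z - (z \<bullet> b) *\<^sub>R b))\<^sup>2)"
      using norm_orthogonal_component[of b z] b by (simp flip: exp_add)
    then show "ennreal (exp (- (norm z)\<^sup>2) * norm (z - (z \<bullet> b) *\<^sub>R b) powr (2 * s)) =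
      ennreal (exp (- (z \<bullet> b)\<^sup>2)) * ennreal (norm (z - (z \<bullet> b) *\<^sub>R b) powr (2 * s) * exp (- (norm (z - (z \<bullet> b) *\<^sub>R b))\<^sup>2))"
      by (simp add: mult_ac flip: ennreal_mult')
  qed
  also have "\<dots> = (\<integral>\<^sup>+t. ennreal (exp (- t\<^sup>2)) \<partial>lborel) *
    (\<integral>\<^sup>+r. ennreal (omega (N - 1) * r ^ (N - 2) * indicator {0<..} r) * ennreal (r powr (2 * s) * exp (- r\<^sup>2)) \<partial>lborel)"
    unfolding N_def by (rule nn_integral_cylindrical[OF _ _ b dim]) measurable
  also note nn_integral_gaussian_real
  also have "(\<integral>\<^sup>+r. ennreal (omega (N - 1) * r ^ (N - 2) * indicator {0<..} r) * ennreal (r powr (2 * s) * exp (- r\<^sup>2)) \<partial>lborel) =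
    (\<integral>\<^sup>+r. ennreal (omega (N - 1)) * ennreal (r powr (real N - 1 + 2 * s - 1) * exp (- r\<^sup>2) * indicator {0<..} r) \<partial>lborel)"
  proof (rule nn_integral_cong)
    fix r :: real
    have "r ^ (N - 2) * r powr (2 * s) = r powr (real N - 1 + 2 * s - 1)" if "r > 0"
    proof -
      have "r ^ (N - 2) = r powr (real N - 2)" using that powr_realpow[of r "N - 2"] N by simp
      then show ?thesis by (simp only: powr_add[symmetric]) (simp add: algebra_simps)
    qed
    then show "ennreal (omega (N - 1) * r ^ (N - 2) * indicator {0<..} r) * ennreal (r powr (2 * s) * exp (- r\<^sup>2)) =
      ennreal (omega (N - 1)) * ennreal (r powr (real N - 1 + 2 * s - 1) * exp (- r\<^sup>2) * indicator {0<..} r)"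
      using om by (auto simp: indicator_def mult_ac simp flip: ennreal_mult' ennreal_mult'')
  qed
  also have "\<dots> = ennreal (omega (N - 1)) * ennreal (Gamma ((real N - 1) / 2 + s) / 2)"
    using N s nn_integral_gaussian_moment[of "real N - 1 + 2 * s"]
    by (subst nn_integral_cmult) (simp_all add: add_divide_distrib)
  also have "ennreal (sqrt pi) * (ennreal (omega (N - 1)) * ennreal (Gamma ((real N - 1) / 2 + s) / 2)) =
      ennreal (sqrt pi * (omega (N - 1) * (Gamma ((real N - 1) / 2 + s) / 2)))"
    by (simp only: ennreal_mult'[OF less_imp_le[OF om]] ennreal_mult'[OF real_sqrt_ge_zero[OF pi_ge_zero]])
  finally show ?thesis
    by (simp only: N_def)
qed

lemma gaussian_moment_finite:
  assumes s: "s > 0"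
  shows "(\<integral>\<^sup>+z. ennreal (exp (- (norm (z::'a::euclidean_space))\<^sup>2) * norm z powr (2 * s)) \<partial>lborel) < \<infinity>"
proof -
  define N where "N = DIM('a)"
  have N: "N \<ge> 1" by (simp add: N_def Suc_leI)
  have om: "omega N > 0"
    unfolding omega_def using N by (intro divide_pos_pos Gamma_real_pos) auto
  let ?g = "\<lambda>r::real. ennreal (exp (- r\<^sup>2) * r powr (2 * s))"
  have nrm: "norm (\<Sum>i\<in>Basis. x i *\<^sub>R i) = sqrt (\<Sum>i\<in>Basis. (x i)\<^sup>2)" for x :: "'a \<Rightarrow> real"
    by (subst norm_eq_sqrt_inner, subst euclidean_inner) (simp add: power2_eq_square)
  have "(\<integral>\<^sup>+z. ennreal (exp (- (norm (z::'a))\<^sup>2) * norm z powr (2 * s)) \<partial>lborel) =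
    (\<integral>\<^sup>+x. ?g (sqrt (\<Sum>i\<in>Basis. (x i)\<^sup>2)) \<partial>Pi\<^sub>M (Basis::'a set) (\<lambda>_. lborel))"
    by (subst lborel_eq, subst nn_integral_distr) (auto simp only: nrm, measurable)
  also have "\<dots> = (\<integral>\<^sup>+r. ennreal (omega N * r ^ (N - 1) * indicator {0<..} r) * ?g r \<partial>lborel)"
    unfolding N_def by (rule nn_integral_radial_PiM) auto
  also have "\<dots> = (\<integral>\<^sup>+r. ennreal (omega N) * ennreal (r powr (real N + 2 * s - 1) * exp (- r\<^sup>2) * indicator {0<..} r) \<partial>lborel)"
  proof (rule nn_integral_cong)
    fix r :: real
    have "r ^ (N - 1) * r powr (2 * s) = r powr (real N + 2 * s - 1)" if "r > 0"
    proof -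
      have "r ^ (N - 1) = r powr (real N - 1)" using that powr_realpow[of r "N - 1"] N by simp
      then show ?thesis by (simp only: powr_add[symmetric]) (simp add: algebra_simps)
    qed
    then show "ennreal (omega N * r ^ (N - 1) * indicator {0<..} r) * ?g r =
      ennreal (omega N) * ennreal (r powr (real N + 2 * s - 1) * exp (- r\<^sup>2) * indicator {0<..} r)"
      using om by (auto simp: indicator_def mult_ac simp flip: ennreal_mult' ennreal_mult'')
  qed
  also have "\<dots> = ennreal (omega N) * ennreal (Gamma ((real N + 2 * s) / 2) / 2)"
    using N s nn_integral_gaussian_moment[of "real N + 2 * s"] by (subst nn_integral_cmult) simp_all
  finally show ?thesis by (simp add: ennreal_mult_less_top)
qed

section \<open>Functions of one coordinate and of the orthogonal distance\<close>

lemma ray_integral_unit_real: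
  fixes g :: "real \<Rightarrow> real"
  assumes "\<And>t. g (- t) = g t" "w \<noteq> 0"
  shows "ray_integral s g (sgn w) = ray_integral s g 1"
proof (cases "w > 0")
  case False
  then have "sgn w = -1" using assms(2) by simp
  then show ?thesis by (simp add: ray_integral_def assms(1))
qed simp

text \<open>
  The identity behind \<open>C2\<close>: integrating \<open>|z|^(-n-2s)\<close> over the hyperplanes orthogonal to \<open>b\<close> leaves
  \<open>C2 |t|^(-1-2s)\<close>. The factor 2 is there because the right-hand side runs over half a line.
\<close>

lemma kernel_integral_axis:
  fixes b :: "'a::euclidean_space" and g :: "real \<Rightarrow> real"
  assumes g: "g \<in> borel_measurable borel" "g 0 = 0" and even: "\<And>t. g (- t) = g t"
    and b: "b \<in> Basis" and dim: "DIM('a) \<ge> 2" and s: "s > 0"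
  shows "kernel_integral s (\<lambda>z. g (z \<bullet> b)) = ennreal (2 * C2 DIM('a) s) * ray_integral s g 1"
proof -
  define N where "N = DIM('a)"
  have N: "N \<ge> 2" using dim by (simp add: N_def)
  have G: "Gamma (real N / 2 + s) > 0" using N s by (intro Gamma_real_pos) auto
  have lin: "linear (\<lambda>z. z \<bullet> b)"
    by (intro bounded_linear.linear bounded_linear_inner_left)
  have "ennreal (Gamma (real N / 2 + s) / 2) * kernel_integral s (\<lambda>z. g (z \<bullet> b)) =
    (\<integral>\<^sup>+z. ennreal (exp (- (norm z)\<^sup>2)) * (ennreal (norm (z \<bullet> b) powr (2 * s)) * ray_integral s g (sgn (z \<bullet> b))) \<partial>lborel)"
    unfolding N_def by (rule kernel_integral_linear_image[OF g s lin])
  also have "\<dots> = (\<integral>\<^sup>+z. ennreal (exp (- (norm z)\<^sup>2) * \<bar>z \<bullet> b\<bar> powr (2 * s)) * ray_integral s g 1 \<partial>lborel)"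
  proof (rule nn_integral_cong)
    fix z :: 'a
    show "ennreal (exp (- (norm z)\<^sup>2)) * (ennreal (norm (z \<bullet> b) powr (2 * s)) * ray_integral s g (sgn (z \<bullet> b))) =
      ennreal (exp (- (norm z)\<^sup>2) * \<bar>z \<bullet> b\<bar> powr (2 * s)) * ray_integral s g 1"
      by (cases "z \<bullet> b = 0") (simp_all add: ray_integral_unit_real[of g] even ennreal_mult' mult.assoc)
  qed
  also have "\<dots> = ennreal (Gamma (s + 1/2) * (omega (N - 1) * (Gamma ((real N - 1) / 2) / 2))) * ray_integral s g 1"
    unfolding N_def by (subst nn_integral_multc) (simp_all add: gaussian_moment_axis[OF b dim s])
  also have "Gamma (s + 1/2) * (omega (N - 1) * (Gamma ((real N - 1) / 2) / 2)) =
      Gamma (real N / 2 + s) / 2 * (2 * C2 N s)"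
    using G unfolding C2_def by (simp add: mult_ac)
  also have "ennreal (Gamma (real N / 2 + s) / 2 * (2 * C2 N s)) = ennreal (Gamma (real N / 2 + s) / 2) * ennreal (2 * C2 N s)"
    using G by (intro ennreal_mult') simp
  finally show ?thesis
    using G by (simp add: N_def mult.assoc ennreal_mult_cancel_left)
qed

text \<open>
  A function of \<open>|A z|\<close> has the same integral along every ray apart from the factor \<open>|A z|^(2s)\<close>, so the
  two integrations decouple.
\<close>

lemma kernel_integral_radial_linear_image:
  fixes A :: "'a::euclidean_space \<Rightarrow> 'b::euclidean_space" and g :: "real \<Rightarrow> real"
  assumes g: "g \<in> borel_measurable borel" "g 0 = 0" and s: "s > 0" and A: "linear A"
  shows "ennreal (Gamma (real DIM('a) / 2 + s) / 2) * kernel_integral s (\<lambda>z. g (norm (A z))) =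
    (\<integral>\<^sup>+z. ennreal (exp (- (norm z)\<^sup>2) * norm (A z) powr (2 * s)) \<partial>lborel) * ray_integral s g 1"
proof -
  let ?h = "\<lambda>w::'b. g (norm w)"
  have [measurable]: "g \<in> borel_measurable borel" by fact
  have [measurable]: "A \<in> borel_measurable borel"
    using A by (intro borel_measurable_continuous_onI linear_continuous_on) (simp add: linear_conv_bounded_linear)
  have "ennreal (Gamma (real DIM('a) / 2 + s) / 2) * kernel_integral s (\<lambda>z. ?h (A z)) =
    (\<integral>\<^sup>+z. ennreal (exp (- (norm z)\<^sup>2)) * (ennreal (norm (A z) powr (2 * s)) * ray_integral s ?h (sgn (A z))) \<partial>lborel)"
    using g by (intro kernel_integral_linear_image[OF _ _ s A]) auto
  also have "\<dots> = (\<integral>\<^sup>+z. ennreal (exp (- (norm z)\<^sup>2) * norm (A z) powr (2 * s)) * ray_integral s g 1 \<partial>lborel)"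
  proof (rule nn_integral_cong)
    fix z :: 'a
    have "ray_integral s ?h (sgn w) = ray_integral s g 1" if "w \<noteq> 0" for w :: 'b
      unfolding ray_integral_def using that
      by (intro nn_integral_cong) (auto simp: indicator_def norm_sgn)
    then show "ennreal (exp (- (norm z)\<^sup>2)) * (ennreal (norm (A z) powr (2 * s)) * ray_integral s ?h (sgn (A z))) =
      ennreal (exp (- (norm z)\<^sup>2) * norm (A z) powr (2 * s)) * ray_integral s g 1"
      by (cases "A z = 0") (simp_all add: ennreal_mult' mult.assoc)
  qed
  also have "\<dots> = (\<integral>\<^sup>+z. ennreal (exp (- (norm z)\<^sup>2) * norm (A z) powr (2 * s)) \<partial>lborel) * ray_integral s g 1"
    by (rule nn_integral_multc) measurable
  finally show ?thesis .
qed

lemma kernel_integral_radial_finite: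
  fixes A :: "'a::euclidean_space \<Rightarrow> 'b::euclidean_space" and g :: "real \<Rightarrow> real"
  assumes g: "g \<in> borel_measurable borel" "g 0 = 0" and s: "s > 0" and A: "linear A"
    and fin: "ray_integral s g 1 < \<infinity>"
  shows "kernel_integral s (\<lambda>z. g (norm (A z))) < \<infinity>"
proof -
  have G: "Gamma (real DIM('a) / 2 + s) > 0" using s by (intro Gamma_real_pos) (auto intro: add_nonneg_pos)
  obtain B where B: "\<And>z. norm (A z) \<le> B * norm z" "B > 0"
    using linear_bounded_pos[OF A] by blast
  have "(\<integral>\<^sup>+z. ennreal (exp (- (norm z)\<^sup>2) * norm (A z) powr (2 * s)) \<partial>lborel) \<le>
    (\<integral>\<^sup>+z. ennreal (B powr (2 * s)) * ennreal (exp (- (norm (z::'a))\<^sup>2) * norm z powr (2 * s)) \<partial>lborel)"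
  proof (rule nn_integral_mono)
    fix z :: 'a
    have "norm (A z) powr (2 * s) \<le> (B * norm z) powr (2 * s)"
      using s B by (intro powr_mono2) auto
    also have "\<dots> = B powr (2 * s) * norm z powr (2 * s)" using B by (simp add: powr_mult)
    finally have "exp (- (norm z)\<^sup>2) * norm (A z) powr (2 * s) \<le>
        B powr (2 * s) * (exp (- (norm z)\<^sup>2) * norm z powr (2 * s))"
      by (simp add: mult.left_commute)
    then show "ennreal (exp (- (norm z)\<^sup>2) * norm (A z) powr (2 * s)) \<le>
        ennreal (B powr (2 * s)) * ennreal (exp (- (norm z)\<^sup>2) * norm z powr (2 * s))"
      by (simp add: ennreal_leI flip: ennreal_mult')
  qed
  also have "\<dots> = ennreal (B powr (2 * s)) * (\<integral>\<^sup>+z. ennreal (exp (- (norm (z::'a))\<^sup>2) * norm z powr (2 * s)) \<partial>lborel)"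
    by (rule nn_integral_cmult) measurable
  also have "\<dots> < \<infinity>" using gaussian_moment_finite[OF s, where 'a='a] by (simp add: ennreal_mult_less_top)
  finally have "ennreal (Gamma (real DIM('a) / 2 + s) / 2) * kernel_integral s (\<lambda>z. g (norm (A z))) < \<infinity>"
    unfolding kernel_integral_radial_linear_image[OF g s A] using fin by (simp add: ennreal_mult_less_top)
  then show ?thesis using G by (auto simp: ennreal_mult_less_top)
qed

text \<open>
  The identity behind \<open>C1\<close>: for \<open>g(r) = min (2 L r) (C r^2)\<close> the right-hand side is \<open>2 C1 / (1-s)\<close>.
\<close>

lemma kernel_integral_orthogonal:
  fixes b :: "'a::euclidean_space" and g :: "real \<Rightarrow> real"
  assumes g: "g \<in> borel_measurable borel" "g 0 = 0"
    and b: "b \<in> Basis" and dim: "DIM('a) \<ge> 2" and s: "s > 0"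
  shows "kernel_integral s (\<lambda>z. g (norm (z - (z \<bullet> b) *\<^sub>R b))) =
    ennreal (sqrt pi * Gamma ((real DIM('a) - 1) / 2 + s) / Gamma (real DIM('a) / 2 + s) * omega (DIM('a) - 1)) *
    ray_integral s g 1"
proof -
  define N where "N = DIM('a)"
  define K where "K = sqrt pi * Gamma ((real N - 1) / 2 + s) / Gamma (real N / 2 + s) * omega (N - 1)"
  have G: "Gamma (real N / 2 + s) > 0"
    using dim s by (intro Gamma_real_pos) (auto simp: N_def intro: add_nonneg_pos)
  let ?P = "\<lambda>z. z - (z \<bullet> b) *\<^sub>R b"
  have lin: "linear ?P"
    by (rule linearI) (simp_all add: inner_add_left algebra_simps)
  have "ennreal (Gamma (real N / 2 + s) / 2) * kernel_integral s (\<lambda>z. g (norm (?P z))) =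
    ennreal (sqrt pi * (omega (N - 1) * (Gamma ((real N - 1) / 2 + s) / 2))) * ray_integral s g 1"
    unfolding N_def kernel_integral_radial_linear_image[OF g s lin] gaussian_moment_orthogonal[OF b dim s] ..
  also have "sqrt pi * (omega (N - 1) * (Gamma ((real N - 1) / 2 + s) / 2)) = Gamma (real N / 2 + s) / 2 * K"
    using G unfolding K_def by (simp add: mult_ac)
  also have "ennreal (Gamma (real N / 2 + s) / 2 * K) = ennreal (Gamma (real N / 2 + s) / 2) * ennreal K"
    using G by (intro ennreal_mult') simp
  finally have "kernel_integral s (\<lambda>z. g (norm (?P z))) = ennreal K * ray_integral s g 1"
    using G by (simp add: mult.assoc ennreal_mult_cancel_left)
  then show ?thesis by (simp only: K_def N_def)
qed

text \<open>
  Half of the integral over the line that defines \<open>mu1\<close>. That integral is nonzero, hence it converges.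
\<close>

lemma ray_integral_majorant:
  assumes mu: "mu1 s L C \<noteq> 0" and s: "s < 1" and LC: "L \<ge> 0" "C \<ge> 0"
  shows "ray_integral s (\<lambda>t::real. min (2 * L * \<bar>t\<bar>) (C * \<bar>t\<bar>\<^sup>2)) 1 = ennreal (mu1 s L C / (1 - s))"
    and "mu1 s L C > 0"
proof -
  define f :: "real \<Rightarrow> real" where "f t = min (2 * L * \<bar>t\<bar>) (C * \<bar>t\<bar>\<^sup>2) / \<bar>t\<bar> powr (1 + 2 * s)" for t
  define R where "R = ray_integral s (\<lambda>t::real. min (2 * L * \<bar>t\<bar>) (C * \<bar>t\<bar>\<^sup>2)) 1"
  have mueq: "mu1 s L C = (1 - s) / 2 * (\<integral>t. f t \<partial>lborel)"
    by (simp add: mu1_def f_def)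
  have int: "integrable lborel f"
    using mu not_integrable_integral_eq mueq by fastforce
  have f0: "f t \<ge> 0" for t using LC by (simp add: f_def)
  have [measurable]: "f \<in> borel_measurable borel" using int by measurable
  have "(\<integral>t. f t \<partial>lborel) \<ge> 0" by (rule Bochner_Integration.integral_nonneg) (rule f0)
  then have "mu1 s L C \<ge> 0" unfolding mueq using s by (intro mult_nonneg_nonneg) auto
  with mu show pos: "mu1 s L C > 0" by simp
  have R: "R = (\<integral>\<^sup>+t. ennreal (f t * indicator {0<..} t) \<partial>lborel)"
    unfolding R_def ray_integral_def f_def by (intro nn_integral_cong) (auto simp: indicator_def)
  have "(\<integral>\<^sup>+t. ennreal (f t) \<partial>lborel) =
    (\<integral>\<^sup>+t. ennreal (f t * indicator {0<..} t) + ennreal (f (- t) * indicator {0<..} (- t)) \<partial>lborel)"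
  proof (rule nn_integral_cong)
    fix t :: real
    show "ennreal (f t) = ennreal (f t * indicator {0<..} t) + ennreal (f (- t) * indicator {0<..} (- t))"
      by (cases t "0::real" rule: linorder_cases) (simp_all add: f_def)
  qed
  also have "\<dots> = R + (\<integral>\<^sup>+t. ennreal (f (- t) * indicator {0<..} (- t)) \<partial>lborel)"
    unfolding R by (rule nn_integral_add) auto
  also have "(\<integral>\<^sup>+t. ennreal (f (- t) * indicator {0<..} (- t)) \<partial>lborel) = R"
    unfolding R by (subst (2) nn_integral_real_affine[where c="-1" and t=0]) auto
  also have "(\<integral>\<^sup>+t. ennreal (f t) \<partial>lborel) = ennreal (\<integral>t. f t \<partial>lborel)"
    using int f0 by (intro nn_integral_eq_integral) auto
  also have "(\<integral>t. f t \<partial>lborel) = 2 * (mu1 s L C / (1 - s))"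
    using s mueq by (simp add: field_simps)
  finally have RR: "R + R = ennreal (2 * (mu1 s L C / (1 - s)))" by simp
  define c where "c = mu1 s L C / (1 - s)"
  have c: "c > 0" using pos s by (simp add: c_def)
  have "R \<noteq> top" using RR by (auto simp: top_add)
  then obtain r where r: "R = ennreal r" "r \<ge> 0" by (cases R) auto
  then have "ennreal (r + r) = ennreal (2 * c)"
    using RR[unfolded r(1)] by (simp only: ennreal_plus[OF r(2) r(2)] c_def)
  then have "r = c" using r c by (subst (asm) ennreal_inj) auto
  then show "R = ennreal (mu1 s L C / (1 - s))" unfolding R_def using r by (simp add: c_def R_def)
qed

section \<open>Extreme eigenvalues and determinant one\<close>

lemma inner_matrix_symmetric:
  fixes B :: "real^'n^'n"
  assumes "transpose B = B"
  shows "x \<bullet> (B *v y) = (B *v x) \<bullet> y"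
  using dot_lmul_matrix[of x B y] assms by (simp add: transpose_matrix_vector[symmetric])

text \<open>
  Maximize the Rayleigh quotient over the unit sphere. If the residual \<open>r = \<mu> w - B w\<close> at the
  maximizer \<open>w\<close> were nonzero, a small step from \<open>w\<close> in the direction \<open>- r\<close> would make the
  nonnegative quadratic form \<open>\<mu> |z|^2 - z \<bullet> B z\<close> negative.
\<close>

lemma symmetric_matrix_max_eigenvector:
  fixes B :: "real^'n^'n"
  assumes sym: "transpose B = B"
  obtains w \<mu> where "norm w = 1" "B *v w = \<mu> *\<^sub>R w" "\<And>z. z \<bullet> (B *v z) \<le> \<mu> * (norm z)\<^sup>2"
proof -
  let ?q = "\<lambda>z. z \<bullet> (B *v z)"
  have cont: "continuous_on S (\<lambda>z. B *v z)" for S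
    by (intro linear_continuous_on) (simp add: matrix_vector_mul_bounded_linear)
  have "axis undefined 1 \<in> sphere (0::real^'n) 1" by simp
  then have ne: "sphere (0::real^'n) 1 \<noteq> {}" by blast
  have "continuous_on (sphere 0 1) ?q" by (intro continuous_intros cont)
  then obtain w where w: "w \<in> sphere 0 1" "\<And>z. z \<in> sphere 0 1 \<Longrightarrow> ?q z \<le> ?q w"
    using continuous_attains_sup[OF compact_sphere ne] by blast
  define \<mu> where "\<mu> = ?q w"
  have nw: "norm w = 1" using w by simp
  have max: "?q z \<le> \<mu> * (norm z)\<^sup>2" for z
  proof (cases "z = 0")
    case False
    then have "?q (z /\<^sub>R norm z) \<le> \<mu>" unfolding \<mu>_def by (intro w) simp
    moreover have "?q (z /\<^sub>R norm z) = ?q z / (norm z)\<^sup>2"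
      by (simp add: matrix_vector_mult_scaleR power2_eq_square divide_inverse)
    ultimately have "?q z / (norm z)\<^sup>2 \<le> \<mu>" by (simp only:)
    then show ?thesis using False by (simp add: pos_divide_le_eq)
  qed simp
  define r where "r = \<mu> *\<^sub>R w - B *v w"
  have "r = 0"
  proof (rule ccontr)
    assume r: "r \<noteq> 0"
    define Q where "Q z = \<mu> * (z \<bullet> z) - ?q z" for z
    have Q0: "Q z \<ge> 0" for z using max[of z] by (simp add: Q_def power2_norm_eq_inner)
    have Qw: "Q w = 0" using nw by (simp add: Q_def \<mu>_def norm_eq_1)
    have exp: "Q (w - t *\<^sub>R r) = t * (t * Q r - 2 * (r \<bullet> r))" for t
    proof -
      have "Q (w - t *\<^sub>R r) = Q w - 2 * t * (\<mu> * (r \<bullet> w) - r \<bullet> (B *v w)) + t * t * Q r"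
        using inner_matrix_symmetric[OF sym, of w r]
        by (simp add: Q_def inner_diff_left inner_diff_right matrix_vector_mult_diff_distrib
            matrix_vector_mult_scaleR inner_commute algebra_simps)
      also have "\<mu> * (r \<bullet> w) - r \<bullet> (B *v w) = r \<bullet> r"
        by (subst (3) r_def) (simp add: inner_diff_right)
      finally show ?thesis by (simp add: Qw algebra_simps)
    qed
    \<comment> \<open>Any step with \<open>t * Q r < 2 (r \<bullet> r)\<close> works; adding 1 keeps the denominator positive.\<close>
    define t where "t = (r \<bullet> r) / (Q r + 1)"
    have rr: "r \<bullet> r > 0" using r by simp
    have t: "t > 0" using rr Q0[of r] by (simp add: t_def add_nonneg_pos)
    have "t * Q r \<le> t * (Q r + 1)" using t by simp
    also have "\<dots> = r \<bullet> r" using Q0[of r] by (simp add: t_def)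
    finally have "t * Q r - 2 * (r \<bullet> r) < 0" using rr by linarith
    then have "Q (w - t *\<^sub>R r) < 0" unfolding exp using t by (simp add: mult_pos_neg)
    then show False using Q0[of "w - t *\<^sub>R r"] by simp
  qed
  then have "B *v w = \<mu> *\<^sub>R w" by (simp add: r_def)
  with nw max show thesis by (intro that)
qed

text \<open>
  Eigenvectors for distinct eigenvalues are orthogonal, hence independent.
\<close>

lemma finite_eigenvalues_symmetric:
  fixes A :: "real^'n^'n"
  assumes sym: "transpose A = A"
  shows "finite {l. eigenvalue A l}"
proof -
  define v where "v l = (SOME v. v \<noteq> 0 \<and> A *v v = l *\<^sub>R v)" for l
  have v: "v l \<noteq> 0 \<and> A *v v l = l *\<^sub>R v l" if "eigenvalue A l" for l
    unfolding v_def using that unfolding eigenvalue_def by (rule someI_ex)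
  have orth: "v l \<bullet> v m = 0" if "eigenvalue A l" "eigenvalue A m" "l \<noteq> m" for l m
  proof -
    have "m * (v l \<bullet> v m) = l * (v l \<bullet> v m)"
      using inner_matrix_symmetric[OF sym, of "v l" "v m"] v that by simp
    then show ?thesis using that by simp
  qed
  have inj: "inj_on v {l. eigenvalue A l}"
  proof (rule inj_onI, rule ccontr)
    fix l m assume "l \<in> {l. eigenvalue A l}" "m \<in> {l. eigenvalue A l}" "v l = v m" "l \<noteq> m"
    then show False using orth[of l m] v[of m] by simp
  qed
  have "independent (v ` {l. eigenvalue A l})"
  proof (rule pairwise_orthogonal_independent)
    show "pairwise orthogonal (v ` {l. eigenvalue A l})"
      by (auto simp: pairwise_def orthogonal_def intro: orth)
    show "0 \<notin> v ` {l. eigenvalue A l}" using v by auto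
  qed
  then have "finite (v ` {l. eigenvalue A l})" by (rule independent_imp_finite)
  then show ?thesis using inj by (rule finite_imageD)
qed

text \<open>
  \<open>lambda_min\<close> is defined by \<open>Min\<close>, so it is an eigenvalue only because the set of eigenvalues is finite
  and nonempty.
\<close>

lemma eigenvalue_lambda_min:
  fixes A :: "real^'n^'n"
  assumes sym: "transpose A = A"
  shows "eigenvalue A (lambda_min A)"
proof -
  obtain w \<mu> where "norm w = 1" "A *v w = \<mu> *\<^sub>R w"
    using symmetric_matrix_max_eigenvector[OF sym] by metis
  then have "eigenvalue A \<mu>" unfolding eigenvalue_def by (metis norm_zero zero_neq_one)
  then have "{l. eigenvalue A l} \<noteq> {}" by auto
  then have "lambda_min A \<in> {l. eigenvalue A l}"
    unfolding lambda_min_def by (intro Min_in finite_eigenvalues_symmetric sym)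
  then show ?thesis by simp
qed

lemma gaussian_integral:
  "(\<integral>\<^sup>+z. ennreal (exp (- (norm (z::'a::euclidean_space))\<^sup>2)) \<partial>lborel) = ennreal (sqrt pi ^ DIM('a))"
proof -
  have "exp (- (norm z)\<^sup>2) = (\<Prod>b\<in>Basis. exp (- (z \<bullet> b)\<^sup>2))" for z :: 'a
  proof -
    have "(norm z)\<^sup>2 = (\<Sum>b\<in>Basis. (z \<bullet> b)\<^sup>2)"
      unfolding power2_norm_eq_inner by (subst euclidean_inner) (simp add: power2_eq_square)
    then show ?thesis by (simp add: exp_sum[symmetric] sum_negf)
  qed
  then have "(\<integral>\<^sup>+z. ennreal (exp (- (norm (z::'a))\<^sup>2)) \<partial>lborel) =
      (\<integral>\<^sup>+z. (\<Prod>b\<in>Basis. ennreal (exp (- (z \<bullet> b)\<^sup>2))) \<partial>(lborel :: 'a measure))"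
    by (simp add: prod_ennreal)
  also have "\<dots> = (\<Prod>b\<in>(Basis :: 'a set). (\<integral>\<^sup>+t. ennreal (exp (- t\<^sup>2)) \<partial>lborel))"
    by (rule nn_integral_lborel_prod) auto
  also have "\<dots> = ennreal (sqrt pi ^ DIM('a))"
    unfolding nn_integral_gaussian_real by (simp add: ennreal_power)
  finally show ?thesis .
qed

text \<open>
  A positive definite matrix of determinant one with a small eigenvalue has a large one; \<open>\<Lambda>\<close> is the largest
  eigenvalue and \<open>w\<close> its unit eigenvector. The bound comes from comparing volumes: in coordinates whose \<open>k\<close>-th axis is the eigenvector for \<open>lambda_min A\<close>,
  \<open>|A z| \<le> |D z|\<close> with \<open>D\<close> diagonal, \<open>lambda_min A\<close> in position \<open>k\<close> and \<open>\<Lambda>\<close> elsewhere. The Gaussian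
  integral is invariant under \<open>A\<close> and is divided by \<open>det D\<close> under \<open>D\<close>, which gives \<open>det D \<ge> 1\<close>.
\<close>

lemma det_one_eigenvalue_stretch:
  fixes A :: "real^'n^'n"
  assumes pd: "positive_definite A" and det: "det A = 1"
  obtains w \<Lambda> where "norm w = 1" "\<Lambda> > 0" "\<And>z. \<Lambda> * \<bar>z \<bullet> w\<bar> \<le> norm (A *v z)"
    "lambda_min A > 0" "1 \<le> lambda_min A * \<Lambda> ^ (CARD('n) - 1)"
proof -
  have sym: "transpose A = A" using pd by (simp add: positive_definite_def)
  define l where "l = lambda_min A"
  obtain v0 where v0: "v0 \<noteq> 0" "A *v v0 = l *\<^sub>R v0"
    using eigenvalue_lambda_min[OF sym] by (auto simp: eigenvalue_def l_def)
  define v where "v = v0 /\<^sub>R norm v0"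
  have v: "norm v = 1" "A *v v = l *\<^sub>R v"
    using v0 by (simp_all add: v_def matrix_vector_mult_scaleR)
  have "v \<bullet> (A *v v) > 0" using pd v unfolding positive_definite_def by (metis norm_zero zero_neq_one)
  then have l: "l > 0" using v by (simp add: norm_eq_1)
  \<comment> \<open>A maximal eigenvector of \<open>A ** A\<close> gives both \<open>|A z| \<le> \<Lambda> |z|\<close> and \<open>\<Lambda> |z \<bullet> w| \<le> |A z|\<close>.\<close>
  have "transpose (A ** A) = A ** A" by (simp add: matrix_transpose_mul sym)
  then obtain w \<mu> where w: "norm w = 1" "(A ** A) *v w = \<mu> *\<^sub>R w"
    "\<And>z. z \<bullet> ((A ** A) *v z) \<le> \<mu> * (norm z)\<^sup>2"
    using symmetric_matrix_max_eigenvector by blast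
  have AA: "z \<bullet> ((A ** A) *v z) = (norm (A *v z))\<^sup>2" for z
    by (simp add: matrix_vector_mul_assoc[symmetric] inner_matrix_symmetric[OF sym] power2_norm_eq_inner)
  have "(norm (A *v w))\<^sup>2 = \<mu>" using AA[of w] w by (simp add: norm_eq_1)
  moreover have "A *v w \<noteq> 0" using pd w unfolding positive_definite_def
    by (metis inner_zero_right norm_zero order_less_irrefl zero_neq_one)
  ultimately have mu: "\<mu> > 0" by (metis zero_less_norm_iff zero_less_power)
  define \<Lambda> where "\<Lambda> = sqrt \<mu>"
  have Lam: "\<Lambda> > 0" "\<Lambda>\<^sup>2 = \<mu>" using mu by (simp_all add: \<Lambda>_def)
  have Aw: "norm (A *v w) = \<Lambda>" using \<open>(norm (A *v w))\<^sup>2 = \<mu>\<close> by (simp add: \<Lambda>_def real_sqrt_unique)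
  have upper: "(norm (A *v z))\<^sup>2 \<le> \<Lambda>\<^sup>2 * (norm z)\<^sup>2" for z
    using w(3)[of z] AA Lam by simp
  have lower: "\<Lambda> * \<bar>z \<bullet> w\<bar> \<le> norm (A *v z)" for z
  proof -
    have "\<Lambda>\<^sup>2 * (z \<bullet> w) = (A *v z) \<bullet> (A *v w)"
      using w(2) Lam by (simp add: inner_matrix_symmetric[OF sym, symmetric] matrix_vector_mul_assoc)
    then have "\<Lambda>\<^sup>2 * \<bar>z \<bullet> w\<bar> = \<bar>(A *v z) \<bullet> (A *v w)\<bar>" by (metis abs_mult abs_of_nonneg zero_le_power2)
    also have "\<dots> \<le> norm (A *v z) * \<Lambda>" using Cauchy_Schwarz_ineq2[of "A *v z" "A *v w"] Aw by simp
    finally show ?thesis using Lam by (simp add: power2_eq_square mult_ac)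
  qed
  obtain k :: 'n where True by simp
  define b where "b = (axis k 1 :: real^'n)"
  have b: "norm b = 1" by (simp add: b_def)
  obtain T where T: "orthogonal_transformation T" "T b = v"
    using orthogonal_transformation_exists[of b v] b v by auto
  define d where "d i = (if i = k then l else \<Lambda>)" for i :: 'n
  have d0: "d i \<noteq> 0" for i using l Lam by (simp add: d_def)
  have prod: "(\<Prod>i\<in>UNIV. d i) = l * \<Lambda> ^ (CARD('n) - 1)"
    by (subst prod.remove[of _ k]) (auto simp: d_def)
  let ?G = "\<integral>\<^sup>+z. ennreal (exp (- (norm (z::real^'n))\<^sup>2)) \<partial>lborel"
  have le: "(norm (A *v T z))\<^sup>2 \<le> (norm (\<chi> i. d i * z $ i))\<^sup>2" for z
  proof -
    define \<zeta> where "\<zeta> = z $ k"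
    define y where "y = z - \<zeta> *\<^sub>R b"
    have zb: "z \<bullet> b = \<zeta>" by (simp add: b_def \<zeta>_def inner_axis)
    have Tl: "linear T" using T by (simp add: orthogonal_transformation_linear)
    have Tz: "T z = \<zeta> *\<^sub>R v + T y"
      using T by (simp add: y_def linear_diff[OF Tl] linear_scale[OF Tl])
    have "v \<bullet> T y = b \<bullet> y"
      using T by (metis orthogonal_transformation_def)
    also have "\<dots> = 0" using b zb by (simp add: y_def inner_diff_right inner_commute norm_eq_1)
    finally have "v \<bullet> (A *v T y) = 0"
      using v by (simp add: inner_matrix_symmetric[OF sym])
    then have "(norm (A *v T z))\<^sup>2 = l\<^sup>2 * \<zeta>\<^sup>2 + (norm (A *v T y))\<^sup>2"
      using v unfolding Tz power2_norm_eq_inner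
      by (simp add: matrix_vector_right_distrib matrix_vector_mult_scaleR inner_add_left inner_add_right
          inner_commute norm_eq_1 power2_eq_square)
    also have "\<dots> \<le> l\<^sup>2 * \<zeta>\<^sup>2 + \<Lambda>\<^sup>2 * (norm y)\<^sup>2"
      using upper[of "T y"] T by (simp add: orthogonal_transformation_norm)
    also have "\<dots> = (norm (\<chi> i. d i * z $ i))\<^sup>2"
    proof -
      have sq: "(norm x)\<^sup>2 = (\<Sum>i\<in>UNIV. (x $ i)\<^sup>2)" for x :: "real^'n"
        unfolding power2_norm_eq_inner inner_vec_def by (simp add: power2_eq_square)
      have "(norm (\<chi> i. d i * z $ i))\<^sup>2 = l\<^sup>2 * \<zeta>\<^sup>2 + (\<Sum>i\<in>UNIV - {k}. \<Lambda>\<^sup>2 * (z $ i)\<^sup>2)"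
        unfolding sq by (subst sum.remove[of _ k]) (auto simp: d_def \<zeta>_def power_mult_distrib intro!: sum.cong)
      moreover have "(norm y)\<^sup>2 = (\<Sum>i\<in>UNIV - {k}. (z $ i)\<^sup>2)"
        unfolding sq by (subst sum.remove[of _ k]) (auto simp: y_def b_def axis_def \<zeta>_def intro!: sum.cong)
      ultimately show ?thesis by (simp add: sum_distrib_left)
    qed
    finally show ?thesis .
  qed
  have "?G = (\<integral>\<^sup>+z. ennreal (exp (- (norm (A *v z))\<^sup>2)) \<partial>lborel)"
    using nn_integral_matrix_image[of "\<lambda>z. ennreal (exp (- (norm z)\<^sup>2))" A] det by simp
  also have "\<dots> = (\<integral>\<^sup>+z. ennreal (exp (- (norm (A *v T z))\<^sup>2)) \<partial>lborel)"
    by (rule nn_integral_orthogonal_transformation[OF _ T(1), symmetric]) measurable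
  finally have G1: "?G = (\<integral>\<^sup>+z. ennreal (exp (- (norm (A *v T z))\<^sup>2)) \<partial>lborel)" .
  have "?G = ennreal \<bar>\<Prod>i\<in>UNIV. d i\<bar> * (\<integral>\<^sup>+z. ennreal (exp (- (norm (\<chi> i. d i * z $ i))\<^sup>2)) \<partial>lborel)"
    by (rule nn_integral_coordinate_scaling[symmetric]) (use d0 in auto)
  also have "\<dots> \<le> ennreal \<bar>\<Prod>i\<in>UNIV. d i\<bar> * ?G"
    unfolding G1 by (intro mult_left_mono nn_integral_mono ennreal_leI) (use le in auto)
  finally have "?G \<le> ennreal (l * \<Lambda> ^ (CARD('n) - 1)) * ?G" using l Lam by (simp add: prod)
  then have "ennreal (sqrt pi ^ CARD('n)) \<le> ennreal (l * \<Lambda> ^ (CARD('n) - 1) * sqrt pi ^ CARD('n))"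
    unfolding gaussian_integral using l Lam by (simp add: ennreal_mult')
  then have "sqrt pi ^ CARD('n) \<le> l * \<Lambda> ^ (CARD('n) - 1) * sqrt pi ^ CARD('n)"
    using l Lam by (subst (asm) ennreal_le_iff) auto
  then have "1 \<le> l * \<Lambda> ^ (CARD('n) - 1)" by simp
  with w(1) Lam(1) lower l show thesis by (intro that[of w \<Lambda>]) (auto simp: l_def)
qed

text \<open>
  Since \<open>s < 1\<close> and \<open>|z \<bullet> w| \<le> |z|\<close>, one has \<open>|z \<bullet> w|^(2s) \<ge> (z \<bullet> w)^2 |z|^(2s-2)\<close>. The integral of the
  right-hand side does not depend on the unit vector \<open>w\<close>, and its sum over an orthonormal basis is
  the integral of \<open>|z|^(2s)\<close>.
\<close>

lemma gaussian_moment_direction: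
  fixes w :: "real^'n"
  assumes w: "norm w = 1" and s: "0 < s" "s < 1"
  shows "(\<integral>\<^sup>+z. ennreal (exp (- (norm (z::real^'n))\<^sup>2) * norm z powr (2 * s)) \<partial>lborel) \<le>
     of_nat CARD('n) * (\<integral>\<^sup>+z. ennreal (exp (- (norm (z::real^'n))\<^sup>2) * \<bar>z \<bullet> w\<bar> powr (2 * s)) \<partial>lborel)"
proof -
  define h where "h z v = exp (- (norm z)\<^sup>2) * ((z \<bullet> v)\<^sup>2 * norm z powr (2 * s - 2))" for z v :: "real^'n"
  define H where "H v = (\<integral>\<^sup>+z. ennreal (h z v) \<partial>lborel)" for v
  have [measurable]: "(\<lambda>z. h z v) \<in> borel_measurable borel" for v unfolding h_def by measurable
  have "(\<integral>\<^sup>+z. ennreal (exp (- (norm (z::real^'n))\<^sup>2) * norm z powr (2 * s)) \<partial>lborel) =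
    (\<integral>\<^sup>+z. (\<Sum>b\<in>Basis. ennreal (h z b)) \<partial>lborel)"
  proof (rule nn_integral_cong)
    fix z :: "real^'n"
    have "(\<Sum>b\<in>Basis. h z b) = exp (- (norm z)\<^sup>2) * ((\<Sum>b\<in>Basis. (z \<bullet> b)\<^sup>2) * norm z powr (2 * s - 2))"
      by (simp add: h_def sum_distrib_left sum_distrib_right)
    also have "(\<Sum>b\<in>Basis. (z \<bullet> b)\<^sup>2) = (norm z)\<^sup>2"
      unfolding power2_norm_eq_inner by (subst (2) euclidean_inner) (simp add: power2_eq_square)
    also have "(norm z)\<^sup>2 * norm z powr (2 * s - 2) = norm z powr (2 * s)"
      by (cases "z = 0") (simp_all add: powr_diff)
    finally have "exp (- (norm z)\<^sup>2) * norm z powr (2 * s) = (\<Sum>b\<in>Basis. h z b)" ..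
    then show "ennreal (exp (- (norm z)\<^sup>2) * norm z powr (2 * s)) = (\<Sum>b\<in>Basis. ennreal (h z b))"
      by (subst sum_ennreal) (auto simp: h_def)
  qed
  also have "\<dots> = (\<Sum>b\<in>Basis. H b)"
    unfolding H_def by (rule nn_integral_sum) measurable
  also have "\<dots> = (\<Sum>b\<in>(Basis::(real^'n) set). H w)"
  proof (rule sum.cong)
    fix b :: "real^'n" assume "b \<in> Basis"
    then obtain T where T: "orthogonal_transformation T" "T b = w"
      using orthogonal_transformation_exists[of b w] w by auto
    have "h (T z) w = h z b" for z
    proof -
      have "T z \<bullet> w = z \<bullet> b" using T by (metis orthogonal_transformation_def)
      then show ?thesis using T by (simp add: h_def orthogonal_transformation_norm)
    qed
    then have "H b = (\<integral>\<^sup>+z. ennreal (h (T z) w) \<partial>lborel)" by (simp add: H_def)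
    also have "\<dots> = H w" unfolding H_def
      by (rule nn_integral_orthogonal_transformation[OF _ T(1)]) measurable
    finally show "H b = H w" .
  qed simp
  also have "\<dots> = of_nat CARD('n) * H w" by simp
  also have "H w \<le> (\<integral>\<^sup>+z. ennreal (exp (- (norm (z::real^'n))\<^sup>2) * \<bar>z \<bullet> w\<bar> powr (2 * s)) \<partial>lborel)"
    unfolding H_def
  proof (intro nn_integral_mono ennreal_leI)
    fix z :: "real^'n"
    have "(z \<bullet> w)\<^sup>2 * norm z powr (2 * s - 2) \<le> \<bar>z \<bullet> w\<bar> powr (2 * s)"
    proof (cases "z \<bullet> w = 0")
      case False
      have "\<bar>z \<bullet> w\<bar> \<le> norm z" using Cauchy_Schwarz_ineq2[of z w] w by simp
      then have "norm z powr (2 * s - 2) \<le> \<bar>z \<bullet> w\<bar> powr (2 * s - 2)"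
        using s False by (intro powr_mono2') auto
      then have "(z \<bullet> w)\<^sup>2 * norm z powr (2 * s - 2) \<le> (z \<bullet> w)\<^sup>2 * \<bar>z \<bullet> w\<bar> powr (2 * s - 2)"
        by (intro mult_left_mono) auto
      also have "\<dots> = \<bar>z \<bullet> w\<bar> powr (2 * s)" using False by (simp add: powr_diff)
      finally show ?thesis .
    qed simp
    then show "h z w \<le> exp (- (norm z)\<^sup>2) * \<bar>z \<bullet> w\<bar> powr (2 * s)"
      unfolding h_def by (intro mult_left_mono) auto
  qed
  finally show ?thesis by (simp add: mult_left_mono)
qed

section \<open>Semiconcave functions are touched from above by paraboloids\<close>

text \<open>
  A parameter missing from the closed set of good parameters of a segment lies in a gap whose end points
  are good, but then so is the midpoint of the gap.
\<close>

lemma midpoint_closed_imp_convex: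
  fixes S :: "'a::real_normed_vector set"
  assumes S: "closed S" and mid: "\<And>x y. x \<in> S \<Longrightarrow> y \<in> S \<Longrightarrow> midpoint x y \<in> S"
  shows "convex S"
proof (rule convexI)
  fix x y :: 'a and u v :: real
  assume xy: "x \<in> S" "y \<in> S" and uv: "0 \<le> u" "0 \<le> v" "u + v = 1"
  define \<gamma> where "\<gamma> t = (1 - t) *\<^sub>R x + t *\<^sub>R y" for t :: real
  define K where "K = {t. \<gamma> t \<in> S}"
  have "continuous_on UNIV \<gamma>" unfolding \<gamma>_def by (intro continuous_intros)
  then have K: "closed K"
    using closed_vimage[OF S, of \<gamma>] by (simp add: K_def vimage_def)
  have midK: "(s + t) / 2 \<in> K" if "s \<in> K" "t \<in> K" for s t
  proof -
    have c: "1 - (s + t) / 2 = inverse 2 * (1 - s) + inverse 2 * (1 - t)"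
      "(s + t) / 2 = inverse 2 * s + inverse 2 * t"
      by (simp_all add: field_simps)
    have "\<gamma> ((s + t) / 2) = midpoint (\<gamma> s) (\<gamma> t)"
      unfolding \<gamma>_def midpoint_def c(1) unfolding c(2)
      by (simp only: scaleR_add_left scaleR_add_right scaleR_scaleR add_ac)
    then show ?thesis using mid that by (simp add: K_def)
  qed
  have "v \<in> K"
  proof (rule ccontr)
    assume v: "v \<notin> K"
    define l where "l = Sup (K \<inter> {0..v})"
    define r where "r = Inf (K \<inter> {v..1})"
    have ne: "0 \<in> K \<inter> {0..v}" "1 \<in> K \<inter> {v..1}" using xy uv by (auto simp: K_def \<gamma>_def)
    have cl: "closed (K \<inter> {0..v})" "closed (K \<inter> {v..1})" using K by auto
    have bd: "bdd_above (K \<inter> {0..v})" "bdd_below (K \<inter> {v..1})" by auto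
    have l: "l \<in> K \<inter> {0..v}" unfolding l_def
      using ne by (intro closed_contains_Sup bd cl) auto
    have r: "r \<in> K \<inter> {v..1}" unfolding r_def
      using ne by (intro closed_contains_Inf bd cl) auto
    have lr: "l < v" "v < r" using l r v by (auto simp: less_le)
    define m where "m = (l + r) / 2"
    have m: "m \<in> K" unfolding m_def using l r by (intro midK) auto
    show False
    proof (cases "m \<le> v")
      case True
      then have "m \<in> K \<inter> {0..v}" using m l lr by (auto simp: m_def)
      then have "m \<le> l" unfolding l_def by (intro cSup_upper bd)
      then show False using lr by (simp add: m_def)
    next
      case False
      then have "m \<in> K \<inter> {v..1}" using m r lr by (auto simp: m_def)
      then have "r \<le> m" unfolding r_def by (intro cInf_lower bd)
      then show False using lr by (simp add: m_def)
    qed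
  qed
  then show "u *\<^sub>R x + v *\<^sub>R y \<in> S" using uv by (simp add: K_def \<gamma>_def eq_diff_eq[symmetric])
qed

text \<open>
  Separate the point \<open>(x, w x)\<close> from the strict hypograph of \<open>w\<close>. The separating hyperplane is not
  vertical, because the hypograph projects onto the whole space.
\<close>

lemma midpoint_concave_supergradient:
  fixes w :: "'a::euclidean_space \<Rightarrow> real"
  assumes cont: "continuous_on UNIV w" and mid: "\<And>x y. w (x + y) + w (x - y) \<le> 2 * w x"
  shows "\<exists>p. \<forall>y. w y \<le> w x + p \<bullet> (y - x)"
proof -
  define H where "H = {q::'a \<times> real. snd q \<le> w (fst q)}"
  have "continuous_on UNIV (\<lambda>q::'a \<times> real. w (fst q))"
    by (rule continuous_on_compose2[OF cont]) (auto intro: continuous_intros)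
  then have "closed H" unfolding H_def
    by (intro closed_Collect_le continuous_intros)
  moreover have "midpoint q q' \<in> H" if "q \<in> H" "q' \<in> H" for q q'
  proof -
    define y where "y = (1/2) *\<^sub>R (fst q - fst q')"
    have "fst (midpoint q q') + y = fst q" "fst (midpoint q q') - y = fst q'"
      by (simp_all add: midpoint_def y_def scaleR_add_right scaleR_diff_right flip: scaleR_add_left)
    then have "w (fst q) + w (fst q') \<le> 2 * w (fst (midpoint q q'))"
      using mid[of "fst (midpoint q q')" y] by simp
    then show ?thesis using that by (simp add: H_def midpoint_def)
  qed
  ultimately have convH: "convex H" by (rule midpoint_closed_imp_convex)
  define H' where "H' = {q::'a \<times> real. snd q < w (fst q)}"
  have "convex H'"
  proof (rule convexI)
    fix q q' :: "'a \<times> real" and u v :: real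
    assume q: "q \<in> H'" "q' \<in> H'" and uv: "0 \<le> u" "0 \<le> v" "u + v = 1"
    \<comment> \<open>the vertical room left above both points, so that convexity of the closed hypograph applies\<close>
    define e where "e = min (w (fst q) - snd q) (w (fst q') - snd q')"
    have e: "e > 0" using q by (simp add: e_def H'_def)
    have "(fst q, snd q + e) \<in> H" "(fst q', snd q' + e) \<in> H"
      using q by (auto simp: H_def e_def)
    then have "u *\<^sub>R (fst q, snd q + e) + v *\<^sub>R (fst q', snd q' + e) \<in> H"
      using uv by (intro convexD[OF convH])
    then have "u * snd q + v * snd q' + (u + v) * e \<le> w (u *\<^sub>R fst q + v *\<^sub>R fst q')"
      by (simp add: H_def algebra_simps)
    then show "u *\<^sub>R q + v *\<^sub>R q' \<in> H'" using e uv by (simp add: H'_def)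
  qed
  moreover have "(x, w x - 1) \<in> H'" by (simp add: H'_def)
  moreover have "H' \<inter> {(x, w x)} = {}" by (auto simp: H'_def)
  ultimately obtain a \<beta> where a: "a \<noteq> 0" "\<forall>q\<in>H'. a \<bullet> q \<le> \<beta>" "\<forall>q\<in>{(x, w x)}. a \<bullet> q \<ge> \<beta>"
    using separating_hyperplane_sets[of H' "{(x, w x)}"] by blast
  obtain p c where pc: "a = (p, c)" by (cases a)
  have sep: "p \<bullet> y + c * t \<le> p \<bullet> x + c * w x" if "t < w y" for y t
  proof -
    have "(y, t) \<in> H'" using that by (simp add: H'_def)
    then show ?thesis using a by (force simp: pc)
  qed
  have "c \<ge> 0" using sep[of "w x - 1" x] by (simp add: algebra_simps)
  moreover have "c \<noteq> 0"
  proof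
    assume c: "c = 0"
    have "p \<bullet> (x + p) \<le> p \<bullet> x" using sep[of "w (x + p) - 1" "x + p"] c by simp
    then have "p \<bullet> p \<le> 0" by (simp add: inner_add_right)
    then have "p = 0" using inner_ge_zero[of p] by (simp add: antisym)
    then show False using a c pc by (simp add: zero_prod_def)
  qed
  ultimately have c: "c > 0" by simp
  have "w y \<le> w x + (- (1 / c) *\<^sub>R p) \<bullet> (y - x)" for y
  proof -
    have "w y \<le> w x - p \<bullet> (y - x) / c"
    proof (rule dense_le)
      fix t assume "t < w y"
      then show "t \<le> w x - p \<bullet> (y - x) / c"
        using sep[of t y] c by (simp add: field_simps inner_diff_right)
    qed
    then show ?thesis by simp
  qed
  then show ?thesis by blast
qed

text \<open>
  The parallelogram law turns semiconcavity of \<open>u\<close> into midpoint concavity of \<open>u - C/2 |y|^2\<close>.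
\<close>

lemma semiconcave_touching_paraboloid:
  fixes u :: "'a::euclidean_space \<Rightarrow> real"
  assumes "semiconcave C u"
  obtains p where "\<And>y. u y \<le> u x + p \<bullet> (y - x) + C / 2 * (norm (y - x))\<^sup>2"
proof -
  define w where "w y = u y - C / 2 * (norm y)\<^sup>2" for y
  have u: "continuous_on UNIV u" "\<And>x y. delta u x y \<le> C * (norm y)\<^sup>2"
    using assms by (auto simp: semiconcave_def)
  have "continuous_on UNIV w" unfolding w_def by (intro continuous_intros u)
  moreover have "w (z + y) + w (z - y) \<le> 2 * w z" for z y
  proof -
    have "(norm (z + y))\<^sup>2 + (norm (z - y))\<^sup>2 = 2 * (norm z)\<^sup>2 + 2 * (norm y)\<^sup>2"
      by (simp add: power2_norm_eq_inner inner_add_left inner_add_right inner_diff_left inner_diff_right)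
    then have "C / 2 * (norm (z + y))\<^sup>2 + C / 2 * (norm (z - y))\<^sup>2 = C * (norm z)\<^sup>2 + C * (norm y)\<^sup>2"
      by (metis (no_types, lifting) distrib_left mult.assoc mult.commute nonzero_mult_div_cancel_left times_divide_eq_right zero_neq_numeral)
    then show ?thesis using u(2)[of z y] by (simp add: w_def delta_def)
  qed
  ultimately obtain p where p: "\<And>y. w y \<le> w x + p \<bullet> (y - x)"
    using midpoint_concave_supergradient[of w x] by blast
  have "u y \<le> u x + (p + C *\<^sub>R x) \<bullet> (y - x) + C / 2 * (norm (y - x))\<^sup>2" for y
  proof -
    have "(norm y)\<^sup>2 = (norm x)\<^sup>2 + 2 * (x \<bullet> (y - x)) + (norm (y - x))\<^sup>2"
      by (simp add: power2_norm_eq_inner inner_diff_left inner_diff_right inner_commute)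
    then have "C / 2 * (norm y)\<^sup>2 = C / 2 * ((norm x)\<^sup>2 + 2 * (x \<bullet> (y - x)) + (norm (y - x))\<^sup>2)"
      by (simp only:)
    also have "\<dots> = C / 2 * (norm x)\<^sup>2 + C * (x \<bullet> (y - x)) + C / 2 * (norm (y - x))\<^sup>2"
      by (simp add: distrib_left)
    finally have "C / 2 * (norm y)\<^sup>2 = C / 2 * (norm x)\<^sup>2 + C * (x \<bullet> (y - x)) + C / 2 * (norm (y - x))\<^sup>2" .
    then show ?thesis using p[of y] unfolding w_def inner_add_left inner_scaleR_left by linarith
  qed
  then show thesis by (rule that)
qed

section \<open>The viscosity inequality holds pointwise\<close>

text \<open>
  The pointwise bound on second differences in the definition of \<open>mu1\<close>: Lipschitz continuity controls
  them at large, semiconcavity at small distances.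
\<close>

definition majorant :: "real \<Rightarrow> real \<Rightarrow> real \<Rightarrow> real" where
  "majorant L C t = min (2 * L * \<bar>t\<bar>) (C * \<bar>t\<bar>\<^sup>2)"

lemma majorant_simps [simp]: "majorant L C 0 = 0" "majorant L C (- t) = majorant L C t"
  by (simp_all add: majorant_def)

lemma borel_measurable_majorant [measurable]: "majorant L C \<in> borel_measurable borel"
  unfolding majorant_def[abs_def] by measurable

lemma delta_le_majorant:
  assumes "L-lipschitz_on UNIV u" "semiconcave C u"
  shows "delta u x y \<le> majorant L C (norm y)"
proof -
  have "\<bar>u (x + y) - u x\<bar> \<le> L * norm y" "\<bar>u (x - y) - u x\<bar> \<le> L * norm y"
    using lipschitz_onD[OF assms(1), of "x + y" x] lipschitz_onD[OF assms(1), of "x - y" x]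
    by (simp_all add: dist_norm)
  then have "delta u x y \<le> 2 * L * norm y" by (simp add: delta_def)
  moreover have "delta u x y \<le> C * (norm y)\<^sup>2" using assms(2) by (simp add: semiconcave_def)
  ultimately show ?thesis by (simp add: majorant_def)
qed

lemma nn_integral_inverse_matrix_kernel:
  fixes A :: "real^'n^'n" and f :: "real^'n \<Rightarrow> real"
  assumes [measurable]: "f \<in> borel_measurable borel" and det: "det A = 1"
  shows "(\<integral>\<^sup>+y. ennreal (f y / norm (matrix_inv A *v y) powr (real CARD('n) + 2 * s)) \<partial>lborel) =
    kernel_integral s (\<lambda>z. f (A *v z))"
proof -
  have "invertible A" using det by (simp add: invertible_det_nz)
  then have "matrix_inv A ** A = mat 1"
    unfolding invertible_def matrix_inv_def by (rule someI2_ex) blast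
  then have "matrix_inv A *v (A *v z) = z" for z
    by (simp add: matrix_vector_mul_assoc)
  then show ?thesis
    unfolding kernel_integral_def
    by (subst nn_integral_matrix_image[of _ A, symmetric]) (simp_all add: det)
qed

lemma L_op_eq_kernel_integral:
  fixes A :: "real^'n^'n" and u :: "real^'n \<Rightarrow> real"
  assumes [measurable]: "u \<in> borel_measurable borel" and det: "det A = 1"
  shows "L_op s A u x = ereal (1/2) *
    (enn2ereal (kernel_integral s (\<lambda>z. delta u x (A *v z))) -
     enn2ereal (kernel_integral s (\<lambda>z. - delta u x (A *v z))))"
proof -
  have m: "(\<lambda>y. delta u x y) \<in> borel_measurable borel" unfolding delta_def by measurable
  then have m': "(\<lambda>y. - delta u x y) \<in> borel_measurable borel" by measurable
  show ?thesis
    unfolding L_op_def ereal_integral_def minus_divide_left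
      nn_integral_inverse_matrix_kernel[OF m det] nn_integral_inverse_matrix_kernel[OF m' det] ..
qed

text \<open>
  With \<open>M = \<infinity>\<close> the difference is \<open>-\<infinity>\<close> unless \<open>P = \<infinity>\<close>, and for \<open>P = \<infinity>\<close> the conclusion is trivial.
  So a lower bound on the difference excludes the bad cases.
\<close>

lemma half_diff_ge_imp_add_le:
  assumes "ereal \<eta> \<le> ereal (1/2) * (enn2ereal P - enn2ereal M)" "\<eta> \<ge> 0"
  shows "M + ennreal (2 * \<eta>) \<le> P"
proof (cases P)
  case (real p)
  show ?thesis
  proof (cases M)
    case (real m)
    then have "\<eta> \<le> (p - m) / 2" using assms \<open>P = ennreal p\<close> \<open>0 \<le> p\<close> by simp
    then show ?thesis using real \<open>P = ennreal p\<close> assms(2)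
      by (simp add: ennreal_leI flip: ennreal_plus)
  next
    case top
    then show ?thesis using assms real by simp
  qed
qed simp

lemma half_diff_le_half_diff:
  assumes "M + Q \<le> P" "P < \<infinity>"
  shows "ereal (1/2) * (enn2ereal Q - enn2ereal M') \<le> ereal (1/2) * (enn2ereal P - enn2ereal M)"
proof -
  obtain p where p: "P = ennreal p" "p \<ge> 0" using assms(2) by (cases P) auto
  have "M < \<infinity>" "Q < \<infinity>" using assms by (auto simp: less_top[symmetric] top_unique)
  then obtain m q where m: "M = ennreal m" "m \<ge> 0" and q: "Q = ennreal q" "q \<ge> 0"
    by (cases M; cases Q) auto
  have "m + q \<le> p" using assms(1) p m q by (simp flip: ennreal_plus)
  then have "ereal (1/2) * ereal q \<le> ereal (1/2) * (ereal p - ereal m)" by simp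
  moreover have "ereal (1/2) * (enn2ereal Q - enn2ereal M') \<le> ereal (1/2) * ereal q"
    using q by (intro ereal_mult_left_mono) (auto intro: ereal_diff_le_self)
  ultimately have "ereal (1/2) * (enn2ereal Q - enn2ereal M') \<le> ereal (1/2) * (ereal p - ereal m)"
    by (rule order_trans[rotated])
  then show ?thesis using p m by simp
qed

lemma C2_closure_paraboloid:
  "C2_closure N (\<lambda>y. a + p \<bullet> (y - x) + c / 2 * (norm (y - x))\<^sup>2)"
  unfolding C2_closure_def
proof (intro exI conjI ballI)
  let ?G = "\<lambda>y. p + c *\<^sub>R (y - x)" and ?H = "\<lambda>y::real^'n. c *\<^sub>R (mat 1 :: real^'n^'n)"
  show "((\<lambda>y. a + p \<bullet> (y - x) + c / 2 * (norm (y - x))\<^sup>2) has_derivative (\<lambda>h. ?G y \<bullet> h)) (at y)" for y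
    unfolding power2_norm_eq_inner
    by (auto intro!: derivative_eq_intros simp: inner_add_left inner_commute algebra_simps)
  have H: "?H y *v h = c *\<^sub>R h" for y h
    by (simp add: scaleR_matrix_vector_assoc[symmetric])
  show "(?G has_derivative (\<lambda>h. ?H y *v h)) (at y)" for y
    unfolding H by (auto intro!: derivative_eq_intros)
  show "continuous_on (closure N) (\<lambda>y. a + p \<bullet> (y - x) + c / 2 * (norm (y - x))\<^sup>2)"
    "continuous_on (closure N) ?G" "continuous_on (closure N) ?H"
    by (intro continuous_intros)+
qed

text \<open>
  That is, \<open>L_A u(x) \<ge> \<eta>\<close> for every admissible matrix. Replacing \<open>u\<close> in a ball of radius \<open>r\<close> by a
  touching paraboloid gives a test function, for which the inequality holds. As \<open>r\<close> tends to 0, the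
  contribution of the paraboloid tends to 0 by dominated convergence, and the negative part of \<open>d\<close>
  outside the ball increases to the negative part of \<open>d\<close>. In particular that negative part turns out
  to be integrable.
\<close>

lemma viscosity_imp_kernel_inequality:
  fixes u :: "real^'n \<Rightarrow> real" and A :: "real^'n^'n"
  assumes s: "s > 0" and \<Omega>: "open \<Omega>" "x \<in> \<Omega>"
    and L: "L > 0" and lip: "L-lipschitz_on UNIV u"
    and C: "C > 0" and semi: "semiconcave C u"
    and visc: "viscosity_D_ge s u (\<lambda>x. \<eta>) \<Omega>" and \<eta>: "\<eta> \<ge> 0"
    and fin: "ray_integral s (majorant L C) 1 < \<infinity>"
    and A: "positive_definite A" "det A = 1"
  shows "kernel_integral s (\<lambda>z. - delta u x (A *v z)) + ennreal (2 * \<eta>) \<le>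
    kernel_integral s (\<lambda>z. delta u x (A *v z))"
proof -
  have contu: "continuous_on UNIV u" using semi by (simp add: semiconcave_def)
  then have [measurable]: "u \<in> borel_measurable borel" by (rule borel_measurable_continuous_onI)
  have mdelta [measurable]: "(\<lambda>z. delta u x (A *v z)) \<in> borel_measurable borel"
    unfolding delta_def by measurable
  let ?k = "\<lambda>z::real^'n. norm z powr (real DIM(real^'n) + 2 * s)"
  let ?P = "kernel_integral s (\<lambda>z. delta u x (A *v z))"
  let ?M = "kernel_integral s (\<lambda>z. - delta u x (A *v z))"
  obtain p where p: "\<And>y. u y \<le> u x + p \<bullet> (y - x) + C / 2 * (norm (y - x))\<^sup>2"
    using semiconcave_touching_paraboloid[OF semi, of x] by blast
  \<comment> \<open>an opening larger than \<open>C\<close>, since the test function has to touch strictly\<close>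
  define c where "c = C + 1"
  have c: "c > C" "c > 0" using C by (simp_all add: c_def)
  define \<psi> where "\<psi> y = u x + p \<bullet> (y - x) + c / 2 * (norm (y - x))\<^sup>2" for y
  \<comment> \<open>The bound \<open>r0 \<le> 1\<close> makes \<open>|y|^2 \<le> |y|\<close> in the ball, so that a multiple of the majorant dominates
      the second difference of the paraboloid there.\<close>
  obtain r0 where r0: "0 < r0" "r0 \<le> 1" "ball x r0 \<subseteq> \<Omega>"
  proof -
    obtain e where "e > 0" "ball x e \<subseteq> \<Omega>" using \<Omega> open_contains_ball by blast
    then show thesis by (intro that[of "min e 1"]) (auto simp: subset_iff)
  qed
  define q where "q r y = (if norm y < r then c * (norm y)\<^sup>2 else 0)" for r and y :: "real^'n"
  define d where "d r y = (if norm y < r then 0 else - delta u x y)" for r and y :: "real^'n"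
  have [measurable]: "(\<lambda>z. q r (A *v z)) \<in> borel_measurable borel" for r
    unfolding q_def by measurable
  have [measurable]: "(\<lambda>z. d r (A *v z)) \<in> borel_measurable borel" for r
    unfolding d_def by measurable
  have truncated: "kernel_integral s (\<lambda>z. d r (A *v z)) + ennreal (2 * \<eta>) \<le>
      kernel_integral s (\<lambda>z. q r (A *v z)) + ?P" if r: "0 < r" "r \<le> r0" for r
  proof -
    define v where "v y = (if y \<in> ball x r then \<psi> y else u y)" for y
    have "D_op s (\<lambda>y. if y \<in> ball x r then \<psi> y else u y) x \<ge> ereal \<eta>"
    proof (rule visc[unfolded viscosity_D_ge_def, THEN conjunct2, rule_format])
      show "C2_closure (ball x r) \<psi>" unfolding \<psi>_def by (rule C2_closure_paraboloid)
      show "ball x r \<subseteq> \<Omega>" using r r0 by (auto simp: subset_iff)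
      show "u y < \<psi> y" if "y \<in> ball x r - {x}" for y
      proof -
        have "C / 2 * (norm (y - x))\<^sup>2 < c / 2 * (norm (y - x))\<^sup>2"
          using c that by (intro mult_strict_right_mono) auto
        then show ?thesis using p[of y] by (simp add: \<psi>_def)
      qed
    qed (use \<Omega> r in \<open>auto simp: \<psi>_def\<close>)
    also have "D_op s (\<lambda>y. if y \<in> ball x r then \<psi> y else u y) x \<le> L_op s A v x"
      unfolding D_op_def v_def by (rule Inf_lower) (use A in blast)
    finally have "ereal \<eta> \<le> L_op s A v x" .
    have [measurable]: "v \<in> borel_measurable borel" unfolding v_def \<psi>_def mem_ball by measurable
    have dv: "delta v x y = (if norm y < r then c * (norm y)\<^sup>2 else delta u x y)" for y
      using r by (simp add: delta_def v_def \<psi>_def dist_norm)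
    have "kernel_integral s (\<lambda>z. - delta v x (A *v z)) + ennreal (2 * \<eta>) \<le>
        kernel_integral s (\<lambda>z. delta v x (A *v z))"
      using \<open>ereal \<eta> \<le> L_op s A v x\<close> \<eta> unfolding L_op_eq_kernel_integral[OF \<open>v \<in> _\<close> A(2)]
      by (rule half_diff_ge_imp_add_le)
    also have "kernel_integral s (\<lambda>z. delta v x (A *v z)) \<le>
        (\<integral>\<^sup>+z. ennreal (q r (A *v z) / ?k z) + ennreal (delta u x (A *v z) / ?k z) \<partial>lborel)"
      unfolding kernel_integral_def
      by (intro nn_integral_mono) (simp add: dv q_def)
    also have "\<dots> = kernel_integral s (\<lambda>z. q r (A *v z)) + ?P"
      unfolding kernel_integral_def by (rule nn_integral_add) measurable
    also have "kernel_integral s (\<lambda>z. - delta v x (A *v z)) = kernel_integral s (\<lambda>z. d r (A *v z))"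
      unfolding kernel_integral_def
    proof (rule nn_integral_cong)
      fix z :: "real^'n"
      show "ennreal (- delta v x (A *v z) / ?k z) = ennreal (d r (A *v z) / ?k z)"
        using c by (simp add: dv d_def ennreal_neg divide_nonpos_nonneg)
    qed
    finally show ?thesis .
  qed
  define r where "r k = r0 / real (Suc k)" for k
  have r: "0 < r k" "r k \<le> r0" for k using r0 by (auto simp: r_def field_simps)
  have rlim: "r \<longlonglongrightarrow> 0"
    unfolding r_def by (rule LIMSEQ_Suc) (rule lim_const_over_n)
  have ev: "\<forall>\<^sub>F k in sequentially. \<not> norm y < r k" if "y \<noteq> 0" for y :: "real^'n"
    using order_tendstoD(2)[OF rlim, of "norm y"] that by (auto elim: eventually_mono)
  have Mlim: "(\<lambda>k. kernel_integral s (\<lambda>z. d (r k) (A *v z))) \<longlonglongrightarrow> ?M"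
    unfolding kernel_integral_def
  proof (rule nn_integral_LIMSEQ)
    show "incseq (\<lambda>k z. ennreal (d (r k) (A *v z) / ?k z))"
    proof (rule incseq_SucI, rule le_funI)
      fix k and z :: "real^'n"
      have "r (Suc k) \<le> r k" using r0 by (simp add: r_def field_simps)
      then show "ennreal (d (r k) (A *v z) / ?k z) \<le> ennreal (d (r (Suc k)) (A *v z) / ?k z)"
        by (simp add: d_def)
    qed
    show "(\<lambda>k. ennreal (d (r k) (A *v z) / ?k z)) \<longlonglongrightarrow> ennreal (- delta u x (A *v z) / ?k z)" for z
    proof (cases "A *v z = 0")
      case True
      have "delta u x 0 = 0" by (simp add: delta_def)
      with True show ?thesis using r(1) by (simp add: d_def)
    next
      case False
      show ?thesis
        by (rule tendsto_eventually, rule eventually_mono[OF ev[OF False]]) (simp add: d_def)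
    qed
  qed measurable
  define B where "B = c / min (2 * L) C"
  have B: "B > 0" using c L C by (simp add: B_def)
  have q_le: "q r y \<le> B * majorant L C (norm y)" if "r \<le> 1" for r y
  proof (cases "norm y < r")
    case True
    then have "(norm y)\<^sup>2 \<le> norm y"
      using that by (simp add: power2_eq_square mult_left_le_one_le)
    then have "2 * L * (norm y)\<^sup>2 \<le> 2 * L * norm y" using L by simp
    moreover have "min (2 * L) C * (norm y)\<^sup>2 \<le> 2 * L * (norm y)\<^sup>2"
      "min (2 * L) C * (norm y)\<^sup>2 \<le> C * (norm y)\<^sup>2"
      by (intro mult_right_mono; simp)+
    ultimately have "min (2 * L) C * (norm y)\<^sup>2 \<le> majorant L C (norm y)" by (simp add: majorant_def)
    then have "B * (min (2 * L) C * (norm y)\<^sup>2) \<le> B * majorant L C (norm y)"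
      using B by (intro mult_left_mono) auto
    moreover have "B * (min (2 * L) C * (norm y)\<^sup>2) = c * (norm y)\<^sup>2" using L C by (simp add: B_def)
    ultimately show ?thesis using True by (simp add: q_def)
  next
    case False
    then show ?thesis using B L C by (simp add: q_def majorant_def)
  qed
  have "(\<lambda>k. kernel_integral s (\<lambda>z. q (r k) (A *v z))) \<longlonglongrightarrow> (\<integral>\<^sup>+z. 0 \<partial>(lborel :: (real^'n) measure))"
    unfolding kernel_integral_def
  proof (rule nn_integral_dominated_convergence[where w="\<lambda>z. ennreal B * ennreal (majorant L C (norm (A *v z)) / ?k z)"])
    show "(\<integral>\<^sup>+z. ennreal B * ennreal (majorant L C (norm (A *v z)) / ?k z) \<partial>lborel) < \<infinity>"
      using kernel_integral_radial_finite[OF _ _ s _ fin, of "(*v) A"]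
      by (subst nn_integral_cmult) (simp_all add: kernel_integral_def ennreal_mult_less_top)
    show "AE z in lborel. ennreal (q (r k) (A *v z) / ?k z) \<le> ennreal B * ennreal (majorant L C (norm (A *v z)) / ?k z)" for k
    proof (rule AE_I2)
      fix z :: "real^'n"
      have "q (r k) (A *v z) / ?k z \<le> B * majorant L C (norm (A *v z)) / ?k z"
        using r[of k] r0 by (intro divide_right_mono q_le) auto
      then show "ennreal (q (r k) (A *v z) / ?k z) \<le> ennreal B * ennreal (majorant L C (norm (A *v z)) / ?k z)"
        using B by (simp add: ennreal_leI flip: ennreal_mult')
    qed
    show "AE z in lborel. (\<lambda>k. ennreal (q (r k) (A *v z) / ?k z)) \<longlonglongrightarrow> 0"
    proof (rule AE_I2)
      fix z :: "real^'n"
      show "(\<lambda>k. ennreal (q (r k) (A *v z) / ?k z)) \<longlonglongrightarrow> 0"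
      proof (cases "A *v z = 0")
        case True
        then show ?thesis using r(1) by (simp add: q_def)
      next
        case False
        show ?thesis
          by (rule tendsto_eventually, rule eventually_mono[OF ev[OF False]]) (simp add: q_def)
      qed
    qed
  qed measurable
  then have Qlim: "(\<lambda>k. kernel_integral s (\<lambda>z. q (r k) (A *v z))) \<longlonglongrightarrow> 0" by simp
  have "?M + ennreal (2 * \<eta>) \<le> 0 + ?P"
  proof (rule LIMSEQ_le[OF tendsto_add[OF Mlim tendsto_const] tendsto_add[OF Qlim tendsto_const]])
    show "\<exists>N. \<forall>k\<ge>N. kernel_integral s (\<lambda>z. d (r k) (A *v z)) + ennreal (2 * \<eta>) \<le>
        kernel_integral s (\<lambda>z. q (r k) (A *v z)) + ?P"
      using truncated[OF r] by blast
  qed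
  then show ?thesis by simp
qed

section \<open>The lower bound along each direction\<close>

text \<open>
  The inequality \<open>p + q \<le> 2 x + 2 m\<close>, rearranged so that only positive parts occur and it can be
  integrated without knowing that the terms are integrable.
\<close>

lemma pos_neg_part_sum_le:
  fixes p q x m :: real
  assumes "p + q \<le> 2 * x + 2 * m" "m \<ge> 0"
  shows "ennreal p + ennreal q + 2 * ennreal (- x) \<le> ennreal (- p) + ennreal (- q) + 2 * ennreal x + 2 * ennreal m"
proof -
  have pos: "ennreal y = ennreal (max 0 y)" for y by (simp add: max_def ennreal_neg)
  have "max 0 p + max 0 q + 2 * max 0 (- x) \<le> max 0 (- p) + max 0 (- q) + 2 * max 0 x + 2 * max 0 m"
    using assms by (simp add: max_def)
  then have "ennreal (max 0 p + max 0 q + 2 * max 0 (- x)) \<le> ennreal (max 0 (- p) + max 0 (- q) + 2 * max 0 x + 2 * max 0 m)"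
    by (rule ennreal_leI)
  then show ?thesis
    unfolding pos[of p] pos[of q] pos[of "- x"] pos[of "- p"] pos[of "- q"] pos[of x] pos[of m]
    by (simp add: ennreal_mult')
qed

lemma kernel_integral_orthogonal_transformation:
  fixes T :: "real^'n \<Rightarrow> real^'n"
  assumes [measurable]: "f \<in> borel_measurable borel" and T: "orthogonal_transformation T"
  shows "kernel_integral s (\<lambda>z. f (T z)) = kernel_integral s f"
proof -
  have "kernel_integral s (\<lambda>z. f (T z)) =
      (\<integral>\<^sup>+z. ennreal (f (T z) / norm (T z) powr (real DIM(real^'n) + 2 * s)) \<partial>lborel)"
    using T by (simp add: kernel_integral_def orthogonal_transformation_norm)
  also have "\<dots> = kernel_integral s f"
    unfolding kernel_integral_def by (rule nn_integral_orthogonal_transformation[OF _ T]) measurable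
  finally show ?thesis .
qed

lemma orthogonal_transformation_axis_reflection:
  fixes b :: "'a::euclidean_space"
  assumes "norm b = 1"
  shows "orthogonal_transformation (\<lambda>z. (2 * (z \<bullet> b)) *\<^sub>R b - z)"
proof -
  have "b \<bullet> b = 1" using assms by (simp add: norm_eq_1)
  then show ?thesis
    unfolding orthogonal_transformation_def
    by (auto intro!: linearI simp: inner_diff_left inner_diff_right inner_add_left inner_commute algebra_simps)
qed

text \<open>
  Second differences of \<open>u\<close> at \<open>x + v\<close> and \<open>x - v\<close> in the direction \<open>w\<close> are added.
\<close>

lemma delta_reflection_average:
  assumes lip: "L-lipschitz_on UNIV u" and semi: "semiconcave C u"
  shows "delta u x (v + w) + delta u x (v - w) \<le> 2 * delta u x v + 2 * majorant L C (norm w)"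
proof -
  have "delta u (x + v) w \<le> majorant L C (norm w)" "delta u (x - v) w \<le> majorant L C (norm w)"
    by (rule delta_le_majorant[OF lip semi])+
  then show ?thesis by (simp add: delta_def algebra_simps)
qed

text \<open>
  In a rotated frame whose \<open>k\<close>-th axis is \<open>e\<close>, the matrix is diagonal with entry \<open>a\<close> in position \<open>k\<close> and \<open>b\<close>
  elsewhere.
\<close>

lemma stretch_matrix:
  fixes e :: "real^'n"
  assumes e: "norm e = 1" and ab: "a > 0" "b > 0" "a * b ^ (CARD('n) - 1) = 1"
  obtains A :: "real^'n^'n" and T :: "real^'n \<Rightarrow> real^'n" and k :: 'n where "positive_definite A" "det A = 1"
    "orthogonal_transformation T" "T (axis k 1) = e"
    "\<And>z. A *v T z = (a * (z \<bullet> axis k 1)) *\<^sub>R e + b *\<^sub>R T (z - (z \<bullet> axis k 1) *\<^sub>R axis k 1)"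
proof -
  obtain k :: 'n where True by simp
  define c where "c = (axis k 1 :: real^'n)"
  obtain T where T: "orthogonal_transformation T" "T c = e"
    using orthogonal_transformation_exists[of c e] e by (auto simp: c_def)
  have Tl: "linear T" using T by (simp add: orthogonal_transformation_linear)
  define Q where "Q = matrix T"
  have Qz: "Q *v z = T z" for z unfolding Q_def using Tl by (simp add: matrix_works)
  have "orthogonal_matrix Q" using T unfolding Q_def by (simp add: orthogonal_transformation_matrix)
  then have QQ: "transpose Q ** Q = mat 1" "Q ** transpose Q = mat 1" by (auto simp: orthogonal_matrix_def)
  define d where "d i = (if i = k then a else b)" for i :: 'n
  define D where "D = (\<chi> i j. if i = j then d i else 0 :: real^'n^'n)"
  have Dz: "D *v z = (a * (z \<bullet> c)) *\<^sub>R c + b *\<^sub>R (z - (z \<bullet> c) *\<^sub>R c)" for z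
  proof -
    have "(D *v z) $ i = d i * z $ i" for i
      by (simp add: D_def matrix_vector_mult_def if_distrib[of "\<lambda>x. x * y" for y] cong: if_cong)
    moreover have "z \<bullet> c = z $ k" by (simp add: c_def inner_axis)
    moreover have "c $ i = (if i = k then 1 else 0)" for i by (simp add: c_def axis_def)
    ultimately show ?thesis by (simp add: vec_eq_iff d_def algebra_simps)
  qed
  define A where "A = Q ** D ** transpose Q"
  have "det D = (\<Prod>i\<in>UNIV. d i)"
    by (subst det_diagonal) (simp_all add: D_def)
  also have "\<dots> = a * b ^ (CARD('n) - 1)"
    by (subst prod.remove[of _ k]) (auto simp: d_def)
  finally have detD: "det D = 1" using ab by simp
  have "det A = det (Q ** transpose Q) * det D" by (simp add: A_def det_mul)
  then have detA: "det A = 1" by (simp add: QQ detD)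
  have "transpose D = D" by (simp add: D_def transpose_def vec_eq_iff)
  then have symA: "transpose A = A"
    by (simp add: A_def matrix_transpose_mul matrix_mul_assoc)
  have posA: "x \<bullet> (A *v x) > 0" if x: "x \<noteq> 0" for x
  proof -
    define y where "y = transpose Q *v x"
    have "Q *v y = x" unfolding y_def matrix_vector_mul_assoc QQ by simp
    then have "y \<noteq> 0" using x by auto
    have "x \<bullet> (A *v x) = y \<bullet> (D *v y)"
    proof -
      have "A *v x = Q *v (D *v y)" by (simp only: A_def y_def matrix_vector_mul_assoc matrix_mul_assoc)
      then have "x \<bullet> (A *v x) = T y \<bullet> T (D *v y)" using \<open>Q *v y = x\<close> by (simp add: Qz)
      then show ?thesis using T by (simp add: orthogonal_transformation_def)
    qed
    also have "\<dots> = a * (y \<bullet> c)\<^sup>2 + b * (norm (y - (y \<bullet> c) *\<^sub>R c))\<^sup>2"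
    proof -
      have "c \<bullet> c = 1" by (simp add: c_def inner_axis_axis)
      then show ?thesis unfolding Dz power2_norm_eq_inner
        by (simp add: inner_add_right inner_diff_left inner_diff_right inner_commute power2_eq_square algebra_simps)
    qed
    also have "\<dots> > 0"
    proof (cases "y \<bullet> c = 0")
      case True
      then show ?thesis using ab \<open>y \<noteq> 0\<close> by simp
    next
      case False
      then show ?thesis using ab by (intro add_pos_nonneg) auto
    qed
    finally show ?thesis .
  qed
  have "A *v T z = (a * (z \<bullet> c)) *\<^sub>R e + b *\<^sub>R T (z - (z \<bullet> c) *\<^sub>R c)" for z
  proof -
    have "A *v T z = Q *v (D *v ((transpose Q ** Q) *v z))"
      by (simp only: A_def Qz[symmetric] matrix_vector_mul_assoc matrix_mul_assoc)
    also have "\<dots> = T (D *v z)" by (simp add: QQ Qz)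
    also have "\<dots> = (a * (z \<bullet> c)) *\<^sub>R e + b *\<^sub>R T (z - (z \<bullet> c) *\<^sub>R c)"
      unfolding Dz by (simp only: linear_add[OF Tl] linear_scale[OF Tl] T(2))
    finally show ?thesis .
  qed
  note image = this
  have "positive_definite A" using symA posA by (simp add: positive_definite_def)
  show thesis
  proof (rule that[of A T k])
    show "positive_definite A" by fact
    show "T (axis k 1) = e" using T(2) by (simp only: c_def)
    show "A *v T z = (a * (z \<bullet> axis k 1)) *\<^sub>R e + b *\<^sub>R T (z - (z \<bullet> axis k 1) *\<^sub>R axis k 1)" for z
      using image[of z] by (simp only: c_def)
  qed (fact detA T(1))+
qed

lemma ray_integral_real_line:
  "ray_integral s (\<lambda>t::real. f (t *\<^sub>R e)) 1 = ray_integral s f e"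
  by (simp add: ray_integral_def)

text \<open>
  The restriction of \<open>u\<close> to every line through \<open>x\<close> satisfies a one-dimensional inequality. Take the matrix
  that scales \<open>e\<close> by \<open>a\<close> and the orthogonal directions by \<open>b\<close>, and average \<open>d\<close> over the
  reflection in the axis \<open>e\<close>. The average is at most the value on the line plus
  the majorant of the orthogonal component. The first term integrates to \<open>2 C2 a^(2s)\<close> times the
  integral along \<open>e\<close>, the second to \<open>2 C1 b^(2s) / (1-s)\<close>, and \<open>b\<close> is chosen so that the latter is
  half of the lower bound \<open>2 \<eta> / (1-s)\<close>.
\<close>

lemma directional_lower_bound:
  fixes u :: "real^'n \<Rightarrow> real" and e :: "real^'n"
  assumes n: "CARD('n) \<ge> 2" and s: "0 < s" "s < 1"
    and L: "L \<ge> 0" and lip: "L-lipschitz_on UNIV u"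
    and C: "C \<ge> 0" and semi: "semiconcave C u" and \<eta>: "\<eta> > 0"
    and mu: "mu1 s L C \<noteq> 0" and e: "norm e = 1"
    and ineq: "\<And>A. positive_definite A \<Longrightarrow> det A = 1 \<Longrightarrow>
      kernel_integral s (\<lambda>z. - delta u x (A *v z)) + ennreal (2 * (\<eta> / (1 - s))) \<le>
      kernel_integral s (\<lambda>z. delta u x (A *v z))"
  shows "mu0 CARD('n) s L C \<eta> > 0"
    and "ray_integral s (\<lambda>y. - delta u x y) e + ennreal (mu0 CARD('n) s L C \<eta> / (1 - s)) \<le>
      ray_integral s (delta u x) e"
proof -
  let ?d = "delta u x"
  define n where "n = CARD('n)"
  have n2: "n \<ge> 2" using n by (simp add: n_def)
  have contu: "continuous_on UNIV u" using semi by (simp add: semiconcave_def)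
  then have [measurable]: "u \<in> borel_measurable borel" by (rule borel_measurable_continuous_onI)
  have dm[measurable]: "?d \<in> borel_measurable borel" unfolding delta_def[abs_def] by measurable
  then have dm'[measurable]: "(\<lambda>y. - ?d y) \<in> borel_measurable borel" by measurable
  have d0: "?d 0 = 0" by (simp add: delta_def)
  have even: "?d (- y) = ?d y" for y by (simp add: delta_def)
  have maj: "ray_integral s (majorant L C) 1 = ennreal (mu1 s L C / (1 - s))" "mu1 s L C > 0"
    using ray_integral_majorant[OF mu s(2) L C] by (simp_all add: majorant_def[abs_def])
  have maj0: "majorant L C t \<ge> 0" for t using L C by (simp add: majorant_def)
  define K1 where "K1 = sqrt pi * Gamma ((real n - 1) / 2 + s) / Gamma (real n / 2 + s) * omega (n - 1)"
  have om: "omega (n - 1) > 0"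
    unfolding omega_def using n2 by (intro divide_pos_pos Gamma_real_pos) auto
  have K1: "K1 > 0" unfolding K1_def using n2 s om
    by (intro mult_pos_pos divide_pos_pos Gamma_real_pos) (auto intro: add_nonneg_pos)
  have C1: "C1 n s L C = K1 * mu1 s L C / 2"
    by (simp add: C1_def K1_def)
  have C1_pos: "C1 n s L C > 0" unfolding C1 using K1 maj(2) by simp
  have C2: "C2 n s > 0" unfolding C2_def using n2 s om
    by (intro mult_pos_pos divide_pos_pos Gamma_real_pos) (auto intro: add_nonneg_pos)
  show mu0: "mu0 CARD('n) s L C \<eta> > 0"
    unfolding n_def[symmetric] mu0_def using C1_pos C2 \<eta> by (intro mult_pos_pos) auto
  \<comment> \<open>\<open>b^(2s) = t\<close> means \<open>C1 b^(2s) = \<eta>/2\<close>, and \<open>a = b^(1-n)\<close> makes the determinant one.\<close>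
  define t where "t = \<eta> / (2 * C1 n s L C)"
  have t: "t > 0" using \<eta> C1_pos by (simp add: t_def)
  define b where "b = t powr (1 / (2 * s))"
  define a where "a = b powr (1 - real n)"
  have ab: "a > 0" "b > 0" using t by (simp_all add: a_def b_def)
  have b2s: "b powr (2 * s) = t" using t s by (simp add: b_def powr_powr)
  have a2s: "a powr (2 * s) = inverse (t ^ (n - 1))"
  proof -
    have "a powr (2 * s) = t powr (1 - real n)"
      unfolding a_def b2s[symmetric] powr_powr by (simp add: mult_ac)
    also have "\<dots> = inverse (t powr real (n - 1))" using n2 by (simp add: powr_minus[symmetric] of_nat_diff)
    finally show ?thesis using t by (simp add: powr_realpow)
  qed
  have "b ^ (n - 1) = b powr real (n - 1)" using ab by (simp add: powr_realpow)
  then have ab1: "a * b ^ (n - 1) = 1" unfolding a_def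
    using ab n2 by (simp add: powr_add[symmetric] of_nat_diff)
  obtain A and T :: "real^'n \<Rightarrow> real^'n" and k where A: "positive_definite A" "det A = 1" and T: "orthogonal_transformation T" "T (axis k 1) = e"
    and AT: "\<And>z. A *v T z = (a * (z \<bullet> axis k 1)) *\<^sub>R e + b *\<^sub>R T (z - (z \<bullet> axis k 1) *\<^sub>R axis k 1)"
    using stretch_matrix[OF e ab ab1[unfolded n_def]] by blast
  define c where "c = (axis k 1 :: real^'n)"
  have c: "norm c = 1" "c \<in> Basis" by (simp_all add: c_def axis_in_Basis_iff)
  \<comment> \<open>\<open>V z\<close> lies on the line of \<open>e\<close> and \<open>W z\<close> is orthogonal to it; the reflection \<open>S\<close> fixes \<open>V\<close> and negates \<open>W\<close>.\<close>
  define V where "V z = (a * (z \<bullet> c)) *\<^sub>R e" for z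
  define W where "W z = b *\<^sub>R T (z - (z \<bullet> c) *\<^sub>R c)" for z
  have Tl: "linear T" using T by (simp add: orthogonal_transformation_linear)
  have [measurable]: "T \<in> borel_measurable borel"
    using Tl by (intro borel_measurable_continuous_onI linear_continuous_on) (simp add: linear_conv_bounded_linear)
  have [measurable]: "V \<in> borel_measurable borel" "W \<in> borel_measurable borel"
    unfolding V_def[abs_def] W_def[abs_def] by measurable
  have nW: "norm (W z) = b * norm (z - (z \<bullet> c) *\<^sub>R c)" for z
    using ab T by (simp add: W_def orthogonal_transformation_norm)
  define S where "S z = (2 * (z \<bullet> c)) *\<^sub>R c - z" for z :: "real^'n"
  have S: "orthogonal_transformation S"
    unfolding S_def[abs_def] by (rule orthogonal_transformation_axis_reflection[OF c(1)])
  have Sc: "S z \<bullet> c = z \<bullet> c" for z using c by (simp add: S_def inner_diff_left norm_eq_1)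
  have VS: "V (S z) = V z" for z by (simp add: V_def Sc)
  have WS: "W (S z) = - W z" for z
  proof -
    have "S z - (S z \<bullet> c) *\<^sub>R c = - (z - (z \<bullet> c) *\<^sub>R c)"
      unfolding Sc by (simp add: S_def scaleR_2 flip: scaleR_scaleR)
    then show ?thesis unfolding W_def by (simp only: linear_neg[OF Tl] scaleR_minus_right)
  qed
  have plus: "kernel_integral s (\<lambda>z. f (V z + W z)) = kernel_integral s (\<lambda>z. f (A *v z))"
    if [measurable]: "f \<in> borel_measurable borel" for f :: "real^'n \<Rightarrow> real"
  proof -
    have "kernel_integral s (\<lambda>z. f (A *v T z)) = kernel_integral s (\<lambda>z. f (A *v z))"
      by (rule kernel_integral_orthogonal_transformation[OF _ T(1)]) measurable
    then show ?thesis unfolding AT V_def W_def c_def .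
  qed
  have minus: "kernel_integral s (\<lambda>z. f (V z - W z)) = kernel_integral s (\<lambda>z. f (A *v z))"
    if [measurable]: "f \<in> borel_measurable borel" for f :: "real^'n \<Rightarrow> real"
  proof -
    have "kernel_integral s (\<lambda>z. f (V (S z) + W (S z))) = kernel_integral s (\<lambda>z. f (V z + W z))"
      by (rule kernel_integral_orthogonal_transformation[OF _ S]) measurable
    then show ?thesis unfolding VS WS plus[OF that] by simp
  qed
  let ?P = "kernel_integral s (\<lambda>z. ?d (A *v z))"
  let ?M = "kernel_integral s (\<lambda>z. - ?d (A *v z))"
  let ?X = "kernel_integral s (\<lambda>z. ?d (V z))"
  let ?N = "kernel_integral s (\<lambda>z. - ?d (V z))"
  let ?E = "kernel_integral s (\<lambda>z. majorant L C (norm (W z)))"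
  let ?k = "\<lambda>z::real^'n. norm z powr (real DIM(real^'n) + 2 * s)"
  have sum1: "?P + ?P + 2 * ?N \<le> ?M + ?M + 2 * ?X + 2 * ?E"
  proof -
    have "?P + ?P + 2 * ?N = (\<integral>\<^sup>+z. ennreal (?d (V z + W z) / ?k z) + ennreal (?d (V z - W z) / ?k z) + 2 * ennreal (- (?d (V z) / ?k z)) \<partial>lborel)"
    proof -
      have "?P + ?P + 2 * ?N = kernel_integral s (\<lambda>z. ?d (V z + W z)) + kernel_integral s (\<lambda>z. ?d (V z - W z)) + 2 * ?N"
        by (simp only: plus[OF dm] minus[OF dm])
      then show ?thesis
        unfolding kernel_integral_def by (simp add: nn_integral_add nn_integral_cmult)
    qed
    also have "\<dots> \<le> (\<integral>\<^sup>+z. ennreal (- (?d (V z + W z) / ?k z)) + ennreal (- (?d (V z - W z) / ?k z)) + 2 * ennreal (?d (V z) / ?k z)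
        + 2 * ennreal (majorant L C (norm (W z)) / ?k z) \<partial>lborel)"
    proof (intro nn_integral_mono pos_neg_part_sum_le)
      fix z :: "real^'n"
      have "(?d (V z + W z) + ?d (V z - W z)) / ?k z \<le> (2 * ?d (V z) + 2 * majorant L C (norm (W z))) / ?k z"
        by (intro divide_right_mono delta_reflection_average lip semi) simp
      then show "?d (V z + W z) / ?k z + ?d (V z - W z) / ?k z \<le> 2 * (?d (V z) / ?k z) + 2 * (majorant L C (norm (W z)) / ?k z)"
        by (simp add: add_divide_distrib)
    qed (simp add: maj0)
    also have "\<dots> = ?M + ?M + 2 * ?X + 2 * ?E"
    proof -
      have "?M + ?M + 2 * ?X + 2 * ?E = kernel_integral s (\<lambda>z. - ?d (V z + W z)) + kernel_integral s (\<lambda>z. - ?d (V z - W z)) + 2 * ?X + 2 * ?E"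
        by (simp only: plus[OF dm'] minus[OF dm'])
      also have "\<dots> = (\<integral>\<^sup>+z. ennreal (- (?d (V z + W z) / ?k z)) + ennreal (- (?d (V z - W z) / ?k z)) + 2 * ennreal (?d (V z) / ?k z)
        + 2 * ennreal (majorant L C (norm (W z)) / ?k z) \<partial>lborel)"
        unfolding kernel_integral_def by (simp add: nn_integral_add nn_integral_cmult)
      finally show ?thesis ..
    qed
    finally show ?thesis .
  qed
  have X: "kernel_integral s (\<lambda>z. f (V z)) = ennreal (2 * C2 n s * a powr (2 * s)) * ray_integral s f e"
    if f[measurable]: "f \<in> borel_measurable borel" and f0: "f 0 = 0" and fe: "\<And>y. f (- y) = f y" for f :: "real^'n \<Rightarrow> real"
  proof -
    have "kernel_integral s (\<lambda>z. f ((z \<bullet> c) *\<^sub>R (a *\<^sub>R e))) = ennreal (2 * C2 DIM(real^'n) s) * ray_integral s (\<lambda>t. f (t *\<^sub>R (a *\<^sub>R e))) 1"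
      using n s f0 fe by (intro kernel_integral_axis c) auto
    also have "ray_integral s (\<lambda>t. f (t *\<^sub>R (a *\<^sub>R e))) 1 = ennreal (a powr (2 * s)) * ray_integral s f e"
      unfolding ray_integral_real_line by (rule ray_integral_scaleR[OF f ab(1)])
    finally show ?thesis
      using C2 by (simp add: V_def n_def ennreal_mult' mult_ac)
  qed
  have E: "?E = ennreal (\<eta> / (1 - s))"
  proof -
    have "?E = ennreal K1 * ray_integral s (\<lambda>r. majorant L C (b * r)) 1"
      unfolding nW using kernel_integral_orthogonal[of "\<lambda>r. majorant L C (b * r)" c s] c n s
      by (simp add: K1_def n_def)
    also have "ray_integral s (\<lambda>r. majorant L C (b * r)) 1 = ray_integral s (majorant L C) (b *\<^sub>R 1)"
      by (simp add: ray_integral_def mult.commute)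
    also have "\<dots> = ennreal (b powr (2 * s)) * ennreal (mu1 s L C / (1 - s))"
      using ray_integral_scaleR[of "majorant L C" b s 1] ab maj by simp
    also have "ennreal K1 * \<dots> = ennreal (K1 * (t * (mu1 s L C / (1 - s))))"
      unfolding b2s by (simp only: ennreal_mult'[OF less_imp_le[OF K1]] ennreal_mult'[OF less_imp_le[OF t]])
    also have "K1 * (t * (mu1 s L C / (1 - s))) = \<eta> / (1 - s)"
      unfolding t_def C1 using K1 maj(2) s by (simp add: field_simps)
    finally show ?thesis .
  qed
  define g where "g = 2 * C2 n s * a powr (2 * s)"
  have g: "g > 0" using C2 ab by (simp add: g_def)
  let ?Rp = "ray_integral s ?d e" and ?Rm = "ray_integral s (\<lambda>y. - ?d y) e"
  have XN: "?X = ennreal g * ?Rp" "?N = ennreal g * ?Rm"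
    using X[of ?d] X[of "\<lambda>y. - ?d y"] d0 even by (simp_all add: g_def)
  have "?Rp \<le> ray_integral s (majorant L C) 1"
  proof (rule ray_integral_mono)
    fix t :: real assume "t > 0"
    then show "?d (t *\<^sub>R e) \<le> majorant L C (t *\<^sub>R 1)"
      using delta_le_majorant[OF lip semi, of x "t *\<^sub>R e"] e by simp
  qed
  then have "?Rp < \<infinity>" using maj by (simp add: order_le_less_trans)
  then obtain Rp where Rp: "?Rp = ennreal Rp" "Rp \<ge> 0" by (cases ?Rp) auto
  have "?P \<le> kernel_integral s (\<lambda>z. majorant L C (norm (A *v z)))"
    unfolding kernel_integral_def
    by (intro nn_integral_mono ennreal_leI divide_right_mono delta_le_majorant lip semi) simp
  also have "\<dots> < \<infinity>" using maj s by (intro kernel_integral_radial_finite) auto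
  finally have Pfin: "?P < \<infinity>" .
  then obtain P where P: "?P = ennreal P" "P \<ge> 0" by (cases ?P) auto
  have MP: "?M + ennreal (2 * (\<eta> / (1 - s))) \<le> ?P" by (rule ineq[OF A])
  then have "?M < \<infinity>" using Pfin by (auto simp: less_top[symmetric] top_unique)
  then obtain M where M: "?M = ennreal M" "M \<ge> 0" by (cases ?M) auto
  define h where "h = \<eta> / (1 - s)"
  have h: "h > 0" using \<eta> s by (simp add: h_def)
  have "M + 2 * h \<le> P"
  proof -
    have "ennreal (M + 2 * h) \<le> ennreal P"
      using MP unfolding M P h_def[symmetric] using M h by (subst ennreal_plus) auto
    then show ?thesis using P by (simp add: ennreal_le_iff)
  qed
  \<comment> \<open>Collecting the terms known to be finite in one real number bounds the remaining integral \<open>?Rm\<close>;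
      the cancellation then takes place in the reals.\<close>
  have comb: "ennreal (p + q + 2 * (g * r) + 2 * h') = ennreal p + ennreal q + 2 * (ennreal g * ennreal r) + 2 * ennreal h'"
    if "p \<ge> 0" "q \<ge> 0" "r \<ge> 0" "h' \<ge> 0" for p q r h'
    using that g by (simp add: ennreal_mult')
  have sum2: "ennreal P + ennreal P + 2 * (ennreal g * ?Rm) \<le> ennreal (M + M + 2 * (g * Rp) + 2 * h)"
    using sum1 h unfolding P M XN E Rp h_def[symmetric] comb[OF M(2) M(2) Rp(2) less_imp_le[OF h]] by simp
  have "2 * (ennreal g * ?Rm) \<le> ennreal P + ennreal P + 2 * (ennreal g * ?Rm)" by simp
  also have "\<dots> < \<infinity>" using sum2 by (rule order_le_less_trans) simp
  finally have "?Rm < \<infinity>" using g by (auto simp: ennreal_mult_less_top)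
  then obtain Rm where Rm: "?Rm = ennreal Rm" "Rm \<ge> 0" by (cases ?Rm) auto
  have "ennreal (P + P + 2 * (g * Rm) + 2 * 0) \<le> ennreal (M + M + 2 * (g * Rp) + 2 * h)"
    using sum2 unfolding Rm comb[OF P(2) P(2) Rm(2) order_refl] by simp
  then have "P + P + 2 * (g * Rm) \<le> M + M + 2 * (g * Rp) + 2 * h"
    by (subst (asm) ennreal_le_iff) (use M Rp g h in \<open>auto intro!: add_nonneg_nonneg\<close>)
  then have "g * Rm + h \<le> g * Rp" using \<open>M + 2 * h \<le> P\<close> by linarith
  then have "g * (Rm + h / g) \<le> g * Rp" using g by (simp add: distrib_left)
  then have fin: "Rm + h / g \<le> Rp" using g by simp
  have "h / g = mu0 CARD('n) s L C \<eta> / (1 - s)"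
  proof -
    have "n = Suc (n - 1)" using n2 by simp
    then have p: "(\<eta> / 2) ^ n = \<eta> / 2 * (\<eta> / 2) ^ (n - 1)" by (metis power_Suc)
    have pi: "C1 n s L C powi (1 - int n) = inverse (C1 n s L C ^ (n - 1))"
      using n2 by (simp add: power_int_def nat_diff_distrib power_inverse)
    have "h / g = \<eta> / (1 - s) * t ^ (n - 1) / (2 * C2 n s)"
      unfolding h_def g_def a2s by (simp only: divide_inverse inverse_mult_distrib inverse_inverse_eq mult_ac)
    also have "t = \<eta> / 2 * inverse (C1 n s L C)"
      unfolding t_def by (simp only: divide_inverse inverse_mult_distrib mult_ac)
    also have "(\<eta> / 2 * inverse (C1 n s L C)) ^ (n - 1) = (\<eta> / 2) ^ (n - 1) * inverse (C1 n s L C ^ (n - 1))"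
      by (simp only: power_mult_distrib power_inverse)
    finally show ?thesis
      unfolding n_def[symmetric] mu0_def p pi
      by (simp only: divide_inverse inverse_mult_distrib mult_ac)
  qed
  then have "ennreal (Rm + mu0 CARD('n) s L C \<eta> / (1 - s)) \<le> ennreal Rp"
    using fin by (simp add: ennreal_leI)
  then show "?Rm + ennreal (mu0 CARD('n) s L C \<eta> / (1 - s)) \<le> ?Rp"
    unfolding Rm Rp using Rm mu0 s by (subst (asm) ennreal_plus) auto
qed

section \<open>Degenerate matrices do not lower the infimum\<close>

lemma positive_definite_mat_1: "positive_definite (mat 1 :: real^'n^'n)"
  by (simp add: positive_definite_def transpose_mat)

lemma lambda_min_mat_1: "lambda_min (mat 1 :: real^'n^'n) = 1"
proof -
  have "eigenvalue (mat 1 :: real^'n^'n) l \<longleftrightarrow> l = 1" for l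
  proof
    assume "eigenvalue (mat 1 :: real^'n^'n) l"
    then obtain v :: "real^'n" where "v \<noteq> 0" "v = l *\<^sub>R v" by (auto simp: eigenvalue_def)
    then have "(1 - l) *\<^sub>R v = 0" by (simp add: scaleR_left_diff_distrib)
    then show "l = 1" using \<open>v \<noteq> 0\<close> by simp
  next
    have "axis undefined 1 \<noteq> (0 :: real^'n)" by (simp add: axis_eq_0_iff)
    then show "eigenvalue (mat 1 :: real^'n^'n) l" if "l = 1" using that by (auto simp: eigenvalue_def)
  qed
  then show ?thesis by (simp add: lambda_min_def)
qed

text \<open>
  Integrating the directional bounds against the Gaussian bounds \<open>2 L_A u(x)\<close> from below by
  \<open>m/(1-s)\<close> times the moment of \<open>|A z|^(2s)\<close>, and \<open>2 L_I u(x)\<close> from above by \<open>mu1/(1-s)\<close> times the moment of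
  \<open>|z|^(2s)\<close>, up to the same constant. The stretch in the direction \<open>w\<close> makes the first moment at
  least \<open>\<Lambda>^(2s) / n\<close> times the second.
\<close>

lemma L_op_identity_le:
  fixes u :: "real^'n \<Rightarrow> real" and A :: "real^'n^'n"
  assumes s: "1/2 < s" "s < 1"
    and L: "L \<ge> 0" and lip: "L-lipschitz_on UNIV u"
    and C: "C \<ge> 0" and semi: "semiconcave C u"
    and mu: "mu1 s L C \<noteq> 0" and m: "m > 0"
    and dir: "\<And>e. norm e = 1 \<Longrightarrow>
      ray_integral s (\<lambda>y. - delta u x y) e + ennreal (m / (1 - s)) \<le> ray_integral s (delta u x) e"
    and A: "det A = 1"
    and w: "norm w = 1" "\<Lambda> > 0" "\<And>z. \<Lambda> * \<bar>z \<bullet> w\<bar> \<le> norm (A *v z)"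
    and large: "real CARD('n) * mu1 s L C \<le> m * \<Lambda> powr (2 * s)"
  shows "L_op s (mat 1) u x \<le> L_op s A u x"
proof -
  let ?d = "delta u x"
  have contu: "continuous_on UNIV u" using semi by (simp add: semiconcave_def)
  then have um[measurable]: "u \<in> borel_measurable borel" by (rule borel_measurable_continuous_onI)
  have [measurable]: "?d \<in> borel_measurable borel" unfolding delta_def[abs_def] by measurable
  have [measurable]: "(sgn :: real^'n \<Rightarrow> real^'n) \<in> borel_measurable borel"
    unfolding sgn_div_norm[abs_def] by measurable
  have d0: "?d 0 = 0" by (simp add: delta_def)
  have s0: "s > 0" using s by simp
  have maj: "ray_integral s (majorant L C) 1 = ennreal (mu1 s L C / (1 - s))" "mu1 s L C > 0"
    using ray_integral_majorant[OF mu s(2) L C] by (simp_all add: majorant_def[abs_def])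
  define \<kappa> where "\<kappa> = Gamma (real DIM(real^'n) / 2 + s) / 2"
  have \<kappa>: "\<kappa> > 0" unfolding \<kappa>_def using s0 by (intro divide_pos_pos Gamma_real_pos) (auto intro: add_nonneg_pos)
  let ?P = "kernel_integral s (\<lambda>z. ?d (A *v z))"
  let ?M = "kernel_integral s (\<lambda>z. - ?d (A *v z))"
  let ?I = "kernel_integral s (\<lambda>z. ?d (mat 1 *v z))"
  let ?GA = "\<integral>\<^sup>+z. ennreal (exp (- (norm (z::real^'n))\<^sup>2) * norm (A *v z) powr (2 * s)) \<partial>lborel"
  let ?G = "\<integral>\<^sup>+z. ennreal (exp (- (norm (z::real^'n))\<^sup>2) * norm z powr (2 * s)) \<partial>lborel"
  let ?Gw = "\<integral>\<^sup>+z. ennreal (exp (- (norm (z::real^'n))\<^sup>2) * \<bar>z \<bullet> w\<bar> powr (2 * s)) \<partial>lborel"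
  define c where "c = m / (1 - s)"
  have c: "c > 0" using m s by (simp add: c_def)
  have "ennreal \<kappa> * ?M + ?GA * ennreal c \<le> ennreal \<kappa> * ?P"
  proof -
    let ?e = "\<lambda>z::real^'n. ennreal (exp (- (norm z)\<^sup>2))"
    let ?p = "\<lambda>z::real^'n. ennreal (norm (A *v z) powr (2 * s))"
    have "ennreal \<kappa> * ?M + ?GA * ennreal c =
      (\<integral>\<^sup>+z. ?e z * (?p z * ray_integral s (\<lambda>y. - ?d y) (sgn (A *v z))) \<partial>lborel) +
      (\<integral>\<^sup>+z. ennreal (exp (- (norm (z::real^'n))\<^sup>2) * norm (A *v z) powr (2 * s)) * ennreal c \<partial>lborel)"
      unfolding \<kappa>_def
      by (subst kernel_integral_linear_image[where f="\<lambda>y. - ?d y"]) (simp_all add: d0 s0 nn_integral_multc)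
    also have "\<dots> = (\<integral>\<^sup>+z. ?e z * (?p z * ray_integral s (\<lambda>y. - ?d y) (sgn (A *v z))) +
      ennreal (exp (- (norm (z::real^'n))\<^sup>2) * norm (A *v z) powr (2 * s)) * ennreal c \<partial>lborel)"
      by (rule nn_integral_add[symmetric]) measurable
    also have "\<dots> \<le> (\<integral>\<^sup>+z. ?e z * (?p z * ray_integral s ?d (sgn (A *v z))) \<partial>lborel)"
    proof (rule nn_integral_mono)
      fix z :: "real^'n"
      have "?e z * (?p z * ray_integral s (\<lambda>y. - ?d y) (sgn (A *v z))) +
          ennreal (exp (- (norm z)\<^sup>2) * norm (A *v z) powr (2 * s)) * ennreal c =
          ?e z * (?p z * (ray_integral s (\<lambda>y. - ?d y) (sgn (A *v z)) + ennreal c))"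
        by (simp add: distrib_left ennreal_mult' mult.assoc)
      also have "\<dots> \<le> ?e z * (?p z * ray_integral s ?d (sgn (A *v z)))"
      proof (cases "A *v z = 0")
        case False
        then show ?thesis
          unfolding c_def by (intro mult_left_mono dir) (simp_all add: norm_sgn)
      qed simp
      finally show "?e z * (?p z * ray_integral s (\<lambda>y. - ?d y) (sgn (A *v z))) +
          ennreal (exp (- (norm z)\<^sup>2) * norm (A *v z) powr (2 * s)) * ennreal c \<le>
          ?e z * (?p z * ray_integral s ?d (sgn (A *v z)))" .
    qed
    also have "\<dots> = ennreal \<kappa> * ?P"
      unfolding \<kappa>_def
      by (subst kernel_integral_linear_image[where f="?d"]) (simp_all add: d0 s0)
    finally show ?thesis .
  qed
  moreover have "ennreal \<kappa> * ?I \<le> ?GA * ennreal c"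
  proof -
    have "?I \<le> kernel_integral s (\<lambda>z. majorant L C (norm (z::real^'n)))"
      unfolding kernel_integral_def
      by (intro nn_integral_mono ennreal_leI divide_right_mono) (simp_all add: delta_le_majorant[OF lip semi])
    then have "ennreal \<kappa> * ?I \<le> ennreal \<kappa> * kernel_integral s (\<lambda>z. majorant L C (norm (z::real^'n)))"
      by (rule mult_left_mono) simp
    also have "\<dots> = ?G * ennreal (mu1 s L C / (1 - s))"
      using kernel_integral_radial_linear_image[of "majorant L C" s "\<lambda>z::real^'n. z"] s0 maj
      by (simp add: \<kappa>_def linear_id[unfolded id_def])
    also have "\<dots> \<le> (of_nat CARD('n) * ?Gw) * ennreal (mu1 s L C / (1 - s))"
      by (intro mult_right_mono gaussian_moment_direction w s s0) simp
    also have "\<dots> = ?Gw * ennreal (real CARD('n) * mu1 s L C / (1 - s))"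
    proof -
      have "ennreal (real CARD('n) * mu1 s L C / (1 - s)) = of_nat CARD('n) * ennreal (mu1 s L C / (1 - s))"
        by (simp only: ennreal_of_nat_eq_real_of_nat ennreal_mult'[OF of_nat_0_le_iff] times_divide_eq_right[symmetric])
      then show ?thesis by (simp only: mult_ac)
    qed
    also have "\<dots> \<le> ?Gw * ennreal (\<Lambda> powr (2 * s) * c)"
      using large s by (intro mult_left_mono ennreal_leI) (simp_all add: c_def divide_right_mono mult.commute)
    also have "\<dots> = (ennreal (\<Lambda> powr (2 * s)) * ?Gw) * ennreal c"
      by (subst ennreal_mult') (simp_all only: powr_ge_zero mult_ac)
    also have "ennreal (\<Lambda> powr (2 * s)) * ?Gw \<le> ?GA"
    proof -
      have "ennreal (\<Lambda> powr (2 * s)) * ?Gw =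
          (\<integral>\<^sup>+z. ennreal (\<Lambda> powr (2 * s)) * ennreal (exp (- (norm (z::real^'n))\<^sup>2) * \<bar>z \<bullet> w\<bar> powr (2 * s)) \<partial>lborel)"
        by (rule nn_integral_cmult[symmetric]) measurable
      also have "\<dots> \<le> ?GA"
      proof (rule nn_integral_mono)
        fix z :: "real^'n"
        have "\<Lambda> powr (2 * s) * \<bar>z \<bullet> w\<bar> powr (2 * s) = (\<Lambda> * \<bar>z \<bullet> w\<bar>) powr (2 * s)"
          using w(2) by (simp add: powr_mult)
        also have "\<dots> \<le> norm (A *v z) powr (2 * s)"
          using w s0 by (intro powr_mono2) auto
        finally have "exp (- (norm z)\<^sup>2) * (\<Lambda> powr (2 * s) * \<bar>z \<bullet> w\<bar> powr (2 * s)) \<le>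
            exp (- (norm z)\<^sup>2) * norm (A *v z) powr (2 * s)"
          by (rule mult_left_mono) simp
        then show "ennreal (\<Lambda> powr (2 * s)) * ennreal (exp (- (norm z)\<^sup>2) * \<bar>z \<bullet> w\<bar> powr (2 * s)) \<le>
            ennreal (exp (- (norm z)\<^sup>2) * norm (A *v z) powr (2 * s))"
          by (simp add: mult.left_commute ennreal_leI flip: ennreal_mult')
      qed
      finally show ?thesis .
    qed
    finally show ?thesis by (simp add: mult_right_mono)
  qed
  ultimately have "ennreal \<kappa> * (?M + ?I) \<le> ennreal \<kappa> * ?P"
    by (simp add: distrib_left) (meson add_left_mono order_trans)
  then have le: "?M + ?I \<le> ?P"
    using \<kappa> by (simp add: ennreal_mult_le_mult_iff)
  have "?P \<le> kernel_integral s (\<lambda>z. majorant L C (norm (A *v z)))"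
    unfolding kernel_integral_def
    by (intro nn_integral_mono ennreal_leI divide_right_mono delta_le_majorant[OF lip semi]) simp
  also have "\<dots> < \<infinity>" using maj s0 by (intro kernel_integral_radial_finite) auto
  finally show ?thesis
    unfolding L_op_eq_kernel_integral[OF um A] L_op_eq_kernel_integral[OF um det_I]
    using le by (rule half_diff_le_half_diff[rotated])
qed

theorem theorem3p1:
  fixes u :: "real ^ 'n \<Rightarrow> real" and \<Omega> :: "(real ^ 'n) set"
    and s L C \<eta>\<^sub>0 \<theta> :: real
  assumes "CARD('n) \<ge> 2"
    and "1/2 < s" and "s < 1"
    and "open \<Omega>"
    and "L > 0" and "L-lipschitz_on UNIV u"
    and "C > 0" and "semiconcave C u"
    and "\<eta>\<^sub>0 > 0"
    and "viscosity_D_ge s u (\<lambda>x. \<eta>\<^sub>0 / (1 - s)) \<Omega>"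
    and "0 < \<theta>"
    and "\<theta> < (mu0 CARD('n) s L C \<eta>\<^sub>0 / (real CARD('n) * mu1 s L C))
               powr ((real CARD('n) - 1) / (2 * s))"
  shows "\<forall>x\<in>\<Omega>. D_op s u x = D_op_theta s \<theta> u x"
proof
  fix x assume x: "x \<in> \<Omega>"
  define n where "n = CARD('n)"
  define m where "m = mu0 n s L C \<eta>\<^sub>0"
  define \<rho> where "\<rho> = m / (real n * mu1 s L C)"
  have n2: "n \<ge> 2" using assms(1) by (simp add: n_def)
  have s0: "s > 0" using assms(2) by simp
  have \<theta>: "\<theta> < \<rho> powr ((real n - 1) / (2 * s))"
    using assms(12) by (simp add: \<rho>_def m_def n_def)
  \<comment> \<open>If \<open>mu1\<close> were 0, then the bound on \<open>\<theta>\<close> would be 0, by the conventions \<open>a / 0 = 0\<close> and \<open>0 powr a = 0\<close>.\<close>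
  have mu: "mu1 s L C \<noteq> 0"
  proof
    assume "mu1 s L C = 0"
    then have "\<rho> = 0" by (simp add: \<rho>_def)
    then show False using \<theta> assms(11) by simp
  qed
  have maj: "ray_integral s (majorant L C) 1 = ennreal (mu1 s L C / (1 - s))" "mu1 s L C > 0"
    using ray_integral_majorant[OF mu] assms(3,5,7) by (simp_all add: majorant_def[abs_def])
  have ineq: "kernel_integral s (\<lambda>z. - delta u x (A *v z)) + ennreal (2 * (\<eta>\<^sub>0 / (1 - s))) \<le>
      kernel_integral s (\<lambda>z. delta u x (A *v z))" if "positive_definite A" "det A = 1" for A
    using assms maj x s0 that by (intro viscosity_imp_kernel_inequality[where \<Omega>=\<Omega> and L=L and C=C]) auto
  have dir: "m > 0" "ray_integral s (\<lambda>y. - delta u x y) e + ennreal (m / (1 - s)) \<le> ray_integral s (delta u x) e"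
    if "norm e = 1" for e
    unfolding m_def n_def
    using directional_lower_bound[OF assms(1) s0 assms(3) less_imp_le[OF assms(5)] assms(6)
        less_imp_le[OF assms(7)] assms(8,9) mu that ineq] by simp_all
  obtain e :: "real^'n" where e: "norm e = 1" using norm_axis_1 by blast
  have m: "m > 0" using dir(1)[OF e] .
  \<comment> \<open>The two bounds along any one direction give \<open>mu0 \<le> mu1\<close>, hence \<open>\<theta> \<le> 1\<close>.\<close>
  have "ennreal (m / (1 - s)) \<le> ray_integral s (\<lambda>y. - delta u x y) e + ennreal (m / (1 - s))" by simp
  also have "\<dots> \<le> ray_integral s (delta u x) e" by (rule dir(2)[OF e])
  also have "\<dots> \<le> ray_integral s (majorant L C) 1"
  proof (rule ray_integral_mono)
    fix t :: real assume "t > 0"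
    then show "delta u x (t *\<^sub>R e) \<le> majorant L C (t *\<^sub>R 1)"
      using delta_le_majorant[OF assms(6,8), of x "t *\<^sub>R e"] e by simp
  qed
  finally have "m \<le> mu1 s L C"
    using maj assms(3) by (simp add: ennreal_le_iff divide_le_cancel)
  then have "m \<le> real n * mu1 s L C"
    using maj(2) n2 by (smt (verit) mult_le_cancel_right1 of_nat_1 of_nat_le_iff numeral_le_one_iff one_le_numeral order_trans)
  then have \<rho>: "0 < \<rho>" "\<rho> \<le> 1" using m maj(2) n2 by (simp_all add: \<rho>_def)
  then have "\<rho> powr ((real n - 1) / (2 * s)) \<le> 1" using n2 s0 by (intro powr_le1) auto
  then have \<theta>1: "\<theta> \<le> 1" using \<theta> by simp
  have "D_op_theta s \<theta> u x \<le> L_op s A u x" if A: "positive_definite A" "det A = 1" for A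
  proof (cases "lambda_min A \<ge> \<theta>")
    case True
    then show ?thesis unfolding D_op_theta_def using A by (intro Inf_lower) blast
  next
    case False
    obtain w \<Lambda> where w: "norm w = 1" "\<Lambda> > 0" "\<And>z. \<Lambda> * \<bar>z \<bullet> w\<bar> \<le> norm (A *v z)"
      and l: "lambda_min A > 0" "1 \<le> lambda_min A * \<Lambda> ^ (n - 1)"
      using det_one_eigenvalue_stretch[OF A] unfolding n_def by blast
    have less: "lambda_min A * \<Lambda> ^ (n - 1) < \<rho> powr ((real n - 1) / (2 * s)) * \<Lambda> ^ (n - 1)"
      using False \<theta> w(2) by (intro mult_strict_right_mono) auto
    have "\<Lambda> ^ (n - 1) = \<Lambda> powr (real n - 1)"
      using w(2) n2 powr_realpow[of \<Lambda> "n - 1"] by (simp add: of_nat_diff)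
    then have "1 < \<rho> powr ((real n - 1) / (2 * s)) * \<Lambda> powr (real n - 1)"
      using le_less_trans[OF l(2) less] by (simp only:)
    then have "1 powr (2 * s / (real n - 1)) \<le>
        (\<rho> powr ((real n - 1) / (2 * s)) * \<Lambda> powr (real n - 1)) powr (2 * s / (real n - 1))"
      using n2 s0 by (intro powr_mono2) auto
    also have "\<dots> = \<rho> * \<Lambda> powr (2 * s)"
      using n2 s0 \<rho> w(2) by (simp add: powr_mult powr_powr)
    finally have "1 \<le> \<rho> * \<Lambda> powr (2 * s)" by simp
    then have "real CARD('n) * mu1 s L C \<le> m * \<Lambda> powr (2 * s)"
      using maj(2) n2 unfolding \<rho>_def n_def[symmetric] by (simp add: field_simps)
    then have "L_op s (mat 1) u x \<le> L_op s A u x"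
      using assms(5,7) by (intro L_op_identity_le[OF assms(2,3) _ assms(6) _ assms(8) mu m dir(2) A(2) w]) auto
    moreover have "D_op_theta s \<theta> u x \<le> L_op s (mat 1) u x"
      unfolding D_op_theta_def
    proof (rule Inf_lower, rule CollectI, intro exI conjI)
      show "\<theta> \<le> lambda_min (mat 1 :: real^'n^'n)" using \<theta>1 by (simp add: lambda_min_mat_1)
    qed (simp_all add: positive_definite_mat_1)
    ultimately show ?thesis by (rule order_trans[rotated])
  qed
  then have "D_op_theta s \<theta> u x \<le> D_op s u x"
    unfolding D_op_def by (intro Inf_greatest) blast
  moreover have "D_op s u x \<le> D_op_theta s \<theta> u x"
    unfolding D_op_def D_op_theta_def by (rule Inf_superset_mono) blast
  ultimately show "D_op s u x = D_op_theta s \<theta> u x" by (rule antisym[rotated])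
qed

end
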